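(* Let $(I,g)=(f_1,\dots,f_n,g)$ be a generic ideal of type $(n+1;d_1,\dots,d_n,d)$ in $R'=K[x_1,\dots,x_n,z]$, where $I=(f_1,\dots,f_n)$, $d_1\le\cdots\le d_n\le d$ and $d<\delta:=d_1+\cdots+d_n-n$. Let $B$ be the set of standard monomials with respect to $J=\pi(I)$, and $a_i=|B_i|$. (1) If $\delta-d=2k$ with $k$ a positive integer, then there are subsets $S_i\subseteq\{1,2,\dots,a_{d+i}\}$ with exactly $a_i$ elements, $i=1,\dots,k$, such that $$\operatorname{in}(I,g)=\bigl(\operatorname{in}(I),\ \mathbf{B}_d^{\{1\}},\ \mathbf{B}_{d+1}^{S_1},\ \mathbf{B}_{d+2}^{S_2},\dots,\mathbf{B}_{d+k}^{S_k},\ z^2B_{d+k-1},\ z^4B_{d+k-2},\dots,z^{2(d+k)}B_0\bigr),$$ where the last sets are $z^{2j}B_{d+k-j}$ for $1\le j\le d+k$. (2) If $\delta-d=2k+1$ with $k$ a positive integer, then there are subsets $S_i\subseteq\{1,2,\dots,a_{d+i}\}$ with exactly $a_i$ elements, $i=1,\dots,k$, such that $$\operatorname{in}(I,g)=\bigl(\operatorname{in}(I),\ \mathbf{B}_d^{\{1\}},\ \mathbf{B}_{d+1}^{S_1},\dots,\mathbf{B}_{d+k}^{S_k},\ B_{d+k+1},\ zB_{d+k},\ z^3B_{d+k-1},\dots,z^{2(d+k)+1}B_0\bigr),$$ where the last sets are $z^{2j+1}B_{d+k-j}$ for $0\le j\le d+k$. (3) If $\delta-d=1$, then $$\operatorname{in}(I,g)=\bigl(\operatorname{in}(I),\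 \mathbf{B}_d^{\{1\}},\ B_{d+1},\ zB_d,\ z^3B_{d-1},\dots,z^{2d+1}B_0\bigr),$$ where the last sets are $z^{2j+1}B_{d-j}$ for $0\le j\le d$.
   Context: $K$ is an infinite field that is an extension of a base field $F$. A form of degree $e$ in a polynomial ring over $K$ is generic over $F$ if it is a linear combination of all monomials of degree $e$ with coefficients algebraically independent over $F$. A homogeneous ideal is generic of type $(m;e_1,\dots,e_r)$ if it is generated by generic forms of degrees $e_1,\dots,e_r$ in a polynomial ring in $m$ variables over $K$ such that all coefficients of all these forms taken together are algebraically independent over $F$. Here $n\ge1$ and the degrees are positive integers. Initial ideals $\operatorname{in}(\cdot)$ are taken with respect to the degree reverse lexicographic order with $x_1>\cdots>x_n>z$ on $R'$ and $x_1>\cdots>x_n$ on $R=K[x_1,\dots,x_n]\subset R'$. $\pi:R'\to R$ is the $K$-algebra homomorphism with $\pi(x_i)=x_i$ and $\pi(z)=0$; $J=\pi(I)$ is a generic ideal of type $(n;d_1,\dots,d_n)$ in $R$. The set $B$ of standard monomials with respect to $J$ is the set of monomials of $R$ not in $\operatorname{in}(J)$; $B_i$ is the set of degree-$i$ elements of $B$. For a finite set $C$ of monomials listed in decreasing order as $\mathbf{C}=\{x^{\alpha_1},x^{\alpha_2},\dots,x^{\alpha_m}\}$ and $S\subseteq\{1,\dots,m\}$, $\mathbf{C}^S=\{x^{\alpha_i}: i\in S\}$. For a set of monomials $C$, $z^jC=\{z^jc: c\in C\}$. An ideal written with sets of monomials in its list of generators is generated by the union of those sets (together with $\operatorname{in}(I)$).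 *)

theory Defs
  imports "HOL-Algebra.Algebraic_Closure_Type" "HOL-Library.Poly_Mapping"
begin

text \<open>
  A monomial is identified with its exponent vector, and a polynomial with the finitely supported
  map from exponent vectors to coefficients. The variables of a polynomial ring in \<open>m\<close> variables
  are indexed by \<open>1, \<dots>, m\<close>. For \<open>R' = K[x\<^sub>1, \<dots>, x\<^sub>n, z]\<close> the variable \<open>z\<close> has index \<open>n + 1\<close>, so
  that \<open>R = K[x\<^sub>1, \<dots>, x\<^sub>n]\<close> is literally a subset of \<open>R'\<close>.
\<close>

type_synonym 'i expo = "'i \<Rightarrow>\<^sub>0 nat"
type_synonym ('i, 'a) mpoly = "'i expo \<Rightarrow>\<^sub>0 'a"

definition monomials :: "nat \<Rightarrow> nat expo set" where
  "monomials m = {a. Poly_Mapping.keys a \<subseteq> {1..m}}"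

definition mdeg :: "'i expo \<Rightarrow> nat" where
  "mdeg a = (\<Sum>i\<in>Poly_Mapping.keys a. Poly_Mapping.lookup a i)"

definition mono_poly :: "'i expo \<Rightarrow> ('i, 'a::comm_ring_1) mpoly" where
  "mono_poly a = Poly_Mapping.single a 1"

definition poly_const :: "'a::comm_ring_1 \<Rightarrow> ('i, 'a) mpoly" where
  "poly_const c = Poly_Mapping.single 0 c"

definition poly_var :: "'i \<Rightarrow> ('i, 'a::comm_ring_1) mpoly" where
  "poly_var i = mono_poly (Poly_Mapping.single i 1)"

definition mpoly_ring :: "nat \<Rightarrow> (nat, 'a::comm_ring_1) mpoly ring" where
  "mpoly_ring m = ring_of_type_algebra\<lparr>carrier := {p. Poly_Mapping.keys p \<subseteq> monomials m}\<rparr>"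

definition forms :: "nat \<Rightarrow> nat \<Rightarrow> (nat, 'a::comm_ring_1) mpoly set" where
  "forms m e = {p. Poly_Mapping.keys p \<subseteq> {a \<in> monomials m. mdeg a = e}}"

text \<open>Evaluation at \<open>c\<close>, with the coefficients mapped along \<open>\<phi>\<close>.\<close>

definition poly_eval ::
  "('a::comm_ring_1 \<Rightarrow> 'b::comm_ring_1) \<Rightarrow> ('i \<Rightarrow> 'b) \<Rightarrow> ('i, 'a) mpoly \<Rightarrow> 'b" where
  "poly_eval \<phi> c p =
     (\<Sum>a\<in>Poly_Mapping.keys p. \<phi> (Poly_Mapping.lookup p a) *
        (\<Prod>i\<in>Poly_Mapping.keys a. c i ^ Poly_Mapping.lookup a i))"

text \<open>
  Algebraic independence of the family \<open>(c i)\<^sub>i\<^sub>\<in>\<^sub>A\<close> over \<open>F\<close>. As this concerns the family, its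
  members are in particular pairwise distinct.
\<close>

definition alg_independent :: "'k::field set \<Rightarrow> 'i set \<Rightarrow> ('i \<Rightarrow> 'k) \<Rightarrow> bool" where
  "alg_independent F A c \<longleftrightarrow>
     (\<forall>p :: ('i, 'k) mpoly.
        (\<forall>a. Poly_Mapping.lookup p a \<in> F) \<and>
        (\<forall>a\<in>Poly_Mapping.keys p. Poly_Mapping.keys a \<subseteq> A) \<and>
        poly_eval id c p = 0 \<longrightarrow> p = 0)"

text \<open>
  \<open>fs\<close> is a list of generic forms of the degrees \<open>es\<close> in \<open>m\<close> variables. The family of coefficients
  runs over all monomials of the respective degrees, so all of these occur in each form.
\<close>

definition generic_forms ::
  "'k::field set \<Rightarrow> nat \<Rightarrow> nat list \<Rightarrow> (nat, 'k) mpoly list \<Rightarrow> bool" where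
  "generic_forms F m es fs \<longleftrightarrow>
     length fs = length es \<and>
     (\<forall>i<length es. fs ! i \<in> forms m (es ! i)) \<and>
     alg_independent F {(i, a). i < length es \<and> a \<in> monomials m \<and> mdeg a = es ! i}
       (\<lambda>(i, a). Poly_Mapping.lookup (fs ! i) a)"

text \<open>
  Degree reverse lexicographic order, a larger index meaning a smaller variable. It does not depend
  on the number of variables.
\<close>

definition drl_less :: "nat expo \<Rightarrow> nat expo \<Rightarrow> bool" where
  "drl_less a b \<longleftrightarrow>
     mdeg a < mdeg b \<or>
     mdeg a = mdeg b \<and>
       (\<exists>i. Poly_Mapping.lookup a i > Poly_Mapping.lookup b i \<and>
            (\<forall>j>i. Poly_Mapping.lookup a j = Poly_Mapping.lookup b j))"

definition lead_mono :: "(nat, 'a::comm_ring_1) mpoly \<Rightarrow> nat expo" where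
  "lead_mono p =
     (THE a. a \<in> Poly_Mapping.keys p \<and>
        (\<forall>b\<in>Poly_Mapping.keys p. b \<noteq> a \<longrightarrow> drl_less b a))"

definition initial_ideal ::
  "nat \<Rightarrow> (nat, 'a::comm_ring_1) mpoly set \<Rightarrow> (nat, 'a) mpoly set" where
  "initial_ideal m L = Idl\<^bsub>mpoly_ring m\<^esub> {mono_poly (lead_mono p) | p. p \<in> L \<and> p \<noteq> 0}"

definition standard_monomials ::
  "nat \<Rightarrow> (nat, 'a::comm_ring_1) mpoly set \<Rightarrow> nat expo set" where
  "standard_monomials m L = {a \<in> monomials m. mono_poly a \<notin> initial_ideal m L}"

text \<open>The \<open>K\<close>-algebra homomorphism \<open>R' \<rightarrow> R\<close> fixing \<open>x\<^sub>1, \<dots>, x\<^sub>n\<close> and sending \<open>z\<close> to \<open>0\<close>.\<close>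

definition proj_z :: "nat \<Rightarrow> (nat, 'a::comm_ring_1) mpoly \<Rightarrow> (nat, 'a) mpoly" where
  "proj_z n = poly_eval poly_const (\<lambda>i. if i = n + 1 then 0 else poly_var i)"

definition decreasing_list :: "nat expo set \<Rightarrow> nat expo list" where
  "decreasing_list C = (THE xs. set xs = C \<and> sorted_wrt (\<lambda>a b. drl_less b a) xs)"

text \<open>\<open>\<^bold>C\<^sup>S\<close>; positions in the decreasing list are counted from 1.\<close>

definition select :: "nat expo set \<Rightarrow> nat set \<Rightarrow> nat expo set" where
  "select C S = {decreasing_list C ! (i - 1) | i. i \<in> S \<and> 1 \<le> i \<and> i \<le> card C}"

text \<open>\<open>z\<^sup>jC\<close>.\<close>

definition z_times :: "nat \<Rightarrow> nat \<Rightarrow> nat expo set \<Rightarrow> nat expo set" where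
  "z_times n j C = (\<lambda>c. Poly_Mapping.single (n + 1) j + c) ` C"

lemma mpoly_ring_simps [simp]:
  "carrier (mpoly_ring m) = {p. Poly_Mapping.keys p \<subseteq> monomials m}"
  "x \<otimes>\<^bsub>mpoly_ring m\<^esub> y = x * y"
  "x \<oplus>\<^bsub>mpoly_ring m\<^esub> y = x + y"
  "\<one>\<^bsub>mpoly_ring m\<^esub> = 1"
  "\<zero>\<^bsub>mpoly_ring m\<^esub> = 0"
  by (simp_all add: mpoly_ring_def ring_of_type_algebra_def)

lemma monomials_add: "a \<in> monomials m \<Longrightarrow> b \<in> monomials m \<Longrightarrow> a + b \<in> monomials m"
  using Poly_Mapping.keys_add[of a b] by (auto simp: monomials_def)

lemma cring_mpoly_ring: "cring (mpoly_ring m :: (nat, 'a::comm_ring_1) mpoly ring)"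
proof (rule cringI)
  show "abelian_group (mpoly_ring m :: (nat, 'a) mpoly ring)"
  proof (rule abelian_groupI)
    fix x :: "(nat, 'a) mpoly" assume "x \<in> carrier (mpoly_ring m)"
    thus "\<exists>y\<in>carrier (mpoly_ring m). y \<oplus>\<^bsub>mpoly_ring m\<^esub> x = \<zero>\<^bsub>mpoly_ring m\<^esub>"
      by (intro bexI[of _ "- x"]) auto
  next
    fix x y :: "(nat, 'a) mpoly"
    assume "x \<in> carrier (mpoly_ring m)" "y \<in> carrier (mpoly_ring m)"
    thus "x \<oplus>\<^bsub>mpoly_ring m\<^esub> y \<in> carrier (mpoly_ring m)"
      using Poly_Mapping.keys_add[of x y] by auto
  qed (auto simp: add.assoc add.commute)
  show "Group.comm_monoid (mpoly_ring m :: (nat, 'a) mpoly ring)"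
  proof (rule comm_monoidI)
    fix x y :: "(nat, 'a) mpoly"
    assume "x \<in> carrier (mpoly_ring m)" "y \<in> carrier (mpoly_ring m)"
    thus "x \<otimes>\<^bsub>mpoly_ring m\<^esub> y \<in> carrier (mpoly_ring m)"
      using keys_mult[of x y] monomials_add by simp blast
  qed (auto simp: mult.assoc mult.commute monomials_def)
qed (auto simp: distrib_right)

lemma drl_less_irrefl: "\<not> drl_less a a"
  by (auto simp: drl_less_def)

lemma drl_less_trans: "drl_less a b \<Longrightarrow> drl_less b c \<Longrightarrow> drl_less a c"
proof -
  assume ab: "drl_less a b" and bc: "drl_less b c"
  show "drl_less a c"
  proof (cases "mdeg a = mdeg b \<and> mdeg b = mdeg c")
    case False
    thus ?thesis using ab bc by (auto simp: drl_less_def)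
  next
    case True
    then obtain i j where
      i: "Poly_Mapping.lookup a i > Poly_Mapping.lookup b i" "\<forall>l>i. Poly_Mapping.lookup a l = Poly_Mapping.lookup b l" and
      j: "Poly_Mapping.lookup b j > Poly_Mapping.lookup c j" "\<forall>l>j. Poly_Mapping.lookup b l = Poly_Mapping.lookup c l"
      using ab bc by (auto simp: drl_less_def)
    have "Poly_Mapping.lookup a (max i j) > Poly_Mapping.lookup c (max i j)"
      using i j by (cases i j rule: linorder_cases) (auto simp: max_def)
    moreover have "\<forall>l>max i j. Poly_Mapping.lookup a l = Poly_Mapping.lookup c l"
      using i j by auto
    ultimately show ?thesis
      using True by (auto simp: drl_less_def)
  qed
qed

lemma drl_less_total: "a \<noteq> b \<Longrightarrow> drl_less a b \<or> drl_less b a"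
proof -
  assume "a \<noteq> b"
  define D where "D = {i. Poly_Mapping.lookup a i \<noteq> Poly_Mapping.lookup b i}"
  have "D \<subseteq> Poly_Mapping.keys a \<union> Poly_Mapping.keys b"
    by (auto simp: D_def in_keys_iff)
  hence fin: "finite D"
    by (rule finite_subset) simp
  have "D \<noteq> {}"
    using \<open>a \<noteq> b\<close> by (auto simp: D_def intro: poly_mapping_eqI)
  with fin have "Max D \<in> D" by simp
  define i where "i = Max D"
  have "Poly_Mapping.lookup a i \<noteq> Poly_Mapping.lookup b i"
    using \<open>Max D \<in> D\<close> by (simp add: D_def i_def)
  moreover have "\<forall>j>i. Poly_Mapping.lookup a j = Poly_Mapping.lookup b j"
    using fin Max_ge[of D] by (fastforce simp: D_def i_def)
  ultimately have "\<exists>i. Poly_Mapping.lookup a i > Poly_Mapping.lookup b i \<and> (\<forall>j>i. Poly_Mapping.lookup a j = Poly_Mapping.lookup b j) \<or>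
                       Poly_Mapping.lookup b i > Poly_Mapping.lookup a i \<and> (\<forall>j>i. Poly_Mapping.lookup b j = Poly_Mapping.lookup a j)"
    by (metis linorder_neq_iff)
  thus ?thesis
    unfolding drl_less_def by (metis linorder_neq_iff)
qed

lemma drl_linorder: "class.linorder (\<lambda>a b. drl_less b a \<or> a = b) (\<lambda>a b. drl_less b a)"
  by unfold_locales (use drl_less_irrefl drl_less_trans drl_less_total in blast)+

lemma decreasing_list:
  assumes "finite C"
  shows "set (decreasing_list C) = C \<and> sorted_wrt (\<lambda>a b. drl_less b a) (decreasing_list C)"
proof -
  interpret L: linorder "\<lambda>a b. drl_less b a \<or> a = b" "\<lambda>a b. drl_less b a"
    by (rule drl_linorder)
  have "\<exists>!xs. set xs = C \<and> sorted_wrt (\<lambda>a b. drl_less b a) xs"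
    using L.finite_sorted_distinct_unique[OF assms] by (simp add: L.strict_sorted_iff)
  thus ?thesis
    unfolding decreasing_list_def by (rule theI')
qed

end

theory Submission
  imports Defs "Jordan_Normal_Form.Determinant"
begin

text \<open>
  Everything is read off the multiplication by powers of \<open>z\<close> on the Artinian algebra
  \<open>C = R'/(I, g)\<close>, whose socle degree is \<open>s = \<delta> + d - 1\<close>: the bijections \<open>z\<^sup>s\<^sup>-\<^sup>2\<^sup>i : C\<^sub>i \<rightarrow> C\<^sub>s\<^sub>-\<^sub>i\<close>
  (the strong Lefschetz property) show that, for a standard monomial \<open>b\<close> of \<open>J\<close> of degree \<open>i\<close>, the
  monomial \<open>z\<^sup>t b\<close> always lies in the initial ideal if \<open>t + 2i > s\<close>, and only together with \<open>b\<close> itself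
  if \<open>t + 2i \<le> s\<close>. Comparing Hilbert functions then gives the number of standard monomials of each degree
  in the initial ideal.

  Surjectivity is an open condition on the coefficients, so it suffices to exhibit one example. In every
  characteristic, generic binary forms \<open>f\<^sub>j \<in> K[x\<^sub>j\<^sub>-\<^sub>1, x\<^sub>j]\<close> will do: the primitive decomposition with
  respect to \<open>x\<^sub>j\<^sub>-\<^sub>1\<close> reduces the claim for \<open>x\<^sub>j\<close> to ideals \<open>(x\<^sub>j\<^sub>-\<^sub>1\<^sup>c, x\<^sub>j\<^sup>t, f\<^sub>j)\<close> in two variables, and there
  \<open>f\<^sub>j\<close> may be specialised further to a monomial.
\<close>

text \<open>The classical example, powers of the variables with the sum of the variables as
  Lefschetz element, can fail in positive characteristic; this obstacle forces the chain of binary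
  forms. In the chain the last form meets the earlier ones only through one shared variable. Modulo
  the earlier forms, an element killed by a power of that variable can be carried along like a
  scalar, and in two variables all monomials still to be covered have a common divisor of the degree
  of the last form, whatever the characteristic.

  The open condition is the non-vanishing of a minor with coefficients in \<open>F\<close>. A point
  witnessing it may lie anywhere in \<open>K\<close>, so specialisations can be iterated and the
  binary forms can be cut out of the generic forms themselves.

  Only surjectivity is transferred in this way. Injectivity is a count: the Hilbert function of
  generic forms is that of powers of variables, and it is symmetric.

  The order enters through two facts: a form whose leading monomial is divisible by
  \<open>z^t\<close> is itself divisible by \<open>z^t\<close>, and setting \<open>z = 0\<close>
  keeps exactly the leading monomials free of \<open>z\<close>.\<close>

abbreviation "lookup \<equiv> Poly_Mapping.lookup"
abbreviation "keys \<equiv> Poly_Mapping.keys"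
abbreviation "single \<equiv> Poly_Mapping.single"

subsection \<open>Monomials and forms\<close>

text \<open>The variable set is arbitrary, so that \<open>R\<close> and the rings in two
  neighbouring variables are literal subsets of \<open>R'\<close> and need no embeddings.\<close>

definition mons :: "'i set \<Rightarrow> nat \<Rightarrow> 'i expo set" where
  "mons V D = {a. keys a \<subseteq> V \<and> mdeg a = D}"

definition hforms :: "'i set \<Rightarrow> nat \<Rightarrow> ('i, 'a::comm_ring_1) mpoly set" where
  "hforms V D = {p. keys p \<subseteq> mons V D}"

lemma forms_eq_hforms: "forms m e = hforms {1..m} e"
  by (simp add: forms_def hforms_def mons_def monomials_def)

lemma mdeg_eq_sum:
  assumes "finite V" "keys a \<subseteq> V"
  shows "mdeg a = (\<Sum>i\<in>V. lookup a i)"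
  unfolding mdeg_def by (rule sum.mono_neutral_left) (use assms in \<open>auto simp: in_keys_iff\<close>)

lemma keys_add_expo: "keys (a + b) = keys a \<union> keys (b :: 'i expo)"
  by (auto simp: in_keys_iff lookup_add)

lemma mdeg_add [simp]: "mdeg (a + b) = mdeg a + mdeg b"
proof -
  have "mdeg c = (\<Sum>i\<in>keys a \<union> keys b. lookup c i)" if "c \<in> {a, b, a + b}" for c
    using that by (intro mdeg_eq_sum) (auto simp: keys_add_expo)
  then show ?thesis by (simp add: lookup_add sum.distrib)
qed

lemma mdeg_0 [simp]: "mdeg 0 = 0"
  by (simp add: mdeg_def)

lemma mdeg_single [simp]: "mdeg (single i k) = k"
  by (simp add: mdeg_def)

lemma mdeg_eq_0_iff: "mdeg a = 0 \<longleftrightarrow> a = 0"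
  by (auto simp: mdeg_def in_keys_iff intro!: poly_mapping_eqI)

lemma mons_add: "a \<in> mons V D \<Longrightarrow> b \<in> mons V E \<Longrightarrow> a + b \<in> mons V (D + E)"
  by (auto simp: mons_def keys_add_expo)

lemma lookup_le_mdeg: "lookup a i \<le> mdeg a"
proof (cases "i \<in> keys a")
  case True
  then show ?thesis unfolding mdeg_def by (intro member_le_sum) auto
qed (simp add: in_keys_iff)

lemma finite_mons [simp]:
  assumes "finite V" shows "finite (mons V D)"
proof (rule finite_imageD)
  let ?f = "\<lambda>a. restrict (lookup a) V"
  show "finite (?f ` mons V D)"
  proof (rule finite_subset)
    show "?f ` mons V D \<subseteq> (\<Pi>\<^sub>E i\<in>V. {..D})"
      using lookup_le_mdeg by (fastforce simp: mons_def)
    show "finite (\<Pi>\<^sub>E i\<in>V. {..D})" using assms by (intro finite_PiE) auto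
  qed
  show "inj_on ?f (mons V D)"
  proof (rule inj_onI)
    fix a b assume ab: "a \<in> mons V D" "b \<in> mons V D" "?f a = ?f b"
    show "a = b"
    proof (rule poly_mapping_eqI)
      fix i show "lookup a i = lookup b i"
      proof (cases "i \<in> V")
        case True then show ?thesis using ab(3) by (metis restrict_apply')
      next
        case False
        with ab show ?thesis by (metis (mono_tags) in_keys_iff mem_Collect_eq mons_def subsetD)
      qed
    qed
  qed
qed

lemma expo_diff:
  fixes a b :: "'i expo"
  assumes "\<And>i. lookup a i \<le> lookup b i"
  obtains c where "b = a + c" "keys c \<subseteq> keys b"
proof
  show "b = a + (b - a)"
    by (rule poly_mapping_eqI) (use assms in \<open>simp add: lookup_add lookup_minus\<close>)
  show "keys (b - a) \<subseteq> keys b"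
    by (auto simp: in_keys_iff lookup_minus)
qed

text \<open>Serves to cut a standard monomial of large degree down to the degree from which on all
  standard monomials of \<open>J\<close> are leading monomials of \<open>(I,g)\<close>.\<close>

lemma expo_divisor:
  fixes b :: "'i expo"
  assumes "D \<le> mdeg b"
  shows "\<exists>a c. b = a + c \<and> mdeg a = D"
  using assms
proof (induction D)
  case 0
  then show ?case by (intro exI[of _ 0] exI[of _ b]) auto
next
  case (Suc D)
  then obtain a c where ac: "b = a + c" "mdeg a = D" by auto
  with Suc.prems have "mdeg c > 0" by simp
  then obtain i where i: "lookup c i \<noteq> 0"
    by (metis gr_implies_not0 mdeg_eq_0_iff lookup_zero poly_mapping_eqI)
  obtain c' where "c = single i 1 + c'"
    by (rule expo_diff[of "single i 1" c]) (use i in \<open>auto simp: lookup_single when_def\<close>)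
  with ac show ?case
    by (intro exI[of _ "a + single i 1"] exI[of _ c']) (auto simp: add.assoc)
qed

subsection \<open>The vector space of polynomials\<close>

lemma poly_mapping_sum_singles: "p = (\<Sum>a\<in>keys p. single a (lookup p a))"
proof (rule poly_mapping_eqI)
  fix k
  have "(\<Sum>a\<in>keys p. lookup (single a (lookup p a)) k) = (\<Sum>a\<in>keys p. if a = k then lookup p k else 0)"
    by (rule sum.cong) (auto simp: lookup_single when_def)
  then show "lookup p k = lookup (\<Sum>a\<in>keys p. single a (lookup p a)) k"
    by (auto simp: lookup_sum in_keys_iff)
qed

definition scl :: "'a::comm_ring_1 \<Rightarrow> ('i, 'a) mpoly \<Rightarrow> ('i, 'a) mpoly" where
  "scl c p = poly_const c * p"

lemma lookup_scl [simp]: "lookup (scl c p) a = c * lookup p a"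
proof -
  have "scl c p = Poly_Mapping.map ((*) c) p"
    by (simp add: scl_def poly_const_def mult_map_scale_conv_mult)
  then show ?thesis by (simp add: map.rep_eq when_def)
qed

lemma lookup_mono_mult: "lookup (mono_poly a * p) k = (\<Sum>b\<in>keys p. lookup p b when a + b = k)"
proof -
  have "mono_poly a * p = (\<Sum>b\<in>keys p. single (a + b) (lookup p b))"
    by (subst poly_mapping_sum_singles[of p])
       (simp add: mono_poly_def sum_distrib_left mult_single)
  then show ?thesis by (simp add: lookup_sum lookup_single)
qed

lemma lookup_mono_mult_add [simp]: "lookup (mono_poly a * p) (a + b) = lookup (p :: ('i, 'a::comm_ring_1) mpoly) b"
proof -
  have "(\<Sum>c\<in>keys p. lookup p c when a + c = a + b) = (\<Sum>c\<in>keys p. if c = b then lookup p b else 0)"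
    by (rule sum.cong) (auto simp: when_def)
  then show ?thesis by (auto simp: lookup_mono_mult in_keys_iff)
qed

lemma keys_mono_mult: "keys (mono_poly a * p) = (+) a ` keys (p :: ('i, 'a::comm_ring_1) mpoly)"
proof
  show "keys (mono_poly a * p) \<subseteq> (+) a ` keys p"
    using keys_mult[of "mono_poly a" p] by (auto simp: mono_poly_def)
  show "(+) a ` keys p \<subseteq> keys (mono_poly a * p)"
    by (auto simp: in_keys_iff)
qed

lemma mono_poly_add: "mono_poly (a + b) = mono_poly a * mono_poly b"
  by (simp add: mono_poly_def mult_single)

lemma mono_poly_0 [simp]: "mono_poly 0 = 1"
  by (simp add: mono_poly_def)

lemma keys_mono_poly [simp]: "keys (mono_poly a :: ('i, 'a::comm_ring_1) mpoly) = {a}"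
  by (simp add: mono_poly_def)

lemma lookup_mono_poly: "lookup (mono_poly a) b = (1 when a = b)"
  by (simp add: mono_poly_def lookup_single)

lemma inj_mono_poly: "inj (mono_poly :: 'i expo \<Rightarrow> ('i, 'a::comm_ring_1) mpoly)"
  by (metis injI keys_mono_poly singleton_inject)

lemma mono_mult_eq_0_iff [simp]:
  "mono_poly a * p = 0 \<longleftrightarrow> p = (0 :: ('i, 'a::comm_ring_1) mpoly)"
  by (metis image_is_empty keys_eq_empty keys_mono_mult)

text \<open>The space of all polynomials is infinite-dimensional; the dimension counts below take
  place inside \<open>hforms V D\<close> with \<open>V\<close> finite, where every independent set
  is finite.\<close>

interpretation pv: vector_space "scl :: 'a::field \<Rightarrow> ('i, 'a) mpoly \<Rightarrow> _"
  by unfold_locales (auto intro!: poly_mapping_eqI simp: lookup_add algebra_simps)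

lemma scl_mult: "scl c p * q = scl c (p * q)" "p * scl c q = scl c (p * q)"
  by (simp_all add: scl_def mult_ac)

lemma poly_sum_monos: "p = (\<Sum>a\<in>keys p. scl (lookup p a) (mono_poly a))"
proof -
  have "scl (lookup p a) (mono_poly a) = single a (lookup p a)" for a
    by (rule poly_mapping_eqI) (auto simp: lookup_mono_poly lookup_single when_def)
  then show ?thesis by (subst poly_mapping_sum_singles) simp
qed

lemma poly_in_span_monos: "keys p \<subseteq> S \<Longrightarrow> p \<in> pv.span (mono_poly ` S)"
proof -
  assume "keys p \<subseteq> S"
  then have "(\<Sum>a\<in>keys p. scl (lookup p a) (mono_poly a)) \<in> pv.span (mono_poly ` S)"
    by (intro pv.span_sum pv.span_scale pv.span_base imageI) blast
  then show ?thesis by (simp flip: poly_sum_monos)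
qed

lemma keys_scl: "keys (scl c p) \<subseteq> keys p"
  by (auto simp: in_keys_iff)

lemma subspace_keys: "pv.subspace {p :: ('i, 'a::field) mpoly. keys p \<subseteq> S}"
proof (rule pv.subspaceI)
  fix p q :: "('i, 'a) mpoly" and c
  show "p + q \<in> {p. keys p \<subseteq> S}" if "p \<in> {p. keys p \<subseteq> S}" "q \<in> {p. keys p \<subseteq> S}"
    using that keys_add[of p q] by auto
  show "scl c p \<in> {p. keys p \<subseteq> S}" if "p \<in> {p. keys p \<subseteq> S}"
    using that keys_scl[of c p] by auto
qed auto

lemma span_monos: "pv.span (mono_poly ` S) = {p :: ('i, 'a::field) mpoly. keys p \<subseteq> S}"
proof
  show "pv.span (mono_poly ` S) \<subseteq> {p :: ('i, 'a) mpoly. keys p \<subseteq> S}"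
  proof (rule pv.span_minimal[OF _ subspace_keys])
    show "mono_poly ` S \<subseteq> {p :: ('i, 'a) mpoly. keys p \<subseteq> S}"
      by (auto simp: mono_poly_def)
  qed
  show "{p :: ('i, 'a) mpoly. keys p \<subseteq> S} \<subseteq> pv.span (mono_poly ` S)"
  proof
    fix p :: "('i, 'a) mpoly" assume "p \<in> {p. keys p \<subseteq> S}"
    then show "p \<in> pv.span (mono_poly ` S)" by (simp add: poly_in_span_monos)
  qed
qed

lemma hforms_eq_span: "hforms V D = pv.span (mono_poly ` mons V D)"
  by (simp add: span_monos hforms_def)

lemma subspace_hforms [simp]: "pv.subspace (hforms V D)"
  by (simp add: hforms_eq_span)

lemma mono_poly_in_hforms [simp]: "mono_poly a \<in> hforms V D \<longleftrightarrow> a \<in> mons V D"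
  by (simp add: hforms_def)

lemma hforms_mult: "p \<in> hforms V D \<Longrightarrow> q \<in> hforms V E \<Longrightarrow> p * q \<in> hforms V (D + E)"
  using keys_mult[of p q] mons_add unfolding hforms_def by blast

lemma hforms_mono: "V \<subseteq> W \<Longrightarrow> hforms V D \<subseteq> hforms W D"
  by (auto simp: hforms_def mons_def)

lemma independent_monos: "pv.independent (mono_poly ` S :: ('i, 'a::field) mpoly set)"
proof -
  have "mono_poly a \<notin> pv.span (mono_poly ` S - {mono_poly a} :: ('i, 'a) mpoly set)" for a
  proof -
    have "mono_poly ` S - {mono_poly a} \<subseteq> (mono_poly ` (S - {a}) :: ('i, 'a) mpoly set)"
      by auto
    then have "pv.span (mono_poly ` S - {mono_poly a}) \<subseteq> (pv.span (mono_poly ` (S - {a})) :: ('i, 'a) mpoly set)"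
      by (rule pv.span_mono)
    then show ?thesis by (auto simp: span_monos)
  qed
  then show ?thesis unfolding pv.dependent_def by auto
qed

lemma dim_hforms: "pv.dim (hforms V D :: ('i, 'a::field) mpoly set) = card (mons V D)"
proof -
  have "pv.dim (hforms V D :: ('i, 'a) mpoly set) = card (mono_poly ` mons V D :: ('i, 'a) mpoly set)"
    by (rule pv.dim_eq_card) (auto simp: independent_monos hforms_eq_span pv.span_span)
  also have "\<dots> = card (mons V D)"
    by (rule card_image) (rule inj_on_subset[OF inj_mono_poly], simp)
  finally show ?thesis .
qed

lemma finite_independent_hforms:
  assumes "finite V" "pv.independent B" "B \<subseteq> hforms V D"
  shows "finite B" "card B \<le> card (mons V D)"
proof -
  have "B \<subseteq> pv.span (mono_poly ` mons V D)" "finite (mono_poly ` mons V D)"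
    using assms by (auto simp: hforms_eq_span)
  from pv.independent_span_bound[OF this(2) assms(2) this(1)]
  show "finite B" "card B \<le> card (mons V D)"
    using card_image_le[of "mons V D" mono_poly] assms(1) by (auto intro: order_trans)
qed

lemma dim_le_dim_plus:
  assumes "finite V" "pv.subspace W" "W \<subseteq> hforms V D" "finite T"
    and "U \<subseteq> pv.span (W \<union> T)"
  shows "pv.dim U \<le> pv.dim W + card T"
proof -
  obtain B where B: "B \<subseteq> W" "pv.independent B" "W \<subseteq> pv.span B" "card B = pv.dim W"
    by (rule pv.basis_exists)
  have fin: "finite B" using finite_independent_hforms[OF assms(1) B(2)] B(1) assms(3) by blast
  have "W \<union> T \<subseteq> pv.span (B \<union> T)"
    using B(3) pv.span_mono[of B "B \<union> T"] pv.span_superset[of "B \<union> T"] by blast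
  then have "pv.span (W \<union> T) \<subseteq> pv.span (B \<union> T)"
    by (rule pv.span_minimal) simp
  then have "pv.dim U \<le> card (B \<union> T)" using assms(5)
    by (intro pv.dim_le_card) (use fin assms(4) in auto)
  also have "\<dots> \<le> pv.dim W + card T" using card_Un_le[of B T] B(4) by simp
  finally show ?thesis .
qed

lemma card_mons_le_dim:
  fixes W :: "('i, 'a::field) mpoly set"
  assumes "finite V" "pv.subspace W" "W \<subseteq> hforms V D" "finite T"
    and "hforms V D \<subseteq> pv.span (W \<union> T)"
  shows "card (mons V D) \<le> pv.dim W + card T"
  using dim_le_dim_plus[OF assms] by (simp add: dim_hforms)

text \<open>\<open>Q\<close> is empty or a single form outside \<open>W\<close> that the complement
  has to contain. The second possibility serves the injectivity proof, where that form is a supposed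
  kernel element.\<close>

lemma complement_exists:
  fixes W :: "('i, 'a::field) mpoly set"
  assumes V: "finite V" and W: "pv.subspace W" "W \<subseteq> hforms V D"
    and Q: "Q \<subseteq> {q}" "Q \<subseteq> hforms V D - W"
  obtains T where "finite T" "Q \<subseteq> T" "T \<subseteq> hforms V D" "hforms V D \<subseteq> pv.span (W \<union> T)"
    "card T + pv.dim W = card (mons V D)"
proof -
  obtain B where B: "B \<subseteq> W" "pv.independent B" "W \<subseteq> pv.span B" "card B = pv.dim W"
    by (rule pv.basis_exists)
  have "pv.span B \<subseteq> W" using B(1) W(1) by (rule pv.span_minimal)
  then have "pv.independent (B \<union> Q)"
    using B(2) Q pv.independent_insertI[of q B] by (cases "Q = {}") (auto simp: subset_singleton_iff)
  moreover have "B \<union> Q \<subseteq> hforms V D" using B(1) W(2) Q(2) by auto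
  ultimately obtain C where C: "B \<union> Q \<subseteq> C" "C \<subseteq> hforms V D" "pv.independent C" "hforms V D \<subseteq> pv.span C"
    using pv.maximal_independent_subset_extend by metis
  have fin: "finite C" using finite_independent_hforms(1)[OF V C(3,2)] .
  have cardC: "card C = card (mons V D)"
    using pv.basis_card_eq_dim[OF C(2,4,3)] by (simp add: dim_hforms)
  show ?thesis
  proof (rule that[of "C - B"])
    show "finite (C - B)" "C - B \<subseteq> hforms V D" using fin C by auto
    show "Q \<subseteq> C - B" using C(1) Q(2) B(1) by auto
    have "pv.span C \<subseteq> pv.span (W \<union> (C - B))" using B(1) by (intro pv.span_mono) auto
    then show "hforms V D \<subseteq> pv.span (W \<union> (C - B))" using C(4) by auto
    have "B \<subseteq> C" using C(1) by simp
    with fin have "card (C - B) + card B = card C"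
      by (metis card_Diff_subset card_mono finite_subset le_add_diff_inverse2)
    then show "card (C - B) + pv.dim W = card (mons V D)" using cardC B(4) by simp
  qed
qed

subsection \<open>Leading monomials\<close>

lemma drl_less_add: "drl_less a b \<Longrightarrow> drl_less (c + a) (c + b)"
  by (auto simp: drl_less_def lookup_add)

lemma finite_has_drl_max:
  assumes "finite A" "A \<noteq> {}"
  shows "\<exists>a\<in>A. \<forall>b\<in>A. b \<noteq> a \<longrightarrow> drl_less b a"
  using assms
proof (induction A rule: finite_ne_induct)
  case (insert x A)
  then obtain a where a: "a \<in> A" "\<forall>b\<in>A. b \<noteq> a \<longrightarrow> drl_less b a" by auto
  show ?case
  proof (cases "drl_less a x")
    case True
    then have "\<forall>b\<in>A. drl_less b x" using a drl_less_trans by metis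
    then show ?thesis by auto
  next
    case False
    then have "x = a \<or> drl_less x a" using drl_less_total by blast
    then show ?thesis using a by auto
  qed
qed auto

lemma lead_mono_eqI:
  assumes "a \<in> keys p" "\<And>b. b \<in> keys p \<Longrightarrow> b \<noteq> a \<Longrightarrow> drl_less b a"
  shows "lead_mono p = a"
  unfolding lead_mono_def
proof (rule the_equality)
  show "x = a" if "x \<in> keys p \<and> (\<forall>b\<in>keys p. b \<noteq> x \<longrightarrow> drl_less b x)" for x
    using that assms drl_less_irrefl drl_less_trans by metis
qed (use assms in auto)

lemma lead_mono:
  assumes "p \<noteq> 0"
  shows "lead_mono p \<in> keys p" "b \<in> keys p \<Longrightarrow> b \<noteq> lead_mono p \<Longrightarrow> drl_less b (lead_mono p)"
proof -
  obtain a where a: "a \<in> keys p" "\<forall>b\<in>keys p. b \<noteq> a \<longrightarrow> drl_less b a"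
    using finite_has_drl_max[of "keys p"] assms by auto
  have "lead_mono p = a" by (rule lead_mono_eqI) (use a in auto)
  then show "lead_mono p \<in> keys p" "b \<in> keys p \<Longrightarrow> b \<noteq> lead_mono p \<Longrightarrow> drl_less b (lead_mono p)"
    using a by auto
qed

lemma lead_mono_mono_mult:
  assumes "p \<noteq> 0"
  shows "lead_mono (mono_poly a * p) = a + lead_mono p"
  by (rule lead_mono_eqI) (use lead_mono[OF assms] in \<open>auto simp: keys_mono_mult intro: drl_less_add\<close>)

definition lead_monos :: "(nat, 'a::comm_ring_1) mpoly set \<Rightarrow> nat expo set" where
  "lead_monos W = lead_mono ` (W - {0})"

lemma lead_monos_mono: "W \<subseteq> U \<Longrightarrow> lead_monos W \<subseteq> lead_monos U"
  by (auto simp: lead_monos_def)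

lemma lead_monos_subset: "W \<subseteq> hforms V D \<Longrightarrow> lead_monos W \<subseteq> mons V D"
  using lead_mono(1) by (fastforce simp: lead_monos_def hforms_def)

text \<open>Forms with distinct leading monomials are independent, and one form per leading monomial
  suffices to reduce every element of \<open>W\<close> to zero. This turns Hilbert functions into
  counts of leading monomials.\<close>

lemma dim_eq_card_lead_monos:
  fixes W :: "(nat, 'a::field) mpoly set"
  assumes V: "finite V" and W: "pv.subspace W" "W \<subseteq> hforms V D"
  shows "pv.dim W = card (lead_monos W)"
proof -
  define f where "f = (\<lambda>a. SOME p. p \<in> W \<and> p \<noteq> 0 \<and> lead_mono p = a)"
  have f: "f a \<in> W" "f a \<noteq> 0" "lead_mono (f a) = a" if "a \<in> lead_monos W" for a
  proof -
    have "\<exists>p. p \<in> W \<and> p \<noteq> 0 \<and> lead_mono p = a" using that by (auto simp: lead_monos_def)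
    from someI_ex[OF this] show "f a \<in> W" "f a \<noteq> 0" "lead_mono (f a) = a" by (auto simp: f_def)
  qed
  have fin: "finite (lead_monos W)"
    using lead_monos_subset[OF W(2)] V by (simp add: finite_subset)
  have inj: "inj_on f (lead_monos W)" by (metis f(3) inj_onI)
  have "pv.independent (f ` lead_monos W)"
  proof (rule pv.independent_if_scalars_zero)
    show "finite (f ` lead_monos W)" using fin by simp
    fix u p assume sum: "(\<Sum>x\<in>f ` lead_monos W. scl (u x) x) = 0" and p: "p \<in> f ` lead_monos W"
    show "u p = 0"
    proof (rule ccontr)
      assume "u p \<noteq> 0"
      define A where "A = {a \<in> lead_monos W. u (f a) \<noteq> 0}"
      have "finite A" "A \<noteq> {}" using fin p \<open>u p \<noteq> 0\<close> by (auto simp: A_def)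
      \<comment> \<open>At the largest leading monomial with a nonzero coefficient nothing can
        cancel: the other forms that occur have smaller leading monomials and do not contain
        \<open>m\<close>.\<close>
      then obtain m where m: "m \<in> A" "\<forall>b\<in>A. b \<noteq> m \<longrightarrow> drl_less b m"
        using finite_has_drl_max by blast
      have zero: "u (f a) * lookup (f a) m = 0" if "a \<in> lead_monos W" "a \<noteq> m" for a
      proof (cases "a \<in> A")
        case True
        then have "drl_less a m" using m that by auto
        then have "m \<notin> keys (f a)"
          using lead_mono(2)[of "f a" m] f[OF that(1)] that(2) drl_less_irrefl drl_less_trans by metis
        then show ?thesis by (simp add: in_keys_iff)
      next
        case False
        then show ?thesis using that by (simp add: A_def)
      qed
      have "0 = lookup (\<Sum>a\<in>lead_monos W. scl (u (f a)) (f a)) m"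
        using sum by (simp add: sum.reindex[OF inj])
      also have "\<dots> = (\<Sum>a\<in>lead_monos W. u (f a) * lookup (f a) m)"
        by (simp add: lookup_sum)
      also have "\<dots> = (\<Sum>a\<in>{m}. u (f a) * lookup (f a) m)"
        by (rule sum.mono_neutral_right) (use fin m zero in \<open>auto simp: A_def\<close>)
      finally have "lookup (f m) m = 0" using m by (simp add: A_def)
      moreover have "m \<in> keys (f m)" using lead_mono(1)[of "f m"] f[of m] m by (simp add: A_def)
      ultimately show False by (simp add: in_keys_iff)
    qed
  qed
  moreover have "W \<subseteq> pv.span (f ` lead_monos W)"
  proof
    fix p assume "p \<in> W"
    then show "p \<in> pv.span (f ` lead_monos W)"
    \<comment> \<open>Gaussian elimination along the order. The conjunct \<open>p \<noteq> 0\<close>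
      gives the zero polynomial measure 0, so a subtraction that ends in zero also decreases the
      measure.\<close>
    proof (induction "card {a \<in> lead_monos W. p \<noteq> 0 \<and> (a = lead_mono p \<or> drl_less a (lead_mono p))}"
           arbitrary: p rule: less_induct)
      case (less p)
      show ?case
      proof (cases "p = 0")
        case True then show ?thesis by (simp add: pv.span_zero)
      next
        case False
        define b where "b = lead_mono p"
        have b: "b \<in> lead_monos W" using False less.prems by (auto simp: lead_monos_def b_def)
        note fb = f[OF b]
        define c where "c = lookup p b / lookup (f b) b"
        define q where "q = p - scl c (f b)"
        have bf: "lookup (f b) b \<noteq> 0" using lead_mono(1)[OF fb(2)] fb(3) by (simp add: in_keys_iff)
        have qW: "q \<in> W" unfolding q_def
          using less.prems fb(1) W(1) by (intro pv.subspace_diff pv.subspace_scale) auto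
        have lq: "drl_less (lead_mono q) b" if "q \<noteq> 0"
        proof -
          have "lookup q b = 0" using bf by (simp add: q_def c_def lookup_minus)
          then have "lead_mono q \<noteq> b" using lead_mono(1)[OF that] by (auto simp: in_keys_iff)
          moreover have "lead_mono q \<in> keys p \<union> keys (f b)"
            using lead_mono(1)[OF that] by (auto simp: q_def in_keys_iff lookup_minus)
          ultimately show ?thesis
            using lead_mono(2)[OF False] lead_mono(2)[OF fb(2)] fb(3) by (auto simp: b_def)
        qed
        have "q \<in> pv.span (f ` lead_monos W)"
        proof (rule less.hyps[OF _ qW], rule psubset_card_mono)
          show "{a \<in> lead_monos W. q \<noteq> 0 \<and> (a = lead_mono q \<or> drl_less a (lead_mono q))} \<subset>
                {a \<in> lead_monos W. p \<noteq> 0 \<and> (a = lead_mono p \<or> drl_less a (lead_mono p))}"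
          proof (rule psubsetI)
            show "{a \<in> lead_monos W. q \<noteq> 0 \<and> (a = lead_mono q \<or> drl_less a (lead_mono q))} \<subseteq>
                {a \<in> lead_monos W. p \<noteq> 0 \<and> (a = lead_mono p \<or> drl_less a (lead_mono p))}"
            proof
              fix a assume "a \<in> {a \<in> lead_monos W. q \<noteq> 0 \<and> (a = lead_mono q \<or> drl_less a (lead_mono q))}"
              then show "a \<in> {a \<in> lead_monos W. p \<noteq> 0 \<and> (a = lead_mono p \<or> drl_less a (lead_mono p))}"
                using lq False drl_less_trans[of a "lead_mono q" b] by (auto simp: b_def)
            qed
            have "b \<notin> {a \<in> lead_monos W. q \<noteq> 0 \<and> (a = lead_mono q \<or> drl_less a (lead_mono q))}"
              using lq drl_less_irrefl[of b] drl_less_trans[of b "lead_mono q" b] by auto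
            moreover have "b \<in> {a \<in> lead_monos W. p \<noteq> 0 \<and> (a = lead_mono p \<or> drl_less a (lead_mono p))}"
              using b False by (simp add: b_def)
            ultimately show "{a \<in> lead_monos W. q \<noteq> 0 \<and> (a = lead_mono q \<or> drl_less a (lead_mono q))} \<noteq>
                {a \<in> lead_monos W. p \<noteq> 0 \<and> (a = lead_mono p \<or> drl_less a (lead_mono p))}"
              by blast
          qed
        qed (use fin in simp)
        moreover have "p = q + scl c (f b)" by (simp add: q_def)
        moreover have "f b \<in> pv.span (f ` lead_monos W)" using b by (intro pv.span_base) simp
        ultimately show ?thesis by (simp add: pv.span_add pv.span_scale)
      qed
    qed
  qed
  moreover have "f ` lead_monos W \<subseteq> W" using f(1) by (rule image_subsetI)
  ultimately have "pv.dim W = card (f ` lead_monos W)"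
    by (metis pv.basis_card_eq_dim)
  then show ?thesis by (simp add: card_image[OF inj])
qed

text \<open>Position \<open>z\<close> is the last one at which the exponents can differ, so it
  decides the comparison. All later statements on \<open>z\<close> and leading monomials rest on
  this trait of the order.\<close>

lemma drl_less_revlex:
  assumes "mdeg a = mdeg b" "lookup b z < lookup a z" "keys a \<subseteq> {..z}" "keys b \<subseteq> {..z}"
  shows "drl_less a b"
proof -
  have "lookup a j = lookup b j" if "j > z" for j
    using assms(3,4) that by (metis atMost_iff in_keys_iff leD subsetD)
  then show ?thesis using assms(1,2) by (auto simp: drl_less_def)
qed

text \<open>Division with remainder: a leading monomial is traded for the smaller terms of a form in
  \<open>W\<close>, and this stops because a degree has only finitely many monomials.\<close>

lemma standard_monos_span:
  fixes W :: "(nat, 'a::field) mpoly set"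
  assumes V: "finite V" and W: "pv.subspace W" "W \<subseteq> hforms V D" and b: "b \<in> mons V D"
  shows "mono_poly b \<in> pv.span (W \<union> mono_poly ` {c \<in> mons V D - lead_monos W. c = b \<or> drl_less c b})"
  using b
proof (induction "card {c \<in> mons V D. drl_less c b}" arbitrary: b rule: less_induct)
  case (less b)
  define S where "S = (\<lambda>b. {c \<in> mons V D - lead_monos W. c = b \<or> drl_less c b})"
  show ?case
  proof (cases "b \<in> lead_monos W")
    case False
    with less.prems show ?thesis by (intro pv.span_base) auto
  next
    case True
    then obtain p where p: "p \<in> W" "p \<noteq> 0" "lead_mono p = b" by (auto simp: lead_monos_def)
    have kp: "keys p \<subseteq> mons V D" using p W(2) by (auto simp: hforms_def)
    have pb: "lookup p b \<noteq> 0" using lead_mono(1)[OF p(2)] p(3) by (simp add: in_keys_iff)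
    define q where "q = mono_poly b - scl (1 / lookup p b) p"
    have kq: "c \<in> mons V D \<and> drl_less c b" if "c \<in> keys q" for c
    proof -
      have "c \<noteq> b" using that pb by (auto simp: q_def in_keys_iff lookup_minus lookup_mono_poly)
      moreover from this have "c \<in> keys p"
        using that by (auto simp: q_def in_keys_iff lookup_minus lookup_mono_poly)
      ultimately show ?thesis using kp lead_mono(2)[OF p(2)] p(3) by auto
    qed
    have "mono_poly c \<in> pv.span (W \<union> mono_poly ` S b)" if c: "c \<in> keys q" for c
    proof -
      have cb: "c \<in> mons V D" "drl_less c b" using kq[OF c] by auto
      have "card {e \<in> mons V D. drl_less e c} < card {e \<in> mons V D. drl_less e b}"
      proof (rule psubset_card_mono)
        have "c \<in> {e \<in> mons V D. drl_less e b} - {e \<in> mons V D. drl_less e c}"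
          using cb drl_less_irrefl[of c] by simp
        moreover have "{e \<in> mons V D. drl_less e c} \<subseteq> {e \<in> mons V D. drl_less e b}"
          using drl_less_trans[OF _ cb(2)] by auto
        ultimately show "{e \<in> mons V D. drl_less e c} \<subset> {e \<in> mons V D. drl_less e b}" by auto
      qed (use V in simp)
      from less.hyps[OF this cb(1)] have "mono_poly c \<in> pv.span (W \<union> mono_poly ` S c)"
        by (simp add: S_def)
      moreover have "S c \<subseteq> S b" using cb drl_less_trans[OF _ cb(2)] by (auto simp: S_def)
      ultimately show ?thesis
        using pv.span_mono[of "W \<union> mono_poly ` S c" "W \<union> mono_poly ` S b"] by blast
    qed
    then have "(\<Sum>c\<in>keys q. scl (lookup q c) (mono_poly c)) \<in> pv.span (W \<union> mono_poly ` S b)"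
      by (intro pv.span_sum pv.span_scale)
    then have "q \<in> pv.span (W \<union> mono_poly ` S b)" by (simp flip: poly_sum_monos)
    moreover have "scl (1 / lookup p b) p \<in> pv.span (W \<union> mono_poly ` S b)"
      using p(1) by (intro pv.span_scale pv.span_base) simp
    moreover have "mono_poly b = q + scl (1 / lookup p b) p" by (simp add: q_def)
    ultimately show ?thesis by (simp add: S_def pv.span_add)
  qed
qed

subsection \<open>Evaluation of polynomials\<close>

lemma poly_eval_superset:
  assumes "\<phi> 0 = 0" "finite S" "keys p \<subseteq> S"
  shows "poly_eval \<phi> c p = (\<Sum>a\<in>S. \<phi> (lookup p a) * (\<Prod>i\<in>keys a. c i ^ lookup a i))"
  unfolding poly_eval_def
  by (rule sum.mono_neutral_left) (use assms in \<open>auto simp: in_keys_iff\<close>)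

lemma prod_pow_expo_add:
  "(\<Prod>i\<in>keys (a + b). c i ^ lookup (a + b) i) =
   (\<Prod>i\<in>keys a. c i ^ lookup a i) * (\<Prod>i\<in>keys b. (c i :: 'b::comm_ring_1) ^ lookup b i)"
proof -
  have "(\<Prod>i\<in>keys e. c i ^ lookup e i) = (\<Prod>i\<in>keys a \<union> keys b. c i ^ lookup e i)" if "e \<in> {a, b}" for e
    using that by (intro prod.mono_neutral_left) (auto simp: in_keys_iff)
  then show ?thesis
    by (simp add: keys_add_expo lookup_add power_add prod.distrib)
qed

text \<open>Being a ring homomorphism lets evaluation commute with determinants.\<close>

lemma comm_ring_hom_poly_eval:
  assumes "comm_ring_hom \<phi>"
  shows "comm_ring_hom (poly_eval \<phi> c :: ('i, 'a::comm_ring_1) mpoly \<Rightarrow> 'b::comm_ring_1)"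
proof -
  interpret comm_ring_hom \<phi> by fact
  let ?m = "\<lambda>a. \<Prod>i\<in>keys a. c i ^ lookup a i"
  have add: "poly_eval \<phi> c (p + q) = poly_eval \<phi> c p + poly_eval \<phi> c q" for p q
  proof -
    note sup = poly_eval_superset[where \<phi> = \<phi> and S = "keys p \<union> keys q"]
    show ?thesis using keys_add[of p q]
      by (simp add: sup lookup_add hom_add distrib_right sum.distrib)
  qed
  have zero: "poly_eval \<phi> c 0 = 0" by (simp add: poly_eval_def)
  have sum: "poly_eval \<phi> c (sum f S) = (\<Sum>x\<in>S. poly_eval \<phi> c (f x))" for f and S :: "'c set"
    by (induction S rule: infinite_finite_induct) (auto simp: add zero)
  have single: "poly_eval \<phi> c (single a x) = \<phi> x * ?m a" for a x
    by (simp add: poly_eval_def)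
  have mult: "poly_eval \<phi> c (p * q) = poly_eval \<phi> c p * poly_eval \<phi> c q" for p q
  proof -
    have "p * q = (\<Sum>a\<in>keys p. \<Sum>b\<in>keys q. single (a + b) (lookup p a * lookup q b))"
      by (subst poly_mapping_sum_singles[of p], subst poly_mapping_sum_singles[of q])
         (simp add: sum_product mult_single)
    then have "poly_eval \<phi> c (p * q) =
        (\<Sum>a\<in>keys p. \<Sum>b\<in>keys q. (\<phi> (lookup p a) * ?m a) * (\<phi> (lookup q b) * ?m b))"
      by (simp only: sum single prod_pow_expo_add hom_mult) (simp add: mult_ac)
    then show ?thesis by (simp add: poly_eval_def sum_product)
  qed
  have one: "poly_eval \<phi> c 1 = 1"
    using single[of 0 1] by simp
  show ?thesis by unfold_locales (simp_all add: add mult zero one)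
qed

lemma comm_ring_hom_id: "comm_ring_hom id"
  by unfold_locales auto

lemma poly_eval_var: "\<phi> 1 = 1 \<Longrightarrow> poly_eval \<phi> c (poly_var i) = c i"
  by (simp add: poly_var_def mono_poly_def poly_eval_def)

subsection \<open>Spanning is inherited by algebraically independent coefficients\<close>

lemma subfield_closed:
  assumes "subfield F (ring_of_type_algebra :: 'k::field ring)"
  shows "0 \<in> F" "1 \<in> F" "x \<in> F \<Longrightarrow> y \<in> F \<Longrightarrow> x + y \<in> F" "x \<in> F \<Longrightarrow> y \<in> F \<Longrightarrow> x * y \<in> F"
    "x \<in> F \<Longrightarrow> - x \<in> F"
proof -
  let ?R = "ring_of_type_algebra :: 'k ring"
  interpret field ?R
    by (rule field_from_type_algebra)
  note S = subringE[OF subfieldE(1)[OF assms]]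
  show "0 \<in> F" "1 \<in> F" "x \<in> F \<Longrightarrow> y \<in> F \<Longrightarrow> x + y \<in> F" "x \<in> F \<Longrightarrow> y \<in> F \<Longrightarrow> x * y \<in> F"
    using S by (auto simp: ring_of_type_algebra_def)
  have "\<ominus>\<^bsub>?R\<^esub> x = - x"
    by (rule minus_equality) (auto simp: ring_of_type_algebra_def)
  then show "x \<in> F \<Longrightarrow> - x \<in> F" using S(5)[of x] by simp
qed

text \<open>The class of polynomials over which \<open>alg_independent\<close> quantifies.\<close>

definition polys_over :: "'k::field set \<Rightarrow> 'i set \<Rightarrow> ('i, 'k) mpoly set" where
  "polys_over F A = {p. (\<forall>a. lookup p a \<in> F) \<and> (\<forall>a\<in>keys p. keys a \<subseteq> A)}"

lemma polys_over_closed: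
  assumes F: "subfield F (ring_of_type_algebra :: 'k::field ring)"
  shows "0 \<in> polys_over F A" "1 \<in> polys_over F A"
    "p \<in> polys_over F A \<Longrightarrow> q \<in> polys_over F A \<Longrightarrow> p + q \<in> polys_over F A"
    "p \<in> polys_over F A \<Longrightarrow> - p \<in> polys_over F A"
    "p \<in> polys_over F A \<Longrightarrow> q \<in> polys_over F A \<Longrightarrow> p * q \<in> polys_over F A"
    "i \<in> A \<Longrightarrow> poly_var i \<in> polys_over F A"
proof -
  note Fc = subfield_closed[OF F]
  show 0: "0 \<in> polys_over F A" "1 \<in> polys_over F A"
    using Fc by (auto simp: polys_over_def lookup_one when_def)
  show add: "p + q \<in> polys_over F A" if "p \<in> polys_over F A" "q \<in> polys_over F A" for p q
    unfolding polys_over_def mem_Collect_eq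
  proof (intro conjI allI ballI)
    show "lookup (p + q) a \<in> F" for a using that Fc by (simp add: polys_over_def lookup_add)
    fix a assume "a \<in> keys (p + q)"
    then have "a \<in> keys p \<union> keys q" using keys_add[of p q] by blast
    then show "keys a \<subseteq> A" using that by (auto simp: polys_over_def)
  qed
  show "- p \<in> polys_over F A" if "p \<in> polys_over F A"
    using that Fc by (auto simp: polys_over_def in_keys_iff)
  show "poly_var i \<in> polys_over F A" if "i \<in> A"
    using that Fc by (auto simp: polys_over_def poly_var_def mono_poly_def lookup_single when_def)
  have sum: "sum f S \<in> polys_over F A" if "\<And>x. x \<in> S \<Longrightarrow> f x \<in> polys_over F A" for f and S :: "'c set"
    using that by (induction S rule: infinite_finite_induct) (auto simp: 0 add)
  have single: "single a x \<in> polys_over F A" if "x \<in> F" "keys a \<subseteq> A" for a x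
    using that Fc by (auto simp: polys_over_def lookup_single when_def)
  show "p * q \<in> polys_over F A" if "p \<in> polys_over F A" "q \<in> polys_over F A"
  proof -
    have "p * q = (\<Sum>a\<in>keys p. \<Sum>b\<in>keys q. single (a + b) (lookup p a * lookup q b))"
      by (subst poly_mapping_sum_singles[of p], subst poly_mapping_sum_singles[of q])
         (simp add: sum_product mult_single)
    also have "\<dots> \<in> polys_over F A"
      using that Fc by (intro sum single) (auto simp: polys_over_def keys_add_expo)
    finally show ?thesis .
  qed
qed

lemma det_polys_over:
  assumes F: "subfield F (ring_of_type_algebra :: 'k::field ring)"
    and M: "M \<in> carrier_mat N N" "\<And>i j. i < N \<Longrightarrow> j < N \<Longrightarrow> M $$ (i, j) \<in> polys_over F A"
  shows "det M \<in> polys_over F A"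
proof -
  have sum: "sum f S \<in> polys_over F A" if "\<And>x. x \<in> S \<Longrightarrow> f x \<in> polys_over F A" for f and S :: "'c set"
    using that by (induction S rule: infinite_finite_induct) (auto simp: polys_over_closed[OF F])
  have prod: "prod f S \<in> polys_over F A" if "\<And>x. x \<in> S \<Longrightarrow> f x \<in> polys_over F A" for f and S :: "'c set"
    using that by (induction S rule: infinite_finite_induct) (auto simp: polys_over_closed[OF F])
  have sgn: "signof \<pi> \<in> polys_over F A" for \<pi> :: "nat \<Rightarrow> nat"
    using polys_over_closed(2)[OF F, of A] polys_over_closed(4)[OF F polys_over_closed(2)[OF F, of A]]
    by (cases "evenperm \<pi>") (simp_all add: sign_def)
  show ?thesis
    unfolding det_def'[OF M(1)]
  proof (rule sum, rule polys_over_closed(5)[OF F sgn], rule prod, rule M(2))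
    fix \<pi> i assume "\<pi> \<in> {\<pi>. \<pi> permutes {0..<N}}" "i \<in> {0..<N}"
    then show "i < N" "\<pi> i < N" using permutes_in_image[of \<pi> "{0..<N}" i] by auto
  qed
qed

text \<open>\<open>e l b\<close> is the coordinate \<open>b\<close> of the vector \<open>l\<close>
  as a polynomial in the indeterminate parameters. A basis chosen among the vectors at the point
  \<open>c0\<close> has nonzero determinant there, so the symbolic determinant is a nonzero
  polynomial over \<open>F\<close>; independence keeps it nonzero at \<open>c\<close>. The point
  \<open>c0\<close> need not have coordinates in \<open>F\<close>.\<close>

lemma generic_spanning:
  fixes v v0 :: "'l \<Rightarrow> ('v, 'k::field) mpoly" and e :: "'l \<Rightarrow> 'v expo \<Rightarrow> ('i, 'k) mpoly"
  assumes F: "subfield F (ring_of_type_algebra :: 'k ring)" and indep: "alg_independent F A c"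
    and R: "finite R"
    and e: "\<And>l b. l \<in> L \<Longrightarrow> b \<in> R \<Longrightarrow> e l b \<in> polys_over F A"
    and v: "\<And>l b. l \<in> L \<Longrightarrow> b \<in> R \<Longrightarrow> lookup (v l) b = poly_eval id c (e l b)"
    and v0: "\<And>l b. l \<in> L \<Longrightarrow> b \<in> R \<Longrightarrow> lookup (v0 l) b = poly_eval id c0 (e l b)"
    and keys_v: "\<And>l. l \<in> L \<Longrightarrow> keys (v l) \<subseteq> R" and keys_v0: "\<And>l. l \<in> L \<Longrightarrow> keys (v0 l) \<subseteq> R"
    and span: "mono_poly ` R \<subseteq> pv.span (v0 ` L)"
  shows "mono_poly ` R \<subseteq> pv.span (v ` L)"
proof -
  obtain B where B: "B \<subseteq> v0 ` L" "pv.independent B" "v0 ` L \<subseteq> pv.span B"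
    by (rule pv.maximal_independent_subset)
  have spanB: "mono_poly ` R \<subseteq> pv.span B"
    using span pv.span_minimal[OF B(3) pv.subspace_span] by blast
  have "B \<subseteq> pv.span (mono_poly ` R)"
  proof
    fix p assume "p \<in> B"
    then obtain l where "l \<in> L" "p = v0 l" using B(1) by auto
    then show "p \<in> pv.span (mono_poly ` R)" using keys_v0 by (simp add: poly_in_span_monos)
  qed
  then have B_sub: "pv.span B = pv.span (mono_poly ` R :: ('v, 'k) mpoly set)"
    using spanB by (intro antisym pv.span_minimal pv.subspace_span)
  have finB: "finite B"
    using pv.independent_span_bound[OF _ B(2) \<open>B \<subseteq> pv.span (mono_poly ` R)\<close>] R by auto
  have "card B = card (mono_poly ` R :: ('v, 'k) mpoly set)"
    using pv.dim_span_eq_card_independent[OF B(2)] B_sub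
      pv.dim_span_eq_card_independent[OF independent_monos[of R]] by metis
  \<comment> \<open>As many basis vectors as monomials: the matrices below are square.\<close>
  then have cardB: "card B = card R"
    by (simp add: card_image[OF inj_on_subset[OF inj_mono_poly]])
  define N where "N = card R"
  obtain rs where rs: "set rs = R" "distinct rs" using finite_distinct_list[OF R] by blast
  obtain bs where bs: "set bs = B" "distinct bs" using finite_distinct_list[OF finB] by blast
  have len: "length rs = N" "length bs = N"
    using distinct_card[OF rs(2)] distinct_card[OF bs(2)] unfolding N_def rs(1) bs(1) cardB by metis+
  define lab where "lab = (\<lambda>k. SOME l. l \<in> L \<and> v0 l = bs ! k)"
  have lab: "lab k \<in> L" "v0 (lab k) = bs ! k" if "k < N" for k
  proof -
    have "bs ! k \<in> set bs" using that len(2) by simp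
    then have "bs ! k \<in> v0 ` L" using B(1) bs(1) by auto
    then have "\<exists>l. l \<in> L \<and> v0 l = bs ! k" by auto
    from someI_ex[OF this] show "lab k \<in> L" "v0 (lab k) = bs ! k" by (auto simp: lab_def)
  qed
  have rsR: "rs ! i \<in> R" if "i < N" for i using that rs(1) len(1) nth_mem[of i rs] by simp
  define MX where "MX = mat N N (\<lambda>(i, k). e (lab k) (rs ! i))"
  define M where "M = mat N N (\<lambda>(i, k). lookup (v (lab k)) (rs ! i))"
  define M0 where "M0 = mat N N (\<lambda>(i, k). lookup (v0 (lab k)) (rs ! i))"
  have carr: "MX \<in> carrier_mat N N" "M \<in> carrier_mat N N" "M0 \<in> carrier_mat N N"
    by (auto simp: MX_def M_def M0_def)
  interpret ev: comm_ring_hom "poly_eval id c :: ('i, 'k) mpoly \<Rightarrow> 'k"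
    by (rule comm_ring_hom_poly_eval[OF comm_ring_hom_id])
  interpret ev0: comm_ring_hom "poly_eval id c0 :: ('i, 'k) mpoly \<Rightarrow> 'k"
    by (rule comm_ring_hom_poly_eval[OF comm_ring_hom_id])
  have M: "M = map_mat (poly_eval id c) MX"
    by (rule eq_matI) (auto simp: MX_def M_def v lab rsR)
  have M0: "M0 = map_mat (poly_eval id c0) MX"
    by (rule eq_matI) (auto simp: MX_def M0_def v0[OF lab(1)] rsR)
  \<comment> \<open>A kernel vector of \<open>M0\<close> would be a linear relation among the basis
    vectors \<open>bs\<close>.\<close>
  have "det M0 \<noteq> 0"
  proof
    assume "det M0 = 0"
    then obtain w where w: "w \<in> carrier_vec N" "w \<noteq> 0\<^sub>v N" "M0 *\<^sub>v w = 0\<^sub>v N"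
      using det_0_iff_vec_prod_zero_field[OF carr(3)] by auto
    define s where "s = (\<Sum>k<N. scl (w $ k) (bs ! k))"
    have "s = 0"
    proof (rule poly_mapping_eqI)
      fix b
      show "lookup s b = lookup 0 b"
      proof (cases "b \<in> R")
        case True
        then obtain i where i: "i < N" "rs ! i = b" using rs(1) len(1) by (metis in_set_conv_nth)
        have "0 = (M0 *\<^sub>v w) $ i" using w(3) i by simp
        also have "\<dots> = (\<Sum>k<N. lookup (bs ! k) b * w $ k)"
          using i w(1) carr(3) lab(2) by (auto simp: M0_def scalar_prod_def atLeast0LessThan intro!: sum.cong)
        finally show ?thesis by (simp add: s_def lookup_sum mult.commute)
      next
        case False
        have "lookup (bs ! k) b = 0" if "k < N" for k
          using keys_v0[OF lab(1)[OF that]] lab(2)[OF that] False by (auto simp: in_keys_iff)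
        then show ?thesis by (simp add: s_def lookup_sum)
      qed
    qed
    have idx: "bs ! k \<in> B" if "k < N" for k using that bs(1) len(2) nth_mem[of k bs] by simp
    have bij: "bij_betw ((!) bs) {..<N} B"
      using bij_betw_nth[OF bs(2), of "{..<N}" B] bs(1) len(2) by simp
    define u where "u = (\<lambda>x. w $ (inv_into {..<N} ((!) bs) x))"
    have uk: "u (bs ! k) = w $ k" if "k < N" for k
      using that bij by (simp add: u_def bij_betw_inv_into_left)
    have "(\<Sum>x\<in>B. scl (u x) x) = s"
      unfolding s_def by (subst sum.reindex_bij_betw[OF bij, symmetric]) (simp add: uk)
    with \<open>s = 0\<close> have "(\<Sum>x\<in>B. scl (u x) x) = 0" by simp
    then have "\<forall>x\<in>B. u x = 0"
      using B(2) finB unfolding pv.independent_explicit_finite_subsets by blast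
    then have "w $ k = 0" if "k < N" for k using uk[OF that] idx[OF that] by metis
    then have "w = 0\<^sub>v N" using w(1) by (intro eq_vecI) auto
    with w(2) show False by simp
  qed
  \<comment> \<open>A polynomial with a nonzero value at \<open>c0\<close> is nonzero, which is all
    that is taken over from the special point.\<close>
  then have "det MX \<noteq> 0" unfolding M0 ev0.hom_det by auto
  moreover have "det MX \<in> polys_over F A"
    by (rule det_polys_over[OF F carr(1)]) (auto simp: MX_def e lab rsR)
  ultimately have "poly_eval id c (det MX) \<noteq> 0"
    using indep unfolding alg_independent_def polys_over_def by blast
  then have "det M \<noteq> 0" by (simp add: M ev.hom_det)
  from det_non_zero_imp_unit[OF carr(2) this, of "()"]
  obtain Q where Q: "Q \<in> carrier_mat N N" "M * Q = 1\<^sub>m N"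
    unfolding Units_def ring_mat_def by auto
  show ?thesis
  proof
    fix p :: "('v, 'k) mpoly" assume "p \<in> mono_poly ` R"
    then obtain r where r: "r \<in> R" "p = mono_poly r" by auto
    then obtain j where j: "j < N" "rs ! j = r" using rs(1) len(1) by (metis in_set_conv_nth)
    \<comment> \<open>The coefficients are the column of the inverse of \<open>M\<close> that
      belongs to the monomial \<open>r\<close>.\<close>
    have "p = (\<Sum>k<N. scl (Q $$ (k, j)) (v (lab k)))"
    proof (rule poly_mapping_eqI)
      fix b
      show "lookup p b = lookup (\<Sum>k<N. scl (Q $$ (k, j)) (v (lab k))) b"
      proof (cases "b \<in> R")
        case True
        then obtain i where i: "i < N" "rs ! i = b" using rs(1) len(1) by (metis in_set_conv_nth)
        have "(M * Q) $$ (i, j) = (\<Sum>k<N. lookup (v (lab k)) b * Q $$ (k, j))"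
          using i j Q(1) carr(2) by (auto simp: M_def scalar_prod_def atLeast0LessThan intro!: sum.cong)
        moreover have "(M * Q) $$ (i, j) = (if i = j then 1 else 0)" using Q(2) i j by simp
        moreover have "i = j \<longleftrightarrow> b = r" using i j rs(2) len(1) nth_eq_iff_index_eq by metis
        ultimately show ?thesis using r
          by (cases "b = r") (simp_all add: lookup_sum mult.commute lookup_mono_poly when_def)
      next
        case False
        have "lookup (v (lab k)) b = 0" if "k < N" for k
          using keys_v[OF lab(1)[OF that]] False by (auto simp: in_keys_iff)
        then show ?thesis using False r by (auto simp: lookup_sum lookup_mono_poly when_def)
      qed
    qed
    moreover have "(\<Sum>k<N. scl (Q $$ (k, j)) (v (lab k))) \<in> pv.span (v ` L)"
      by (intro pv.span_sum pv.span_scale pv.span_base imageI lab) simp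
    ultimately show "p \<in> pv.span (v ` L)" by simp
  qed
qed

subsection \<open>Families of generic forms\<close>

text \<open>The index set and the variable set are free, so that the property passes to fewer forms
  and fewer variables: a subfamily of the coefficients is again algebraically independent.\<close>

definition generic_family ::
  "'k::field set \<Rightarrow> 'i set \<Rightarrow> ('j \<Rightarrow> nat) \<Rightarrow> 'j set \<Rightarrow> ('j \<Rightarrow> ('i, 'k) mpoly) \<Rightarrow> bool" where
  "generic_family F V e J f \<longleftrightarrow>
     finite V \<and> finite J \<and> (\<forall>j\<in>J. f j \<in> hforms V (e j)) \<and>
     alg_independent F {(j, a). j \<in> J \<and> a \<in> mons V (e j)} (\<lambda>(j, a). lookup (f j) a)"

lemma alg_independent_subset:
  fixes c :: "'i \<Rightarrow> 'k::field"
  assumes "alg_independent F A c" "A' \<subseteq> A" "\<And>i. i \<in> A' \<Longrightarrow> c' i = c i"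
  shows "alg_independent F A' c'"
  unfolding alg_independent_def
proof (intro allI impI)
  fix p :: "('i, 'k) mpoly"
  assume p: "(\<forall>a. lookup p a \<in> F) \<and> (\<forall>a\<in>keys p. keys a \<subseteq> A') \<and> poly_eval id c' p = 0"
  have "poly_eval id c' p = poly_eval id c p"
    unfolding poly_eval_def using p assms(3)
    by (intro sum.cong arg_cong2[of _ _ _ _ "(*)"] prod.cong refl) (auto simp: subset_iff)
  then show "p = 0" using p assms(1,2) unfolding alg_independent_def by (metis order_trans)
qed

text \<open>Substitution of 0 for the variables outside \<open>V\<close>, written as deletion of
  terms so that the surviving coefficients are visibly unchanged. It serves both as \<pi> and to cut
  binary forms out of generic forms.\<close>

definition restrict_vars :: "'i set \<Rightarrow> ('i, 'a::comm_ring_1) mpoly \<Rightarrow> ('i, 'a) mpoly" where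
  "restrict_vars V p = (\<Sum>a\<in>{a \<in> keys p. keys a \<subseteq> V}. single a (lookup p a))"

lemma lookup_restrict_vars: "lookup (restrict_vars V p) a = (lookup p a when keys a \<subseteq> V)"
proof -
  have "lookup (restrict_vars V p) a = (\<Sum>b\<in>{b \<in> keys p. keys b \<subseteq> V}. if b = a then lookup p a else 0)"
    unfolding restrict_vars_def lookup_sum by (rule sum.cong) (auto simp: lookup_single when_def)
  then show ?thesis by (auto simp: when_def in_keys_iff)
qed

lemma keys_restrict_vars: "keys (restrict_vars V p) = {a \<in> keys p. keys a \<subseteq> V}"
proof (rule Set.set_eqI)
  fix a
  have "a \<in> keys (restrict_vars V p) \<longleftrightarrow> lookup (restrict_vars V p) a \<noteq> 0"
    by (rule in_keys_iff)
  then show "a \<in> keys (restrict_vars V p) \<longleftrightarrow> a \<in> {a \<in> keys p. keys a \<subseteq> V}"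
    by (auto simp: lookup_restrict_vars lookup_not_eq_zero_eq_in_keys)
qed

lemma restrict_vars_hforms: "p \<in> hforms W D \<Longrightarrow> restrict_vars V p \<in> hforms V D"
  by (auto simp: hforms_def keys_restrict_vars mons_def)

lemma generic_family_restrict:
  assumes "generic_family F V e J f" "J' \<subseteq> J" "V' \<subseteq> V"
  shows "generic_family F V' e J' (\<lambda>j. restrict_vars V' (f j))"
  unfolding generic_family_def
proof (intro conjI ballI)
  show "finite V'" "finite J'" using assms finite_subset unfolding generic_family_def by auto
  show "restrict_vars V' (f j) \<in> hforms V' (e j)" if "j \<in> J'" for j
    using that assms restrict_vars_hforms unfolding generic_family_def by blast
  have "alg_independent F {(j, a). j \<in> J \<and> a \<in> mons V (e j)} (\<lambda>(j, a). lookup (f j) a)"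
    using assms(1) by (simp add: generic_family_def)
  then show "alg_independent F {(j, a). j \<in> J' \<and> a \<in> mons V' (e j)} (\<lambda>(j, a). lookup (restrict_vars V' (f j)) a)"
    by (rule alg_independent_subset) (use assms in \<open>auto simp: mons_def lookup_restrict_vars\<close>)
qed

lemma generic_family_subset:
  assumes "generic_family F V e J f" "J' \<subseteq> J"
  shows "generic_family F V e J' f"
proof -
  have "alg_independent F {(j, a). j \<in> J \<and> a \<in> mons V (e j)} (\<lambda>(j, a). lookup (f j) a)"
    using assms(1) by (simp add: generic_family_def)
  then have "alg_independent F {(j, a). j \<in> J' \<and> a \<in> mons V (e j)} (\<lambda>(j, a). lookup (f j) a)"
    by (rule alg_independent_subset) (use assms in auto)
  then show ?thesis using assms finite_subset unfolding generic_family_def by auto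
qed

text \<open>For forms \<open>f j\<close> of degree \<open>e j\<close> this is the
  degree-\<open>D\<close> component of the ideal they generate. The explicit spanning vectors have
  single coefficients of the \<open>f j\<close> as coordinates, the shape wanted by
  \<open>generic_spanning\<close>; stating the degree as a sum avoids truncated subtraction.\<close>

definition ideal_part ::
  "'i set \<Rightarrow> ('j \<Rightarrow> nat) \<Rightarrow> 'j set \<Rightarrow> ('j \<Rightarrow> ('i, 'k::field) mpoly) \<Rightarrow> nat \<Rightarrow> ('i, 'k) mpoly set" where
  "ideal_part V e J f D = pv.span {mono_poly a * f j | j a. j \<in> J \<and> keys a \<subseteq> V \<and> mdeg a + e j = D}"

lemma subspace_ideal_part [simp]: "pv.subspace (ideal_part V e J f D)"
  by (simp add: ideal_part_def)

lemma ideal_part_base: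
  "j \<in> J \<Longrightarrow> keys a \<subseteq> V \<Longrightarrow> mdeg a + e j = D \<Longrightarrow> mono_poly a * f j \<in> ideal_part V e J f D"
  unfolding ideal_part_def by (rule pv.span_base) auto

lemma ideal_part_subset_hforms:
  assumes "\<And>j. j \<in> J \<Longrightarrow> f j \<in> hforms V (e j)"
  shows "ideal_part V e J f D \<subseteq> hforms V D"
  unfolding ideal_part_def
proof (rule pv.span_minimal)
  show "{mono_poly a * f j | j a. j \<in> J \<and> keys a \<subseteq> V \<and> mdeg a + e j = D} \<subseteq> hforms V D"
    using assms by (auto simp: mons_def intro!: hforms_mult)
qed simp

lemma subspace_mult_vimage:
  fixes W :: "('i, 'a::field) mpoly set"
  shows "pv.subspace W \<Longrightarrow> pv.subspace {q. p * q \<in> W}"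
  by (rule pv.subspaceI)
     (auto simp: distrib_left scl_mult pv.subspace_0 pv.subspace_add pv.subspace_scale)

lemma hforms_mult_span:
  fixes W :: "('i, 'a::field) mpoly set"
  assumes "pv.subspace W" "p \<in> hforms V D" "\<And>a. a \<in> mons V D \<Longrightarrow> mono_poly a * q \<in> W"
  shows "p * q \<in> W"
proof -
  have "hforms V D \<subseteq> {p. q * p \<in> W}"
    unfolding hforms_eq_span
    by (rule pv.span_minimal[OF _ subspace_mult_vimage]) (use assms in \<open>auto simp: mult.commute\<close>)
  then show ?thesis using assms(2) by (auto simp: mult.commute)
qed

lemma ideal_part_mult:
  assumes "p \<in> hforms V E" "q \<in> ideal_part V e J f D"
  shows "p * q \<in> ideal_part V e J f (E + D)"
proof -
  have "ideal_part V e J f D \<subseteq> {q. p * q \<in> ideal_part V e J f (E + D)}"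
    unfolding ideal_part_def[of _ _ _ _ D]
  proof (rule pv.span_minimal[OF _ subspace_mult_vimage[OF subspace_ideal_part]], safe)
    fix j a assume j: "j \<in> J" "keys a \<subseteq> V" "D = mdeg a + e j"
    show "p * (mono_poly a * f j) \<in> ideal_part V e J f (E + (mdeg a + e j))"
    proof (rule hforms_mult_span[OF subspace_ideal_part assms(1)])
      fix b assume "b \<in> mons V E"
      then have "mono_poly (b + a) * f j \<in> ideal_part V e J f (E + (mdeg a + e j))"
        using j by (intro ideal_part_base) (auto simp: keys_add_expo mons_def)
      then show "mono_poly b * (mono_poly a * f j) \<in> ideal_part V e J f (E + (mdeg a + e j))"
        by (simp add: mono_poly_add mult.assoc)
    qed
  qed
  then show ?thesis using assms(2) by blast
qed

lemma ideal_part_mono: "J' \<subseteq> J \<Longrightarrow> ideal_part V e J' f D \<subseteq> ideal_part V e J f D"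
  unfolding ideal_part_def by (rule pv.span_mono) auto

lemma span_span_Un:
  fixes S :: "('i, 'k::field) mpoly set"
  shows "pv.span (pv.span S \<union> T) = pv.span (S \<union> T)"
proof
  have "pv.span S \<subseteq> pv.span (S \<union> T)" "T \<subseteq> pv.span (S \<union> T)"
    using pv.span_mono[of S "S \<union> T"] pv.span_superset[of "S \<union> T"] by auto
  then show "pv.span (pv.span S \<union> T) \<subseteq> pv.span (S \<union> T)"
    by (intro pv.span_minimal) auto
  show "pv.span (S \<union> T) \<subseteq> pv.span (pv.span S \<union> T)"
    using pv.span_superset[of S] by (intro pv.span_mono) auto
qed

text \<open>The specialisation principle behind all examples: if ideal and \<open>T\<close> together
  fill degree \<open>D\<close> for some forms \<open>f0\<close> of the same degrees over
  \<open>K\<close>, then they do so for generic ones.\<close>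

lemma generic_forms_span:
  fixes f f0 :: "'j \<Rightarrow> ('i, 'k::field) mpoly"
  assumes F: "subfield F (ring_of_type_algebra :: 'k ring)" and gen: "generic_family F V e J f"
    and f0: "\<And>j. j \<in> J \<Longrightarrow> f0 j \<in> hforms V (e j)"
    and T: "T \<subseteq> mons V D"
    and span: "mono_poly ` mons V D \<subseteq> pv.span (ideal_part V e J f0 D \<union> mono_poly ` T)"
  shows "mono_poly ` mons V D \<subseteq> pv.span (ideal_part V e J f D \<union> mono_poly ` T)"
proof -
  define A where "A = {(j, a). j \<in> J \<and> a \<in> mons V (e j)}"
  define P where "P = {(j, a). j \<in> J \<and> keys a \<subseteq> V \<and> mdeg a + e j = D}"
  \<comment> \<open>Left labels stand for the monomials in \<open>T\<close>, which stay fixed under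
    specialisation; right labels stand for the monomial multiples of the forms.\<close>
  define L where "L = Inl ` T \<union> Inr ` P"
  define v where "v = (\<lambda>f :: 'j \<Rightarrow> ('i, 'k) mpoly. case_sum mono_poly (\<lambda>(j, a). mono_poly a * f j))"
  \<comment> \<open>The coefficient of \<open>b\<close> in \<open>x^a f_j\<close> is the coefficient
    of \<open>b - a\<close> in \<open>f_j\<close>. Subtraction of exponents is truncated, hence the
    guard that \<open>a\<close> divides \<open>b\<close>.\<close>
  define E :: "'i expo + 'j \<times> 'i expo \<Rightarrow> 'i expo \<Rightarrow> ('j \<times> 'i expo, 'k) mpoly"
    where "E = case_sum (\<lambda>a b. 1 when a = b)
      (\<lambda>(j, a) b. poly_var (j, b - a) when (\<exists>c. b = a + c \<and> (j, c) \<in> A))"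
  have span_eq: "pv.span (ideal_part V e J f D \<union> mono_poly ` T) = pv.span (v f ` L)"
    for f :: "'j \<Rightarrow> ('i, 'k) mpoly"
  proof -
    have eq: "v f ` L = {mono_poly a * f j | j a. j \<in> J \<and> keys a \<subseteq> V \<and> mdeg a + e j = D} \<union> mono_poly ` T"
      by (auto simp: v_def L_def P_def image_Un image_image)
    show ?thesis unfolding eq ideal_part_def by (rule span_span_Un)
  qed
  interpret ev: comm_ring_hom "poly_eval id c :: ('j \<times> 'i expo, 'k) mpoly \<Rightarrow> 'k" for c
    by (rule comm_ring_hom_poly_eval[OF comm_ring_hom_id])
  have lookup_v: "lookup (v f l) b = poly_eval id (\<lambda>(j, a). lookup (f j) a) (E l b)"
    if l: "l \<in> L" and f: "\<And>j. j \<in> J \<Longrightarrow> f j \<in> hforms V (e j)" for l b and f :: "'j \<Rightarrow> ('i, 'k) mpoly"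
  proof (cases l)
    case (Inl a)
    then show ?thesis by (auto simp: v_def E_def lookup_mono_poly when_def)
  next
    case (Inr q)
    then obtain j a where q: "l = Inr (j, a)" "j \<in> J" using l by (cases q) (auto simp: L_def P_def)
    show ?thesis
    proof (cases "\<exists>c. b = a + c \<and> (j, c) \<in> A")
      case True
      then obtain c where "b = a + c" "(j, c) \<in> A" by blast
      then show ?thesis using q by (auto simp: v_def E_def poly_eval_var when_def)
    next
      case False
      have "b \<notin> keys (mono_poly a * f j)"
        using False f[OF q(2)] q(2) by (auto simp: keys_mono_mult hforms_def A_def)
      moreover have "E l b = 0" using q False by (auto simp: E_def when_def)
      ultimately show ?thesis using q by (simp add: v_def in_keys_iff)
    qed
  qed
  have keys_v: "keys (v f l) \<subseteq> mons V D"
    if l: "l \<in> L" and f: "\<And>j. j \<in> J \<Longrightarrow> f j \<in> hforms V (e j)" for l and f :: "'j \<Rightarrow> ('i, 'k) mpoly"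
  proof (cases l)
    case (Inl a)
    then show ?thesis using l T by (auto simp: v_def L_def)
  next
    case (Inr q)
    then obtain j a where q: "l = Inr (j, a)" "j \<in> J" "keys a \<subseteq> V" "mdeg a + e j = D"
      using l by (cases q) (auto simp: L_def P_def)
    then have "mono_poly a * f j \<in> hforms V D"
      using hforms_mult[of "mono_poly a" V "mdeg a" "f j" "e j"] f by (auto simp: mons_def)
    then show ?thesis using q by (simp add: v_def hforms_def)
  qed
  have f: "\<And>j. j \<in> J \<Longrightarrow> f j \<in> hforms V (e j)" using gen by (simp add: generic_family_def)
  have "mono_poly ` mons V D \<subseteq> pv.span (v f ` L)"
  proof (rule generic_spanning[OF F])
    show "alg_independent F A (\<lambda>(j, a). lookup (f j) a)"
      using gen by (simp add: generic_family_def A_def)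
    show "finite (mons V D)" using gen by (simp add: generic_family_def)
    show "E l b \<in> polys_over F A" if "l \<in> L" for l b
      using that by (auto simp: E_def L_def when_def intro!: polys_over_closed[OF F] split: sum.splits)
    show "mono_poly ` mons V D \<subseteq> pv.span (v f0 ` L)" using span by (simp add: span_eq)
  qed (use lookup_v keys_v f f0 in auto)
  then show ?thesis by (simp add: span_eq)
qed

subsection \<open>The Hilbert function of generic complete intersections\<close>

text \<open>The standard monomials of degree \<open>D\<close> for the ideal of pure powers of the
  first \<open>r\<close> variables. Forms are counted from 0 and variables from 1, so
  \<open>f j\<close> is matched with variable \<open>Suc j\<close>.\<close>

definition box :: "nat \<Rightarrow> (nat \<Rightarrow> nat) \<Rightarrow> nat \<Rightarrow> nat \<Rightarrow> nat expo set" where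
  "box m e r D = {a \<in> mons {1..m} D. \<forall>j<r. lookup a (Suc j) < e j}"

lemma finite_box [simp]: "finite (box m e r D)"
  by (simp add: box_def)

text \<open>The numerical form of the exact sequence given by multiplication with the next pure
  power: the monomials divisible by it are a shifted copy of the box.\<close>

lemma card_box_Suc:
  assumes "r < m"
  shows "card (box m e r D) = card (box m e (Suc r) D) + (if e r \<le> D then card (box m e r (D - e r)) else 0)"
proof -
  have split: "box m e r D = box m e (Suc r) D \<union> {a \<in> box m e r D. e r \<le> lookup a (Suc r)}"
    "box m e (Suc r) D \<inter> {a \<in> box m e r D. e r \<le> lookup a (Suc r)} = {}"
    by (auto simp: box_def less_Suc_eq)
  have "card {a \<in> box m e r D. e r \<le> lookup a (Suc r)} = (if e r \<le> D then card (box m e r (D - e r)) else 0)"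
  proof (cases "e r \<le> D")
    case True
    have "{a \<in> box m e r D. e r \<le> lookup a (Suc r)} = (+) (single (Suc r) (e r)) ` box m e r (D - e r)"
    proof (intro antisym subsetI)
      fix a assume a: "a \<in> {a \<in> box m e r D. e r \<le> lookup a (Suc r)}"
      obtain c where c: "a = single (Suc r) (e r) + c" "keys c \<subseteq> keys a"
        by (rule expo_diff[of "single (Suc r) (e r)" a]) (use a in \<open>auto simp: lookup_single when_def\<close>)
      have "lookup c j \<le> lookup a j" for j by (simp add: c(1) lookup_add)
      then have "lookup c (Suc j) < e j" if "j < r" for j
        using a that by (simp add: box_def) (meson le_less_trans)
      moreover have "mdeg a = e r + mdeg c" by (simp add: c(1))
      ultimately have "c \<in> box m e r (D - e r)"
        using a c(2) by (auto simp: box_def mons_def)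
      with c show "a \<in> (+) (single (Suc r) (e r)) ` box m e r (D - e r)" by blast
    next
      fix a assume "a \<in> (+) (single (Suc r) (e r)) ` box m e r (D - e r)"
      then obtain c where c: "a = single (Suc r) (e r) + c" "c \<in> box m e r (D - e r)" by blast
      have "keys c \<subseteq> {1..m}" "mdeg c = D - e r" "\<And>j. j < r \<Longrightarrow> lookup c (Suc j) < e j"
        using c(2) by (auto simp: box_def mons_def)
      moreover from this(1) have "keys a \<subseteq> {1..m}"
        using assms unfolding c(1) keys_add_expo by (simp del: One_nat_def)
      ultimately show "a \<in> {a \<in> box m e r D. e r \<le> lookup a (Suc r)}"
        using True by (simp add: c(1) box_def mons_def lookup_add lookup_single when_def)
    qed
    then show ?thesis using True by (simp add: card_image)
  next
    case False
    then have "{a \<in> box m e r D. e r \<le> lookup a (Suc r)} = {}"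
      by (auto simp: box_def mons_def dest: le_trans[OF _ lookup_le_mdeg[of _ "Suc r"]])
    then show ?thesis using False by simp
  qed
  moreover have "card (box m e r D) = card (box m e (Suc r) D) + card {a \<in> box m e r D. e r \<le> lookup a (Suc r)}"
    by (subst split(1), rule card_Un_disjoint[OF finite_box _ split(2)]) simp
  ultimately show ?thesis by simp
qed

text \<open>Specialising every form to a pure power of its own variable shows that generic forms
  generate at least as much in each degree.\<close>

lemma generic_family_box_span:
  fixes f :: "nat \<Rightarrow> (nat, 'k::field) mpoly"
  assumes F: "subfield F (ring_of_type_algebra :: 'k ring)" and gen: "generic_family F {1..m} e {..<r} f"
    and r: "r \<le> m"
  shows "mono_poly ` mons {1..m} D \<subseteq> pv.span (ideal_part {1..m} e {..<r} f D \<union> mono_poly ` box m e r D)"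
proof (rule generic_forms_span[OF F gen])
  let ?f0 = "\<lambda>j. mono_poly (single (Suc j) (e j)) :: (nat, 'k) mpoly"
  show "?f0 j \<in> hforms {1..m} (e j)" if "j \<in> {..<r}" for j
    using that r by (auto simp: mons_def split: if_splits)
  show "box m e r D \<subseteq> mons {1..m} D" by (auto simp: box_def)
  show "mono_poly ` mons {1..m} D \<subseteq> pv.span (ideal_part {1..m} e {..<r} ?f0 D \<union> mono_poly ` box m e r D)"
  proof (intro image_subsetI)
    fix a assume a: "a \<in> mons {1..m} D"
    show "mono_poly a \<in> pv.span (ideal_part {1..m} e {..<r} ?f0 D \<union> mono_poly ` box m e r D)"
    proof (cases "a \<in> box m e r D")
      case False
      then obtain j where j: "j < r" "e j \<le> lookup a (Suc j)" using a by (auto simp: box_def not_less)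
      obtain c where c: "a = single (Suc j) (e j) + c" "keys c \<subseteq> keys a"
        by (rule expo_diff[of "single (Suc j) (e j)" a]) (use j in \<open>auto simp: lookup_single when_def\<close>)
      have "mono_poly c * ?f0 j \<in> ideal_part {1..m} e {..<r} ?f0 D"
        using a c j by (intro ideal_part_base) (auto simp: mons_def)
      then have "mono_poly a \<in> ideal_part {1..m} e {..<r} ?f0 D"
        by (simp add: c(1) mono_poly_add mult.commute)
      then show ?thesis by (intro pv.span_base) simp
    qed (auto intro: pv.span_base)
  qed
qed

lemma generic_family_hforms:
  "generic_family F V e J f \<Longrightarrow> j \<in> J \<Longrightarrow> f j \<in> hforms V (e j)"
  by (simp add: generic_family_def)

text \<open>The box spans a complement, which bounds the dimension of the ideal from below. From
  above, a new form adds at most its multiples by a complement of the previous ideal. The recursion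
  for boxes makes the two bounds meet.\<close>

lemma dim_ideal_part_plus_box:
  fixes f :: "nat \<Rightarrow> (nat, 'k::field) mpoly"
  assumes F: "subfield F (ring_of_type_algebra :: 'k ring)" and gen: "generic_family F {1..m} e {..<r} f"
    and r: "r \<le> m"
  shows "pv.dim (ideal_part {1..m} e {..<r} f D) + card (box m e r D) = card (mons {1..m} D)"
  using gen r
proof (induction r arbitrary: D)
  case 0
  have "ideal_part {1..m} e {..<0} f D = {0}" by (simp add: ideal_part_def)
  moreover have "pv.dim {0 :: (nat, 'k) mpoly} = 0"
    by (rule pv.dim_unique[of "{}"]) (simp_all add: pv.independent_empty pv.span_empty)
  ultimately show ?case by (simp add: box_def)
next
  case (Suc r)
  let ?W = "\<lambda>r D. ideal_part {1..m} e {..<r} f D"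
  have gen: "generic_family F {1..m} e {..<r} f"
    using Suc.prems(1) by (rule generic_family_subset) auto
  note IH = Suc.IH[OF gen]
  have sub: "?W (Suc r) D \<subseteq> hforms {1..m} D" "?W r D \<subseteq> hforms {1..m} D" for D
    by (intro ideal_part_subset_hforms generic_family_hforms[OF Suc.prems(1)] generic_family_hforms[OF gen];
        assumption)+
  have "hforms {1..m} D \<subseteq> pv.span (?W (Suc r) D \<union> mono_poly ` box m e (Suc r) D)"
    unfolding hforms_eq_span
    by (rule pv.span_minimal) (use generic_family_box_span[OF F Suc.prems] in auto)
  from card_mons_le_dim[OF _ _ sub(1) _ this]
  have "card (mons {1..m} D) \<le> pv.dim (?W (Suc r) D) + card (mono_poly ` box m e (Suc r) D :: (nat, 'k) mpoly set)"
    by simp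
  then have ge: "card (mons {1..m} D) \<le> pv.dim (?W (Suc r) D) + card (box m e (Suc r) D)"
    by (simp add: card_image[OF inj_on_subset[OF inj_mono_poly]])
  have "pv.dim (?W (Suc r) D) \<le> pv.dim (?W r D) + (if e r \<le> D then card (box m e r (D - e r)) else 0)"
  proof (cases "e r \<le> D")
    case True
    obtain T where T: "finite T" "T \<subseteq> hforms {1..m} (D - e r)"
      "hforms {1..m} (D - e r) \<subseteq> pv.span (?W r (D - e r) \<union> T)"
      "card T + pv.dim (?W r (D - e r)) = card (mons {1..m} (D - e r))"
      by (rule complement_exists[OF _ subspace_ideal_part sub(2), where Q = "{}"]) auto
    \<comment> \<open>Multiples of \<open>f r\<close> by elements of the previous ideal lie in that
      ideal already, so only multiples by the complement \<open>T\<close> count.\<close>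
    have mult: "f r * q \<in> pv.span (?W r D \<union> (*) (f r) ` T)" if "q \<in> hforms {1..m} (D - e r)" for q
    proof -
      have "pv.span (?W r (D - e r) \<union> T) \<subseteq> {q. f r * q \<in> pv.span (?W r D \<union> (*) (f r) ` T)}"
      proof (rule pv.span_minimal[OF _ subspace_mult_vimage[OF pv.subspace_span]])
        have "f r * q \<in> ?W r D" if "q \<in> ?W r (D - e r)" for q
          using ideal_part_mult[OF generic_family_hforms[OF Suc.prems(1), of r] that] True by simp
        then show "?W r (D - e r) \<union> T \<subseteq> {q. f r * q \<in> pv.span (?W r D \<union> (*) (f r) ` T)}"
          by (auto intro: pv.span_base)
      qed
      then show ?thesis using that T(3) by blast
    qed
    have "?W (Suc r) D \<subseteq> pv.span (?W r D \<union> (*) (f r) ` T)"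
      unfolding ideal_part_def[of _ _ "{..<Suc r}"]
    proof (rule pv.span_minimal[OF _ pv.subspace_span], rule subsetI)
      fix x assume "x \<in> {mono_poly a * f j | j a. j \<in> {..<Suc r} \<and> keys a \<subseteq> {1..m} \<and> mdeg a + e j = D}"
      then obtain j a where j: "x = mono_poly a * f j" "j < Suc r" "keys a \<subseteq> {1..m}" "mdeg a + e j = D"
        by blast
      show "x \<in> pv.span (?W r D \<union> (*) (f r) ` T)"
      proof (cases "j = r")
        case True
        have "mono_poly a \<in> hforms {1..m} (D - e r)" using j True by (auto simp: mons_def)
        from mult[OF this] show ?thesis using j True by (simp add: mult.commute)
      next
        case False
        then show ?thesis unfolding j(1) using j by (intro pv.span_base UnI1 ideal_part_base) auto
      qed
    qed
    from dim_le_dim_plus[OF _ subspace_ideal_part sub(2) _ this]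
    have "pv.dim (?W (Suc r) D) \<le> pv.dim (?W r D) + card ((*) (f r) ` T)" using T(1) by simp
    also have "card ((*) (f r) ` T) \<le> card T" using T(1) by (rule card_image_le)
    also have "card T = card (box m e r (D - e r))"
      using T(4) IH[of "D - e r"] Suc.prems(2) by simp
    finally show ?thesis using True by simp
  next
    case False
    have "?W (Suc r) D = ?W r D"
      unfolding ideal_part_def using False by (intro arg_cong[of _ _ pv.span]) (auto simp: less_Suc_eq)
    then show ?thesis by simp
  qed
  moreover have "pv.dim (?W r D) + card (box m e r D) = card (mons {1..m} D)"
    using IH Suc.prems(2) by simp
  moreover have "card (box m e r D) = card (box m e (Suc r) D) + (if e r \<le> D then card (box m e r (D - e r)) else 0)"
    by (rule card_box_Suc) (use Suc.prems(2) in simp)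
  ultimately show ?case using ge by linarith
qed

subsection \<open>The strong Lefschetz property\<close>

text \<open>The last conclusion guards the truncated difference \<open>D - t\<close>: for
  \<open>t > D\<close> only the zero form qualifies.\<close>

lemma divide_out_var:
  fixes p :: "('i, 'a::comm_ring_1) mpoly"
  assumes "p \<in> hforms V D" "\<And>b. b \<in> keys p \<Longrightarrow> t \<le> lookup b z"
  obtains q where "p = mono_poly (single z t) * q" "q \<in> hforms V (D - t)" "p = 0 \<or> t \<le> D"
proof -
  define S :: "'i expo" where "S = single z t"
  define q where "q = (\<Sum>b\<in>keys p. single (b - S) (lookup p b))"
  have S: "b = S + (b - S)" if b: "b \<in> keys p" for b
  proof -
    obtain c where "b = S + c"
      by (rule expo_diff[of S b]) (use assms(2)[OF b] in \<open>auto simp: S_def lookup_single when_def\<close>)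
    then show ?thesis by simp
  qed
  have "mono_poly S * q = (\<Sum>b\<in>keys p. single (S + (b - S)) (lookup p b))"
    by (simp add: q_def sum_distrib_left mono_poly_def mult_single)
  also have "\<dots> = (\<Sum>b\<in>keys p. single b (lookup p b))" by (rule sum.cong) (use S in auto)
  finally have pq: "p = mono_poly S * q" by (simp flip: poly_mapping_sum_singles)
  have "c \<in> mons V (D - t)" if "c \<in> keys q" for c
  proof -
    have "S + c \<in> mons V D" using that assms(1) pq by (auto simp: keys_mono_mult hforms_def)
    then show ?thesis by (auto simp: mons_def keys_add_expo S_def)
  qed
  then have "q \<in> hforms V (D - t)" by (auto simp: hforms_def)
  moreover have "t \<le> D" if "p \<noteq> 0"
  proof -
    have "keys p \<noteq> {}" using that by simp
    then obtain b where "b \<in> keys p" by blast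
    then show ?thesis using assms lookup_le_mdeg[of b z] by (force simp: hforms_def mons_def)
  qed
  ultimately show ?thesis using that pq unfolding S_def by blast
qed

text \<open>A monomial of degree \<open>E\<close> outside \<open>(x_l^c, x_z^t)\<close> has exponent
  at least \<open>E + 1 - t\<close> in \<open>x_l\<close> and at least \<open>E + 1 - c\<close> in
  \<open>x_z\<close>. The monomial with these exponents has degree at least \<open>e j\<close> by
  the last hypothesis, so a divisor of it of degree exactly \<open>e j\<close> can be taken as the
  special form.\<close>

lemma binary_form_span:
  fixes f :: "'j \<Rightarrow> ('i, 'k::field) mpoly"
  assumes F: "subfield F (ring_of_type_algebra :: 'k ring)" and lz: "l \<noteq> z"
    and gen: "generic_family F {l, z} e {j} f"
    and E: "c + e j + t \<le> 2 * E + 2"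
  shows "mono_poly ` mons {l, z} E \<subseteq> pv.span (ideal_part {l, z} e {j} f E \<union>
           mono_poly ` {b \<in> mons {l, z} E. c \<le> lookup b l \<or> t \<le> lookup b z})"
proof (rule generic_forms_span[OF F gen])
  \<comment> \<open>As much of the degree as possible goes to \<open>x_l\<close>; the rest,
    \<open>e j - s\<close>, then fits below the exponent of \<open>x_z\<close>.\<close>
  define s where "s = min (e j) (E + 1 - t)"
  define h :: "'i expo" where "h = single l s + single z (e j - s)"
  let ?f0 = "\<lambda>_::'j. mono_poly h :: ('i, 'k) mpoly"
  let ?T = "{b \<in> mons {l, z} E. c \<le> lookup b l \<or> t \<le> lookup b z}"
  have h: "keys h \<subseteq> {l, z}" "mdeg h = e j" "lookup h l = s" "lookup h z = e j - s"
    using lz by (auto simp: h_def keys_add_expo s_def lookup_add lookup_single when_def split: if_splits)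
  show "mono_poly h \<in> hforms {l, z} (e i)" if "i \<in> {j}" for i
    using that h by (simp add: mons_def)
  show "?T \<subseteq> mons {l, z} E" by auto
  show "mono_poly ` mons {l, z} E \<subseteq> pv.span (ideal_part {l, z} e {j} ?f0 E \<union> mono_poly ` ?T)"
  proof (rule image_subsetI)
    fix b assume b: "b \<in> mons {l, z} E"
    show "mono_poly b \<in> pv.span (ideal_part {l, z} e {j} ?f0 E \<union> mono_poly ` ?T)"
    proof (cases "b \<in> ?T")
      case False
      then have lt: "lookup b l < c" "lookup b z < t" using b by auto
      have sum: "lookup b l + lookup b z = E"
        using b lz mdeg_eq_sum[of "{l, z}" b] by (simp add: mons_def)
      have "s \<le> lookup b l" "e j - s \<le> lookup b z"
        using lt sum E unfolding s_def by linarith+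
      then have "lookup h i \<le> lookup b i" for i
        using h by (cases "i = l"; cases "i = z") (auto simp: h_def lookup_add lookup_single)
      then obtain a where a: "b = h + a" "keys a \<subseteq> keys b" by (rule expo_diff)
      have "mono_poly a * ?f0 j \<in> ideal_part {l, z} e {j} ?f0 E"
        by (rule ideal_part_base) (use a b h(2) in \<open>auto simp: mons_def\<close>)
      then have "mono_poly b \<in> ideal_part {l, z} e {j} ?f0 E"
        by (simp add: a(1) mono_poly_add mult.commute)
      then show ?thesis by (intro pv.span_base) simp
    qed (auto intro: pv.span_base)
  qed
qed

text \<open>With \<open>s\<close> the socle degree, \<open>s + t \<le> 2 D\<close> says that \<open>D\<close> is at least as far above \<open>s/2\<close> as
  \<open>D - t\<close> is below it; this is therefore the surjectivity half of the strong Lefschetz property.\<close>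

definition lefschetz :: "nat \<Rightarrow> (nat \<Rightarrow> nat) \<Rightarrow> (nat \<Rightarrow> (nat, 'k::field) mpoly) \<Rightarrow> bool" where
  "lefschetz m e f \<longleftrightarrow> (\<forall>D t. (\<Sum>j<m. e j - 1) + t \<le> 2 * D \<longrightarrow>
     mono_poly ` mons {1..m} D \<subseteq>
       pv.span (ideal_part {1..m} e {..<m} f D \<union> mono_poly ` {b \<in> mons {1..m} D. t \<le> lookup b m}))"

lemma lefschetz_decompose:
  fixes f :: "nat \<Rightarrow> (nat, 'k::field) mpoly"
  assumes "lefschetz m e f" "(\<Sum>j<m. e j - 1) + t \<le> 2 * D" "w \<in> hforms {1..m} D"
  obtains x v where "w = x + mono_poly (single m t) * v" "x \<in> ideal_part {1..m} e {..<m} f D"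
    "v \<in> hforms {1..m} (D - t)" "v = 0 \<or> t \<le> D"
proof -
  let ?B = "{b \<in> mons {1..m} D. t \<le> lookup b m}"
  have "hforms {1..m} D \<subseteq> pv.span (ideal_part {1..m} e {..<m} f D \<union> mono_poly ` ?B)"
    unfolding hforms_eq_span by (rule pv.span_minimal) (use assms(1,2) in \<open>auto simp: lefschetz_def\<close>)
  with assms(3) have "w \<in> pv.span (ideal_part {1..m} e {..<m} f D \<union> mono_poly ` ?B)" by blast
  then obtain x y where xy: "w = x + y" "x \<in> pv.span (ideal_part {1..m} e {..<m} f D)"
    "y \<in> pv.span (mono_poly ` ?B)"
    unfolding pv.span_Un by auto
  have y: "keys y \<subseteq> ?B" using xy(3) by (simp add: span_monos)
  then have "y \<in> hforms {1..m} D" by (auto simp: hforms_def)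
  then obtain v where v: "y = mono_poly (single m t) * v" "v \<in> hforms {1..m} (D - t)" "y = 0 \<or> t \<le> D"
    by (rule divide_out_var[where t = t and z = m]) (use y in auto)
  moreover have "x \<in> ideal_part {1..m} e {..<m} f D"
    using xy(2) pv.span_eq_iff[THEN iffD2, OF subspace_ideal_part] by blast
  moreover have "v = 0 \<or> t \<le> D" using v(1,3) by (metis mono_mult_eq_0_iff)
  ultimately show ?thesis using that xy(1) by blast
qed

text \<open>Over the algebra of the first \<open>m\<close> forms, with \<open>l\<close> the variable
  \<open>m\<close>, every form is a primitive form plus a multiple of \<open>l\<close>, up to the
  ideal. A primitive form of degree \<open>i\<close> is killed by \<open>l^c\<close> with
  \<open>c = s - 2i + 1\<close>, so on its multiples by monomials in \<open>l\<close> and the new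
  variable only the ideal \<open>(l^c, z^t, f_m)\<close> in two variables matters. No direct sum
  decomposition is needed, only the descent in the degree.\<close>

lemma lefschetz_step:
  fixes f :: "nat \<Rightarrow> (nat, 'k::field) mpoly"
  assumes F: "subfield F (ring_of_type_algebra :: 'k ring)"
    and m: "1 \<le> m" and L: "lefschetz m e f"
    and gen: "generic_family F {m, Suc m} e {m} f"
    and f: "\<And>j. j < m \<Longrightarrow> f j \<in> hforms {1..m} (e j)" and em: "0 < e m"
  shows "lefschetz (Suc m) e f"
  unfolding lefschetz_def
proof (intro allI impI)
  fix D t assume D: "(\<Sum>j<Suc m. e j - 1) + t \<le> 2 * D"
  define s where "s = (\<Sum>j<m. e j - 1)"
  let ?V = "{1..Suc m}"
  define G where "G = (\<lambda>D. pv.span (ideal_part ?V e {..<Suc m} f D \<union>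
    mono_poly ` {b \<in> mons ?V D. t \<le> lookup b (Suc m)}))"
  let ?l = "\<lambda>u. mono_poly (single m u) :: (nat, 'k) mpoly"
  let ?z = "\<lambda>u. mono_poly (single (Suc m) u) :: (nat, 'k) mpoly"
  have subG: "pv.subspace (G D)" for D by (simp add: G_def)
  have G_ideal: "x \<in> G D" if "x \<in> ideal_part ?V e {..<Suc m} f D" for x D
    using that by (auto simp: G_def intro: pv.span_base)
  have G_mono: "mono_poly b \<in> G D" if "b \<in> mons ?V D" "t \<le> lookup b (Suc m)" for b D
    using that by (auto simp: G_def intro: pv.span_base)
  have V: "{1..m} \<subseteq> ?V" "{m, Suc m} \<subseteq> ?V" using m by auto
  have ideal_m: "ideal_part {1..m} e {..<m} f D \<subseteq> ideal_part ?V e {..<Suc m} f D" for D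
    unfolding ideal_part_def using V by (intro pv.span_mono) fastforce
  have l: "?l u \<in> hforms {1..m} u" "?l u \<in> hforms ?V u" for u using m by (auto simp: mons_def)
  have z: "?z u \<in> hforms ?V u" for u by (auto simp: mons_def)
  \<comment> \<open>Factors of \<open>l\<close> split off from \<open>w\<close> are moved into
    \<open>u\<close>; this lowers \<open>i\<close> and leaves \<open>i + u + v\<close> unchanged,
    and with it the numerical hypothesis.\<close>
  have main: "w * (?l u * ?z v) \<in> G (i + (u + v))"
    if "w \<in> hforms {1..m} i" "s + (e m - 1) + t \<le> 2 * (i + u + v)" for w i u v
    using that
  proof (induction i arbitrary: w u v rule: less_induct)
    case (less i)
    have lz: "?l u * ?z v \<in> hforms ?V (u + v)" by (rule hforms_mult[OF l(2) z])
    have ideal_lz: "x * (?l u * ?z v) \<in> G (i + (u + v))" if "x \<in> ideal_part {1..m} e {..<m} f i" for x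
      using ideal_part_mult[OF lz, of x e "{..<Suc m}" f i] ideal_m that
      by (intro G_ideal) (auto simp: mult.commute add.commute)
    show ?case
    proof (cases "s < 2 * i")
      case True
      \<comment> \<open>Above the middle degree \<open>s/2\<close> the Lefschetz property makes
        \<open>w\<close> a multiple of \<open>l^t'\<close> modulo the ideal, so there is no
        primitive part.\<close>
      define t' where "t' = 2 * i - s"
      have "(\<Sum>j<m. e j - 1) + t' \<le> 2 * i" using True by (simp add: t'_def s_def)
      then obtain x y where xy: "w = x + ?l t' * y" "x \<in> ideal_part {1..m} e {..<m} f i"
        "y \<in> hforms {1..m} (i - t')" "y = 0 \<or> t' \<le> i"
        using lefschetz_decompose[OF L _ less.prems(1)] by metis
      have eq: "w * (?l u * ?z v) = x * (?l u * ?z v) + y * (?l (t' + u) * ?z v)"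
        unfolding xy(1) single_add mono_poly_add by (simp add: algebra_simps)
      have "y * (?l (t' + u) * ?z v) \<in> G (i + (u + v))"
      proof (cases "y = 0")
        case True then show ?thesis by (simp add: pv.subspace_0[OF subG])
      next
        case False
        then have t': "t' \<le> i" using xy(4) by simp
        have "i - t' < i" using True t' by (simp add: t'_def)
        moreover have "s + (e m - 1) + t \<le> 2 * ((i - t') + (t' + u) + v)" using less.prems(2) t' by simp
        ultimately have "y * (?l (t' + u) * ?z v) \<in> G ((i - t') + ((t' + u) + v))"
          using less.IH[OF _ xy(3)] by blast
        moreover have "(i - t') + ((t' + u) + v) = i + (u + v)" using t' by simp
        ultimately show ?thesis by (simp only:)
      qed
      then show ?thesis unfolding eq by (intro pv.subspace_add[OF subG] ideal_lz xy(2))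
    next
      case False
      \<comment> \<open>The smallest power of \<open>l\<close> that carries degree \<open>i\<close>
        past the mirror degree \<open>s - i\<close>. In degree \<open>c + i\<close> the Lefschetz
        property gives divisibility by exactly \<open>l^(c + 1)\<close>, one power more than was
        multiplied on.\<close>
      define c where "c = s - 2 * i + 1"
      have c: "c + 2 * i = s + 1" using False by (simp add: c_def)
      have "?l c * w \<in> hforms {1..m} (c + i)" by (rule hforms_mult[OF l(1) less.prems(1)])
      moreover have "(\<Sum>j<m. e j - 1) + (c + 1) \<le> 2 * (c + i)" using c by (simp add: s_def)
      ultimately obtain x y where xy: "?l c * w = x + ?l (c + 1) * y"
        "x \<in> ideal_part {1..m} e {..<m} f (c + i)"
        "y \<in> hforms {1..m} (c + i - (c + 1))" "y = 0 \<or> c + 1 \<le> c + i"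
        using lefschetz_decompose[OF L] by metis
      \<comment> \<open>The primitive part of \<open>w\<close>: comparing both expressions for
        \<open>l^c w\<close> gives \<open>l^c p = x\<close>, an element of the ideal.\<close>
      define p where "p = w - ?l 1 * y"
      have pc: "?l c * p = x"
        using xy(1) unfolding p_def single_add mono_poly_add by (simp add: algebra_simps)
      have ly: "?l 1 * y \<in> hforms {1..m} i"
      proof (cases "y = 0")
        case True then show ?thesis by (simp add: pv.subspace_0)
      next
        case False
        then have "1 + (c + i - (c + 1)) = i" using xy(4) by simp
        then show ?thesis using hforms_mult[OF l(1)[of 1] xy(3)] by (simp only:)
      qed
      have p: "p \<in> hforms {1..m} i"
        unfolding p_def by (rule pv.subspace_diff[OF subspace_hforms less.prems(1) ly])
      have pV: "p \<in> hforms ?V i" using p hforms_mono[OF V(1)] by blast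
      have yz: "y * (?l (1 + u) * ?z v) \<in> G (i + (u + v))"
      proof (cases "y = 0")
        case True then show ?thesis by (simp add: pv.subspace_0[OF subG])
      next
        case False
        then have i: "1 \<le> i" using xy(4) by simp
        have "y \<in> hforms {1..m} (i - 1)" using xy(3) by simp
        moreover have "i - 1 < i" using i by simp
        moreover have "s + (e m - 1) + t \<le> 2 * ((i - 1) + (1 + u) + v)" using less.prems(2) i by simp
        ultimately have "y * (?l (1 + u) * ?z v) \<in> G ((i - 1) + ((1 + u) + v))"
          using less.IH by blast
        moreover have "(i - 1) + ((1 + u) + v) = i + (u + v)" using i by simp
        ultimately show ?thesis by (simp only:)
      qed
      have "p * (?l u * ?z v) \<in> G (i + (u + v))"
      proof -
        let ?T = "{b \<in> mons {m, Suc m} (u + v). c \<le> lookup b m \<or> t \<le> lookup b (Suc m)}"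
        \<comment> \<open>Inserting \<open>c + 2i = s + 1\<close> turns the hypothesis on the total
          degree into precisely the bound for binary forms.\<close>
        have E: "c + e m + t \<le> 2 * (u + v) + 2" using less.prems(2) c em by simp
        have "single m u + single (Suc m) v \<in> mons {m, Suc m} (u + v)"
          by (auto simp: mons_def keys_add_expo)
        then have "mono_poly (single m u + single (Suc m) v)
            \<in> pv.span (ideal_part {m, Suc m} e {m} f (u + v) \<union> mono_poly ` ?T)"
          using binary_form_span[OF F _ gen E] by auto
        moreover have "pv.span (ideal_part {m, Suc m} e {m} f (u + v) \<union> mono_poly ` ?T)
            \<subseteq> {q. p * q \<in> G (i + (u + v))}"
        proof (rule pv.span_minimal[OF _ subspace_mult_vimage[OF subG]], rule Un_least)
          have "ideal_part {m, Suc m} e {m} f (u + v) \<subseteq> ideal_part ?V e {..<Suc m} f (u + v)"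
            unfolding ideal_part_def using V by (intro pv.span_mono) fastforce
          then show "ideal_part {m, Suc m} e {m} f (u + v) \<subseteq> {q. p * q \<in> G (i + (u + v))}"
            using ideal_part_mult[OF pV] G_ideal by blast
          show "mono_poly ` ?T \<subseteq> {q. p * q \<in> G (i + (u + v))}"
          proof (rule image_subsetI, rule CollectI)
            fix b assume b: "b \<in> ?T"
            then have bV: "b \<in> mons ?V (u + v)" using V(2) by (auto simp: mons_def)
            show "p * mono_poly b \<in> G (i + (u + v))"
            proof (cases "t \<le> lookup b (Suc m)")
              case True
              show ?thesis
              proof (rule hforms_mult_span[OF subG pV])
                fix a assume "a \<in> mons ?V i"
                then have "mono_poly (a + b) \<in> G (i + (u + v))"
                  using bV True by (intro G_mono mons_add) (auto simp: lookup_add)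
                then show "mono_poly a * mono_poly b \<in> G (i + (u + v))" by (simp add: mono_poly_add)
              qed
            next
              case False
              then have "c \<le> lookup b m" using b by auto
              then obtain b' where b': "b = single m c + b'" "keys b' \<subseteq> keys b"
                by - (rule expo_diff[of "single m c" b], auto simp: lookup_single when_def)
              have deg: "mdeg b' + (c + i) = i + (u + v)" using bV by (simp add: b'(1) mons_def)
              have "mono_poly b' * x \<in> ideal_part ?V e {..<Suc m} f (mdeg b' + (c + i))"
                by (rule ideal_part_mult) (use xy(2) ideal_m b' bV in \<open>auto simp: mons_def\<close>)
              then have "mono_poly b' * x \<in> G (i + (u + v))" using G_ideal deg by simp
              moreover have "p * mono_poly b = mono_poly b' * x"
                unfolding b'(1) mono_poly_add pc[symmetric] by (simp add: mult_ac)
              ultimately show ?thesis by simp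
            qed
          qed
        qed
        ultimately show ?thesis by (auto simp: mono_poly_add)
      qed
      moreover have "w * (?l u * ?z v) = p * (?l u * ?z v) + y * (?l (1 + u) * ?z v)"
        unfolding p_def single_add mono_poly_add by (simp add: algebra_simps)
      ultimately show ?thesis using yz pv.subspace_add[OF subG] by simp
    qed
  qed
  show "mono_poly ` mons ?V D \<subseteq> pv.span (ideal_part ?V e {..<Suc m} f D \<union>
    mono_poly ` {b \<in> mons ?V D. t \<le> lookup b (Suc m)})"
  proof (rule image_subsetI)
    fix a assume a: "a \<in> mons ?V D"
    \<comment> \<open>Any monomial is a form in the old variables times a power of the new one, so
      \<open>main\<close> is applied with \<open>u = 0\<close>.\<close>
    define v where "v = lookup a (Suc m)"
    have "lookup (single (Suc m) v) i \<le> lookup a i" for i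
      by (simp add: v_def lookup_single when_def)
    then obtain b where b: "a = single (Suc m) v + b" "keys b \<subseteq> keys a" by (rule expo_diff)
    have "lookup a (Suc m) = v + lookup b (Suc m)" by (simp only: b(1) lookup_add lookup_single_eq)
    then have "lookup b (Suc m) = 0" unfolding v_def by linarith
    then have "Suc m \<notin> keys b" by (simp add: in_keys_iff)
    moreover have "keys b \<subseteq> {1..Suc m}" using a b(2) unfolding mons_def by blast
    ultimately have "keys b \<subseteq> {1..Suc m} - {Suc m}" by blast
    moreover have "{1..Suc m} - {Suc m} = {1..m}" by auto
    ultimately have "mono_poly b \<in> hforms {1..m} (mdeg b)" by (simp only: mons_def mono_poly_in_hforms mem_Collect_eq)
    moreover have deg: "mdeg b + v = D"
    proof -
      have "mdeg a = D" using a by (simp add: mons_def)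
      then show ?thesis unfolding b(1) by simp
    qed
    moreover have "s + (e m - 1) + t \<le> 2 * (mdeg b + 0 + v)"
      using D deg by (simp add: s_def)
    ultimately have "mono_poly b * (?l 0 * ?z v) \<in> G (mdeg b + (0 + v))"
      by (intro main)
    moreover have "mono_poly b * (?l 0 * ?z v) = mono_poly a"
      unfolding b(1) mono_poly_add single_zero mono_poly_0 by (simp only: mult_1_left mult.commute)
    ultimately have "mono_poly a \<in> G D" using deg by simp
    then show "mono_poly a \<in> pv.span (ideal_part ?V e {..<Suc m} f D \<union>
        mono_poly ` {b \<in> mons ?V D. t \<le> lookup b (Suc m)})"
      unfolding G_def .
  qed
qed

lemma ideal_part_cong:
  fixes f f' :: "'j \<Rightarrow> ('i, 'k::field) mpoly"
  assumes "\<And>j. j \<in> J \<Longrightarrow> f j = f' j"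
  shows "ideal_part V e J f D = ideal_part V e J f' D"
proof -
  have "{mono_poly a * f j | j a. j \<in> J \<and> keys a \<subseteq> V \<and> mdeg a + e j = D} =
    (\<lambda>(j, a). mono_poly a * f j) ` {(j, a). j \<in> J \<and> keys a \<subseteq> V \<and> mdeg a + e j = D}"
    for f :: "'j \<Rightarrow> ('i, 'k) mpoly"
    by auto
  moreover have "(\<lambda>(j, a). mono_poly a * f j) ` {(j, a). j \<in> J \<and> keys a \<subseteq> V \<and> mdeg a + e j = D} =
    (\<lambda>(j, a). mono_poly a * f' j) ` {(j, a). j \<in> J \<and> keys a \<subseteq> V \<and> mdeg a + e j = D}"
    by (rule image_cong) (auto simp: assms)
  ultimately show ?thesis unfolding ideal_part_def by (simp only:)
qed

lemma generic_family_cong: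
  assumes "generic_family F V e J f" "\<And>j. j \<in> J \<Longrightarrow> f' j = f j"
  shows "generic_family F V e J f'"
proof -
  have "alg_independent F {(j, a). j \<in> J \<and> a \<in> mons V (e j)} (\<lambda>(j, a). lookup (f j) a)"
    using assms(1) by (simp add: generic_family_def)
  then have "alg_independent F {(j, a). j \<in> J \<and> a \<in> mons V (e j)} (\<lambda>(j, a). lookup (f' j) a)"
    by (rule alg_independent_subset) (use assms(2) in auto)
  then show ?thesis using assms by (simp add: generic_family_def)
qed

lemma lefschetz_cong:
  assumes "\<And>j. j < m \<Longrightarrow> f j = f' j" "lefschetz m e f"
  shows "lefschetz m e f'"
proof -
  have "ideal_part {1..m} e {..<m} f D = ideal_part {1..m} e {..<m} f' D" for D
    using assms(1) by (intro ideal_part_cong) simp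
  then show ?thesis using assms(2) by (simp add: lefschetz_def)
qed

text \<open>The chain of binary forms has coefficients taken from the generic forms, so each link is
  generic and \<open>lefschetz_step\<close> applies along the chain. The chain is itself a
  specialisation of \<open>f\<close>, which transfers the result to \<open>f\<close>.\<close>

theorem lefschetz_generic:
  fixes f :: "nat \<Rightarrow> (nat, 'k::field) mpoly"
  assumes F: "subfield F (ring_of_type_algebra :: 'k ring)"
    and gen: "generic_family F {1..N} e {..<N} f"
    and N: "1 \<le> N" and e: "\<And>j. j < N \<Longrightarrow> 0 < e j"
  shows "lefschetz N e f"
proof -
  define f0 where "f0 = (\<lambda>j. restrict_vars {j, Suc j} (f j))"
  have "lefschetz m e f0 \<and> (\<forall>j<m. f0 j \<in> hforms {1..m} (e j))" if "1 \<le> m" "m \<le> N" for m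
    using that
  proof (induction m rule: dec_induct)
    case base
    have eq: "{..<1} = {0::nat}" by auto
    have keys: "keys (f 0) \<subseteq> mons {1..N} (e 0)"
      using generic_family_hforms[OF gen, of 0] N by (simp add: hforms_def)
    \<comment> \<open>There is no variable with index 0, so the first link of the chain is a form in
      the variable 1 alone.\<close>
    have sub: "keys a \<subseteq> {0, Suc 0} \<longleftrightarrow> keys a \<subseteq> {1}" if "a \<in> mons {1..N} D" for a D
      using that by (auto simp: mons_def)
    have f00: "f0 0 = restrict_vars {1} (f 0)"
    proof (rule poly_mapping_eqI)
      fix a show "lookup (f0 0) a = lookup (restrict_vars {1} (f 0)) a"
      proof (cases "a \<in> keys (f 0)")
        case True
        then have "keys a \<subseteq> {0, Suc 0} \<longleftrightarrow> keys a \<subseteq> {1}" using keys sub by blast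
        then show ?thesis unfolding f0_def lookup_restrict_vars by (simp only:)
      next
        case False
        then have "lookup (f 0) a = 0" by (simp only: not_in_keys_iff_lookup_eq_zero)
        then show ?thesis unfolding f0_def lookup_restrict_vars by simp
      qed
    qed
    have gen1: "generic_family F {1} e {0} (\<lambda>j. restrict_vars {1} (f j))"
      by (rule generic_family_restrict[OF gen]) (use N in auto)
    have f01: "f0 0 \<in> hforms {1} (e 0)" unfolding f00 using generic_family_hforms[OF gen1] by simp
    have "lefschetz 1 e (\<lambda>j. restrict_vars {1} (f j))"
      unfolding lefschetz_def eq atLeastAtMost_singleton
    proof (intro allI impI)
      fix D t assume D: "(\<Sum>j\<in>{0}. e j - 1) + t \<le> 2 * D"
      let ?f0 = "\<lambda>_. mono_poly (single 1 (e 0)) :: (nat, 'k) mpoly"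
      let ?T = "{b \<in> mons {1} D. t \<le> lookup b 1}"
      show "mono_poly ` mons {1} D \<subseteq> pv.span (ideal_part {1} e {0} (\<lambda>j. restrict_vars {1} (f j)) D \<union> mono_poly ` ?T)"
      proof (rule generic_forms_span[OF F gen1])
        show "?f0 j \<in> hforms {1} (e j)" if "j \<in> {0}" for j using that by (simp add: mons_def)
        show "?T \<subseteq> mons {1} D" by auto
        show "mono_poly ` mons {1} D \<subseteq> pv.span (ideal_part {1} e {0} ?f0 D \<union> mono_poly ` ?T)"
        proof (rule image_subsetI)
          fix b :: "nat expo" assume b: "b \<in> mons {1} D"
          have b1: "lookup b 1 = D" using b mdeg_eq_sum[of "{1}" b] by (simp add: mons_def)
          show "mono_poly b \<in> pv.span (ideal_part {1} e {0} ?f0 D \<union> mono_poly ` ?T)"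
          proof (cases "t \<le> D")
            case True
            then show ?thesis using b b1 by (intro pv.span_base) auto
          next
            case False
            then have "e 0 \<le> D" using D e[of 0] N by simp
            then obtain c where c: "b = single 1 (e 0) + c" "keys c \<subseteq> keys b"
              using b1 by - (rule expo_diff[of "single 1 (e 0)" b], auto simp: lookup_single when_def)
            have "mono_poly c * ?f0 0 \<in> ideal_part {1} e {0} ?f0 D"
              by (rule ideal_part_base) (use b c in \<open>auto simp: mons_def\<close>)
            then have "mono_poly b \<in> ideal_part {1} e {0} ?f0 D"
              by (simp add: c(1) mono_poly_add mult.commute)
            then show ?thesis by (intro pv.span_base) simp
          qed
        qed
      qed
    qed
    then have "lefschetz 1 e f0" by (rule lefschetz_cong[rotated]) (simp add: f00)
    then show ?case using f01 by simp
  next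
    case (step m)
    then have IH: "lefschetz m e f0" "\<And>j. j < m \<Longrightarrow> f0 j \<in> hforms {1..m} (e j)" by auto
    have "generic_family F {m, Suc m} e {m} (\<lambda>j. restrict_vars {m, Suc m} (f j))"
      by (rule generic_family_restrict[OF gen]) (use step in auto)
    then have gen2: "generic_family F {m, Suc m} e {m} f0"
      by (rule generic_family_cong) (simp add: f0_def)
    have "lefschetz (Suc m) e f0"
      by (rule lefschetz_step[OF F _ IH(1) gen2 IH(2)]) (use step e in auto)
    moreover have "f0 j \<in> hforms {1..Suc m} (e j)" if "j < Suc m" for j
    proof (cases "j = m")
      case True
      then show ?thesis using generic_family_hforms[OF gen2, of m] hforms_mono[of "{m, Suc m}" "{1..Suc m}"] step
        by auto
    next
      case False
      then show ?thesis using IH(2)[of j] hforms_mono[of "{1..m}" "{1..Suc m}"] that by auto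
    qed
    ultimately show ?case by blast
  qed
  from this[OF N] have f0: "lefschetz N e f0" "\<And>j. j < N \<Longrightarrow> f0 j \<in> hforms {1..N} (e j)" by auto
  show ?thesis
    unfolding lefschetz_def
  proof (intro allI impI)
    fix D t assume "(\<Sum>j<N. e j - 1) + t \<le> 2 * D"
    then show "mono_poly ` mons {1..N} D \<subseteq>
        pv.span (ideal_part {1..N} e {..<N} f D \<union> mono_poly ` {b \<in> mons {1..N} D. t \<le> lookup b N})"
      using f0 by (intro generic_forms_span[OF F gen, of f0]) (auto simp: lefschetz_def)
  qed
qed

subsection \<open>Counting boxes\<close>

text \<open>Division into the socle monomial \<open>top\<close>, the product of all variables with
  their maximal exponents, is an involution exchanging degrees \<open>D\<close> and
  \<open>s - D\<close>.\<close>

lemma card_box_symmetric: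
  assumes e: "\<And>j. j < m \<Longrightarrow> 0 < e j" and D: "D \<le> (\<Sum>j<m. e j - 1)"
  shows "card (box m e m ((\<Sum>j<m. e j - 1) - D)) = card (box m e m D)"
proof -
  define s where "s = (\<Sum>j<m. e j - 1)"
  define top :: "nat expo" where "top = (\<Sum>j<m. single (Suc j) (e j - 1))"
  have lt: "lookup top i = (if i \<in> {1..m} then e (i - 1) - 1 else 0)" for i
  proof -
    have "lookup top i = (\<Sum>j<m. if j = i - 1 \<and> i \<noteq> 0 then e (i - 1) - 1 else 0)"
      unfolding top_def lookup_sum
    proof (rule sum.cong[OF refl])
      fix j show "lookup (single (Suc j) (e j - 1)) i = (if j = i - 1 \<and> i \<noteq> 0 then e (i - 1) - 1 else 0)"
        by (cases i) (simp_all add: lookup_single when_def)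
    qed
    also have "\<dots> = (if i \<in> {1..m} then e (i - 1) - 1 else 0)"
    proof (cases i)
      case (Suc k)
      then have "(\<Sum>j<m. if j = i - 1 \<and> i \<noteq> 0 then e (i - 1) - 1 else 0) = (\<Sum>j<m. if j = k then e k - 1 else 0)"
        by simp
      also have "\<dots> = (if k < m then e k - 1 else 0)" by (simp only: sum.delta' finite_lessThan lessThan_iff sum.delta)
      finally show ?thesis using Suc by simp
    qed simp
    finally show ?thesis .
  qed
  have deg_top: "mdeg top = s"
  proof -
    have "mdeg (\<Sum>j\<in>A. single (Suc j) (e j - 1)) = (\<Sum>j\<in>A. e j - 1)" for A
      by (induction A rule: infinite_finite_induct) auto
    then show ?thesis by (simp add: top_def s_def)
  qed
  have le: "lookup a i \<le> lookup top i" if "a \<in> box m e m D" for a i D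
  proof (cases "i \<in> {1..m}")
    case True
    then obtain j where j: "i = Suc j" "j < m" by (cases i) auto
    with that have "lookup a (Suc j) < e j" by (simp add: box_def)
    then show ?thesis using j by (simp add: lt)
  next
    case False
    then have "i \<notin> keys a" using that unfolding box_def mons_def by blast
    then show ?thesis by (simp add: in_keys_iff)
  qed
  have comp: "top - a \<in> box m e m (s - D)" "top - (top - a) = a" if a: "a \<in> box m e m D" "D \<le> s" for a D
  proof -
    obtain c where c: "top = a + c" by (rule expo_diff[OF le[OF a(1)]])
    have "mdeg a = D" using a by (simp add: box_def mons_def)
    then have "mdeg c = s - D" using deg_top by (simp add: c)
    moreover have ci: "lookup c i \<le> (if i \<in> {1..m} then e (i - 1) - 1 else 0)" for i
      unfolding lt[symmetric] by (simp add: c lookup_add)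
    have "keys c \<subseteq> {1..m}"
    proof
      fix i assume i: "i \<in> keys c"
      show "i \<in> {1..m}"
      proof (rule ccontr)
        assume "i \<notin> {1..m}"
        then have "lookup c i \<le> 0" using ci[of i] by (simp only: if_False)
        then show False using i by (simp add: in_keys_iff)
      qed
    qed
    moreover have "lookup c (Suc j) < e j" if "j < m" for j
      using ci[of "Suc j"] e[OF that] that by simp
    ultimately show "top - a \<in> box m e m (s - D)" by (simp add: c box_def mons_def)
    show "top - (top - a) = a" by (simp add: c)
  qed
  have "bij_betw (\<lambda>a. top - a) (box m e m D) (box m e m (s - D))"
  proof (rule bij_betw_byWitness[where f' = "\<lambda>a. top - a"])
    have "s - (s - D) = D" "s - D \<le> s" using D by (simp_all add: s_def)
    then show "\<forall>a\<in>box m e m (s - D). top - (top - a) = a" "(\<lambda>a. top - a) ` box m e m (s - D) \<subseteq> box m e m D"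
      using comp[of _ "s - D"] by auto
    show "\<forall>a\<in>box m e m D. top - (top - a) = a" "(\<lambda>a. top - a) ` box m e m D \<subseteq> box m e m (s - D)"
      using comp[of _ D] D by (auto simp: s_def)
  qed
  then show ?thesis unfolding s_def by (rule bij_betw_same_card[symmetric])
qed

lemma split_last_var:
  fixes a :: "nat expo"
  assumes "keys a \<subseteq> {1..Suc n}"
  obtains v b where "a = single (Suc n) v + b" "keys b \<subseteq> {1..n}" "v = lookup a (Suc n)"
    "\<And>i. i \<le> n \<Longrightarrow> lookup a i = lookup b i" "mdeg a = v + mdeg b"
proof -
  have "lookup (single (Suc n) (lookup a (Suc n))) i \<le> lookup a i" for i
    by (simp add: lookup_single when_def)
  then obtain b where b: "a = single (Suc n) (lookup a (Suc n)) + b" "keys b \<subseteq> keys a"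
    by (rule expo_diff)
  have lk: "lookup a i = lookup (single (Suc n) (lookup a (Suc n))) i + lookup b i" for i
    by (subst b(1)) (rule lookup_add)
  have "lookup b (Suc n) = 0" using lk[of "Suc n"] by simp
  then have "Suc n \<notin> keys b" by (simp add: in_keys_iff)
  moreover have "{1..Suc n} - {Suc n} = {1..n}" by auto
  ultimately have "keys b \<subseteq> {1..n}" using b(2) assms by blast
  moreover have "lookup a i = lookup b i" if "i \<le> n" for i
    using lk[of i] that by (simp add: lookup_single)
  moreover have "mdeg a = lookup a (Suc n) + mdeg b" by (subst b(1)) simp
  ultimately show ?thesis using that b(1) by blast
qed

text \<open>Sorts the monomials of the box by the exponent of the last variable.\<close>

lemma card_box_last:
  "card (box (Suc n) e (Suc n) D) = (\<Sum>v<e n. if v \<le> D then card (box n e n (D - v)) else 0)"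
proof -
  let ?A = "\<lambda>v. (+) (single (Suc n) v) ` (if v \<le> D then box n e n (D - v) else {})"
  have lookup_n: "lookup b (Suc n) = 0" if "b \<in> box n e n D" for b D
  proof -
    have "Suc n \<notin> keys b" using that unfolding box_def mons_def by auto
    then show ?thesis by (simp add: in_keys_iff)
  qed
  have "box (Suc n) e (Suc n) D = (\<Union>v<e n. ?A v)"
  proof (intro antisym subsetI)
    fix a assume a: "a \<in> box (Suc n) e (Suc n) D"
    then have "keys a \<subseteq> {1..Suc n}" by (simp add: box_def mons_def)
    then obtain v b where b: "a = single (Suc n) v + b" "keys b \<subseteq> {1..n}" "v = lookup a (Suc n)"
      "\<And>i. i \<le> n \<Longrightarrow> lookup a i = lookup b i" "mdeg a = v + mdeg b"
      by (rule split_last_var) blast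
    have "mdeg a = D" "lookup a (Suc n) < e n" "\<And>j. j < n \<Longrightarrow> lookup a (Suc j) < e j"
      using a by (auto simp: box_def mons_def)
    with b have "v < e n" "v \<le> D" "b \<in> box n e n (D - v)" by (auto simp: box_def mons_def)
    then show "a \<in> (\<Union>v<e n. ?A v)" using b(1) by auto
  next
    fix a assume "a \<in> (\<Union>v<e n. ?A v)"
    then obtain v where "v < e n" "a \<in> ?A v" by blast
    then obtain b where v: "v < e n" "v \<le> D" "b \<in> box n e n (D - v)" "a = single (Suc n) v + b"
      by (cases "v \<le> D") auto
    have "keys b \<subseteq> {1..Suc n}" "mdeg b = D - v" using v(3) by (auto simp: box_def mons_def)
    then have "a \<in> mons {1..Suc n} D" using v by (auto simp: mons_def keys_add_expo)
    moreover have "lookup a (Suc j) < e j" if "j < Suc n" for j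
      using v lookup_n[OF v(3)] that by (auto simp: box_def lookup_add lookup_single when_def less_Suc_eq)
    ultimately show "a \<in> box (Suc n) e (Suc n) D" by (simp add: box_def)
  qed
  moreover have "card (\<Union>v<e n. ?A v) = (\<Sum>v<e n. card (?A v))"
  proof (rule card_UN_disjoint)
    show "\<forall>v\<in>{..<e n}. \<forall>w\<in>{..<e n}. v \<noteq> w \<longrightarrow> ?A v \<inter> ?A w = {}"
    proof (intro ballI impI)
      fix v w :: nat assume vw: "v \<noteq> w"
      have lk: "lookup a (Suc n) = u" if a: "a \<in> ?A u" for a u
      proof -
        obtain b where b: "a = single (Suc n) u + b" "b \<in> (if u \<le> D then box n e n (D - u) else {})"
          using a by blast
        then have "b \<in> box n e n (D - u)" by (cases "u \<le> D") simp_all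
        then show ?thesis using lookup_n[of b] by (simp add: b(1) lookup_add)
      qed
      show "?A v \<inter> ?A w = {}"
      proof (rule ccontr)
        assume "?A v \<inter> ?A w \<noteq> {}"
        then obtain a where "a \<in> ?A v" "a \<in> ?A w" by (metis (no_types, lifting) Int_iff ex_in_conv)
        then show False using lk[of a v] lk[of a w] vw by simp
      qed
    qed
  qed auto
  moreover have "card (?A v) = (if v \<le> D then card (box n e n (D - v)) else 0)" for v
    by (simp add: card_image)
  ultimately show ?thesis by simp
qed

text \<open>The sums for \<open>D\<close> and \<open>D - 1\<close> run over windows of length
  \<open>e n\<close> shifted by one, so their difference is the difference of two boundary terms.
  Stated additively because the first difference may be negative.\<close>

lemma card_box_diff:
  assumes "1 \<le> D"
  shows "card (box n e n D) + card (box (Suc n) e (Suc n) (D - 1)) =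
    card (box (Suc n) e (Suc n) D) + (if e n \<le> D then card (box n e n (D - e n)) else 0)"
proof -
  let ?b = "\<lambda>D v. if v \<le> D then card (box n e n (D - v)) else 0"
  have "?b (D - 1) v = ?b D (Suc v)" for v using assms by auto
  then have "card (box n e n D) + card (box (Suc n) e (Suc n) (D - 1)) = ?b D 0 + (\<Sum>v<e n. ?b D (Suc v))"
    by (simp only: card_box_last) simp
  also have "\<dots> = (\<Sum>v<Suc (e n). ?b D v)" by (simp only: sum.lessThan_Suc_shift)
  also have "\<dots> = (\<Sum>v<e n. ?b D v) + ?b D (e n)" by (simp only: sum.lessThan_Suc)
  finally show ?thesis by (simp only: card_box_last)
qed

subsection \<open>Injectivity half of the strong Lefschetz property\<close>

text \<open>Degrees \<open>i\<close> and \<open>s - i\<close> of the quotient have the same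
  dimension, so a kernel element would leave too few vectors to span the target of the
  surjection.\<close>

lemma lefschetz_injective:
  fixes f :: "nat \<Rightarrow> (nat, 'k::field) mpoly"
  assumes F: "subfield F (ring_of_type_algebra :: 'k ring)"
    and gen: "generic_family F {1..m} e {..<m} f"
    and m: "1 \<le> m" and e: "\<And>j. j < m \<Longrightarrow> 0 < e j"
    and t: "t + 2 * i \<le> (\<Sum>j<m. e j - 1)"
    and q: "q \<in> hforms {1..m} i" "mono_poly (single m t) * q \<in> ideal_part {1..m} e {..<m} f (t + i)"
  shows "q \<in> ideal_part {1..m} e {..<m} f i"
proof (rule ccontr)
  assume nq: "q \<notin> ideal_part {1..m} e {..<m} f i"
  let ?W = "ideal_part {1..m} e {..<m} f"
  define s where "s = (\<Sum>j<m. e j - 1)"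
  \<comment> \<open>Enlarging \<open>t\<close> to the exponent that reaches the mirror degree keeps
    \<open>q\<close> in the kernel.\<close>
  define t' where "t' = s - 2 * i"
  let ?z = "mono_poly (single m t') :: (nat, 'k) mpoly"
  have t': "t \<le> t'" "t' + 2 * i = s" using t by (auto simp: t'_def s_def)
  have sub: "?W D \<subseteq> hforms {1..m} D" for D
    by (intro ideal_part_subset_hforms generic_family_hforms[OF gen])
  have L: "lefschetz m e f" by (rule lefschetz_generic[OF F gen m e])
  have zq: "?z * q \<in> ?W (t' + i)"
  proof -
    have "mono_poly (single m (t' - t)) * (mono_poly (single m t) * q) \<in> ?W ((t' - t) + (t + i))"
      by (rule ideal_part_mult[OF _ q(2)]) (use m in \<open>auto simp: mons_def\<close>)
    moreover have "mono_poly (single m (t' - t)) * (mono_poly (single m t) * q) = ?z * q"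
      using t'(1) by (simp flip: mult.assoc mono_poly_add single_add)
    ultimately show ?thesis using t'(1) by simp
  qed
  obtain T where T: "finite T" "{q} \<subseteq> T" "T \<subseteq> hforms {1..m} i" "hforms {1..m} i \<subseteq> pv.span (?W i \<union> T)"
    "card T + pv.dim (?W i) = card (mons {1..m} i)"
    by (rule complement_exists[OF _ subspace_ideal_part sub, where Q = "{q}" and q = q]) (use q(1) nq in auto)
  \<comment> \<open>The complement contains \<open>q\<close>, whose image already lies in the ideal;
    the images of the remaining vectors must therefore suffice.\<close>
  let ?T' = "(*) ?z ` (T - {q})"
  let ?G = "pv.span (?W (t' + i) \<union> ?T')"
  have mult: "?z * p \<in> ?G" if "p \<in> hforms {1..m} i" for p
  proof -
    have "?z * p \<in> ?W (t' + i)" if "p \<in> ?W i" for p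
      by (rule ideal_part_mult[OF _ that]) (use m in \<open>auto simp: mons_def\<close>)
    then have "?W i \<union> T \<subseteq> {p. ?z * p \<in> ?G}"
      using zq pv.span_superset[of "?W (t' + i) \<union> ?T'"] by auto
    then have "pv.span (?W i \<union> T) \<subseteq> {p. ?z * p \<in> ?G}"
      by (rule pv.span_minimal[OF _ subspace_mult_vimage[OF pv.subspace_span]])
    then show ?thesis using that T(4) by blast
  qed
  have "hforms {1..m} (t' + i) \<subseteq> ?G"
  proof
    fix w :: "(nat, 'k) mpoly" assume "w \<in> hforms {1..m} (t' + i)"
    moreover have "(\<Sum>j<m. e j - 1) + t' \<le> 2 * (t' + i)" using t'(2) by (simp add: s_def)
    ultimately obtain x v where xv: "w = x + ?z * v" "x \<in> ?W (t' + i)" "v \<in> hforms {1..m} (t' + i - t')"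
      using lefschetz_decompose[OF L] by metis
    have "?z * v \<in> ?G" using mult xv(3) by simp
    moreover have "x \<in> ?G" using xv(2) by (intro pv.span_base) simp
    ultimately show "w \<in> ?G" unfolding xv(1) by (intro pv.span_add)
  qed
  from card_mons_le_dim[OF _ subspace_ideal_part sub _ this]
  have "card (mons {1..m} (t' + i)) \<le> pv.dim (?W (t' + i)) + card ?T'" using T(1) by simp
  also have "card ?T' \<le> card (T - {q})" using T(1) by (intro card_image_le) simp
  also have "card (T - {q}) < card T" using T(1,2) by (intro card_Diff1_less) auto
  finally have "card (box m e m (t' + i)) < card T"
    using dim_ideal_part_plus_box[OF F gen order_refl, of "t' + i"] by simp
  moreover have "card T = card (box m e m i)"
    using T(5) dim_ideal_part_plus_box[OF F gen order_refl, of i] by simp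
  moreover have "card (box m e m (t' + i)) = card (box m e m i)"
  proof -
    have "t' + i = s - i" "i \<le> s" using t'(2) by auto
    then show ?thesis using card_box_symmetric[of m e i] e by (simp add: s_def)
  qed
  ultimately show False by simp
qed

subsection \<open>Leading monomials and the last variable\<close>

lemma lead_monosI: "p \<in> W \<Longrightarrow> p \<noteq> 0 \<Longrightarrow> lead_mono p = b \<Longrightarrow> b \<in> lead_monos W"
  by (auto simp: lead_monos_def)

lemma lead_monosE:
  assumes "b \<in> lead_monos W"
  obtains p where "p \<in> W" "p \<noteq> 0" "lead_mono p = b"
  using assms by (auto simp: lead_monos_def)

lemma lookup_last_zero:
  assumes "keys (b :: nat expo) \<subseteq> {1..n}"
  shows "lookup b (Suc n) = 0"
proof -
  have "Suc n \<notin> keys b" using assms by auto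
  then show ?thesis by (simp add: in_keys_iff)
qed

lemma keys_le_last:
  assumes "a \<in> mons {1..Suc n} D" "lookup a (Suc n) = 0"
  shows "keys a \<subseteq> {1..n}"
proof -
  have "Suc n \<notin> keys a" using assms(2) by (simp add: in_keys_iff)
  moreover have "keys a \<subseteq> {1..Suc n}" using assms(1) by (simp add: mons_def)
  moreover have "{1..Suc n} - {Suc n} = {1..n}" by auto
  ultimately show ?thesis by blast
qed

lemma drl_less_last:
  assumes "a \<in> mons {1..Suc n} D" "b \<in> mons {1..Suc n} D" "lookup b (Suc n) < lookup a (Suc n)"
  shows "drl_less a b"
  by (rule drl_less_revlex[OF _ assms(3)]) (use assms in \<open>auto simp: mons_def\<close>)

text \<open>Among monomials of one degree those free of the last variable are larger than all
  others, so they contain the leading one as soon as any of them occurs.\<close>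

lemma lead_mono_restrict_vars:
  assumes p: "p \<in> hforms {1..Suc n} D" and nz: "restrict_vars {1..n} p \<noteq> 0"
  shows "lead_mono p = lead_mono (restrict_vars {1..n} p)"
proof (rule lead_mono_eqI)
  let ?r = "restrict_vars {1..n} p"
  have b: "lead_mono ?r \<in> keys ?r" by (rule lead_mono(1)[OF nz])
  then show bp: "lead_mono ?r \<in> keys p" by (simp add: keys_restrict_vars)
  fix c assume c: "c \<in> keys p" "c \<noteq> lead_mono ?r"
  show "drl_less c (lead_mono ?r)"
  proof (cases "keys c \<subseteq> {1..n}")
    case True
    then have "c \<in> keys ?r" using c by (simp add: keys_restrict_vars)
    then show ?thesis using lead_mono(2)[OF nz] c(2) by blast
  next
    case False
    have mons: "c \<in> mons {1..Suc n} D" "lead_mono ?r \<in> mons {1..Suc n} D"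
      using p c(1) bp by (auto simp: hforms_def)
    have "lookup c (Suc n) \<noteq> 0" using keys_le_last[OF mons(1)] False by blast
    moreover have "lookup (lead_mono ?r) (Suc n) = 0"
      using b by (intro lookup_last_zero) (simp add: keys_restrict_vars)
    ultimately show ?thesis by (intro drl_less_last[OF mons]) simp
  qed
qed

lemma restrict_vars_add: "restrict_vars V (p + q) = restrict_vars V p + restrict_vars V q"
  by (rule poly_mapping_eqI) (simp add: lookup_restrict_vars lookup_add when_def)

lemma restrict_vars_scl: "restrict_vars V (scl c p) = scl c (restrict_vars V p)"
  by (rule poly_mapping_eqI) (simp add: lookup_restrict_vars when_def)

lemma restrict_vars_0 [simp]: "restrict_vars V 0 = 0"
  by (rule poly_mapping_eqI) (simp add: lookup_restrict_vars)

lemma restrict_vars_mono_mult: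
  "restrict_vars V (mono_poly a * p) = (if keys a \<subseteq> V then mono_poly a * restrict_vars V p else 0)"
proof (rule poly_mapping_eqI)
  fix b
  show "lookup (restrict_vars V (mono_poly a * p)) b =
    lookup (if keys a \<subseteq> V then mono_poly a * restrict_vars V p else 0) b"
  proof (cases "\<exists>c. b = a + c")
    case True
    then obtain c where "b = a + c" by blast
    then show ?thesis by (simp add: lookup_restrict_vars keys_add_expo when_def)
  next
    case False
    then have "b \<notin> keys (mono_poly a * p)" "b \<notin> keys (mono_poly a * restrict_vars V p)"
      by (auto simp: keys_mono_mult)
    then have "lookup (mono_poly a * p) b = 0" "lookup (mono_poly a * restrict_vars V p) b = 0"
      by (simp_all only: not_in_keys_iff_lookup_eq_zero)
    then show ?thesis by (simp add: lookup_restrict_vars)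
  qed
qed

lemma subspace_restrict_vars_vimage:
  fixes W :: "('i, 'k::field) mpoly set"
  assumes "pv.subspace W" shows "pv.subspace {p. restrict_vars V p \<in> W}"
  by (rule pv.subspaceI)
     (auto simp: restrict_vars_add restrict_vars_scl pv.subspace_0 pv.subspace_add pv.subspace_scale assms)

lemma subspace_restrict_vars_image:
  fixes W :: "('i, 'k::field) mpoly set"
  assumes W: "pv.subspace W" shows "pv.subspace (restrict_vars V ` W)"
proof (rule pv.subspaceI)
  show "0 \<in> restrict_vars V ` W"
    using pv.subspace_0[OF W] by (intro image_eqI[of _ _ 0]) simp_all
  fix x y c
  assume "x \<in> restrict_vars V ` W"
  then obtain p where p: "p \<in> W" "x = restrict_vars V p" by blast
  show "scl c x \<in> restrict_vars V ` W"
    using pv.subspace_scale[OF W p(1)] by (intro image_eqI[of _ _ "scl c p"]) (simp_all add: p(2) restrict_vars_scl)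
  assume "y \<in> restrict_vars V ` W"
  then obtain q where q: "q \<in> W" "y = restrict_vars V q" by blast
  show "x + y \<in> restrict_vars V ` W"
    using pv.subspace_add[OF W p(1) q(1)] by (intro image_eqI[of _ _ "p + q"]) (simp_all add: p(2) q(2) restrict_vars_add)
qed

lemma restrict_ideal_part:
  fixes f :: "'j \<Rightarrow> ('i, 'k::field) mpoly"
  assumes "V' \<subseteq> V"
  shows "restrict_vars V' ` ideal_part V e J f D = ideal_part V' e J (\<lambda>j. restrict_vars V' (f j)) D"
    (is "_ = ?R")
proof
  have "ideal_part V e J f D \<subseteq> {p. restrict_vars V' p \<in> ?R}"
    unfolding ideal_part_def[of V]
  proof (rule pv.span_minimal[OF _ subspace_restrict_vars_vimage[OF subspace_ideal_part]], rule subsetI, rule CollectI)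
    fix x assume "x \<in> {mono_poly a * f j | j a. j \<in> J \<and> keys a \<subseteq> V \<and> mdeg a + e j = D}"
    then obtain j a where "x = mono_poly a * f j" "j \<in> J" "mdeg a + e j = D" by blast
    then show "restrict_vars V' x \<in> ?R"
      by (auto simp: restrict_vars_mono_mult pv.subspace_0 intro: ideal_part_base)
  qed
  then show "restrict_vars V' ` ideal_part V e J f D \<subseteq> ?R" by blast
  show "?R \<subseteq> restrict_vars V' ` ideal_part V e J f D"
    unfolding ideal_part_def[of V']
  proof (rule pv.span_minimal[OF _ subspace_restrict_vars_image[OF subspace_ideal_part]], rule subsetI)
    fix x assume "x \<in> {mono_poly a * restrict_vars V' (f j) | j a. j \<in> J \<and> keys a \<subseteq> V' \<and> mdeg a + e j = D}"
    then obtain j a where ja: "x = mono_poly a * restrict_vars V' (f j)" "j \<in> J" "keys a \<subseteq> V'" "mdeg a + e j = D"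
      by blast
    have "mono_poly a * f j \<in> ideal_part V e J f D"
      using ja assms by (intro ideal_part_base) auto
    moreover have "x = restrict_vars V' (mono_poly a * f j)" using ja by (simp add: restrict_vars_mono_mult)
    ultimately show "x \<in> restrict_vars V' ` ideal_part V e J f D" by blast
  qed
qed

text \<open>The initial ideal of the image under \<pi> is the part of the initial ideal free of the
  last variable, one degree at a time.\<close>

lemma lead_monos_restrict_vars:
  fixes W :: "(nat, 'k::field) mpoly set"
  assumes W: "W \<subseteq> hforms {1..Suc n} D"
  shows "lead_monos (restrict_vars {1..n} ` W) = {b \<in> lead_monos W. keys b \<subseteq> {1..n}}"
proof (intro antisym subsetI)
  fix b assume "b \<in> lead_monos (restrict_vars {1..n} ` W)"
  then obtain p where p: "p \<in> W" "restrict_vars {1..n} p \<noteq> 0" "b = lead_mono (restrict_vars {1..n} p)"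
    by (auto simp: lead_monos_def)
  have "lead_mono p = b" using lead_mono_restrict_vars[OF _ p(2)] p W by blast
  moreover have "p \<noteq> 0" using p(2) by auto
  moreover have "keys b \<subseteq> {1..n}" using lead_mono(1)[OF p(2)] p(3) by (simp add: keys_restrict_vars)
  ultimately show "b \<in> {b \<in> lead_monos W. keys b \<subseteq> {1..n}}" using p(1) by (auto simp: lead_monos_def)
next
  fix b assume "b \<in> {b \<in> lead_monos W. keys b \<subseteq> {1..n}}"
  then obtain p where p: "p \<in> W" "p \<noteq> 0" "b = lead_mono p" "keys b \<subseteq> {1..n}"
    by (auto simp: lead_monos_def)
  have "b \<in> keys (restrict_vars {1..n} p)" using lead_mono(1)[OF p(2)] p by (simp add: keys_restrict_vars)
  then have nz: "restrict_vars {1..n} p \<noteq> 0" by auto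
  have "b = lead_mono (restrict_vars {1..n} p)" using lead_mono_restrict_vars[OF _ nz] p W by blast
  then show "b \<in> lead_monos (restrict_vars {1..n} ` W)" using p(1) nz by (auto simp: lead_monos_def)
qed

text \<open>Surjectivity of multiplication by the power \<open>t + 1\<close> gives an element
  \<open>z^t b - z^(t+1) v\<close> of the ideal, and all terms of the second summand are smaller
  because they contain more of the last variable.\<close>

lemma lefschetz_lead_mono:
  fixes f :: "nat \<Rightarrow> (nat, 'k::field) mpoly"
  assumes L: "lefschetz (Suc n) e f" and f: "\<And>j. j < Suc n \<Longrightarrow> f j \<in> hforms {1..Suc n} (e j)"
    and b: "b \<in> mons {1..n} i" and t: "(\<Sum>j<Suc n. e j - 1) + 1 \<le> t + 2 * i"
  shows "single (Suc n) t + b \<in> lead_monos (ideal_part {1..Suc n} e {..<Suc n} f (t + i))"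
proof -
  let ?c = "single (Suc n) t + b"
  have kb: "keys b \<subseteq> {1..n}" "mdeg b = i" using b by (auto simp: mons_def)
  have lc: "lookup ?c (Suc n) = t" using lookup_last_zero[OF kb(1)] by (simp add: lookup_add)
  have c: "?c \<in> mons {1..Suc n} (t + i)"
  proof -
    have "keys b \<subseteq> {1..Suc n}" using kb(1) by fastforce
    then show ?thesis using kb(2) by (auto simp: mons_def keys_add_expo)
  qed
  have sub: "ideal_part {1..Suc n} e {..<Suc n} f (t + i) \<subseteq> hforms {1..Suc n} (t + i)"
    using f by (intro ideal_part_subset_hforms) simp
  \<comment> \<open>The extra power in \<open>t + 1\<close> is what makes \<open>z^t b\<close>
    strictly the largest term.\<close>
  have "(\<Sum>j<Suc n. e j - 1) + (t + 1) \<le> 2 * (t + i)" using t by simp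
  then obtain x v where xv: "mono_poly ?c = x + mono_poly (single (Suc n) (t + 1)) * v"
    "x \<in> ideal_part {1..Suc n} e {..<Suc n} f (t + i)"
    using lefschetz_decompose[OF L] mono_poly_in_hforms[THEN iffD2, OF c] by metis
  have x: "x = mono_poly ?c - mono_poly (single (Suc n) (t + 1)) * v" using xv(1) by simp
  have big: "t < lookup a (Suc n)" if "a \<in> keys (mono_poly (single (Suc n) (t + 1)) * v)" for a
    using that by (auto simp: keys_mono_mult lookup_add)
  have "?c \<notin> keys (mono_poly (single (Suc n) (t + 1)) * v)" using big[of ?c] lc by auto
  then have cx: "?c \<in> keys x" by (simp add: x in_keys_iff lookup_minus lookup_mono_poly)
  have "lead_mono x = ?c"
  proof (rule lead_mono_eqI[OF cx])
    fix a assume a: "a \<in> keys x" "a \<noteq> ?c"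
    then have "a \<in> keys (mono_poly (single (Suc n) (t + 1)) * v)"
      by (auto simp: x in_keys_iff lookup_minus lookup_mono_poly)
    moreover have "a \<in> mons {1..Suc n} (t + i)" using a(1) xv(2) sub by (auto simp: hforms_def)
    ultimately show "drl_less a ?c" using lc big by (intro drl_less_last[OF _ c]) auto
  qed
  moreover have "x \<noteq> 0" using cx by auto
  ultimately show ?thesis using xv(2) by (intro lead_monosI)
qed

text \<open>If the leading monomial is divisible by \<open>z^t\<close> then so is the whole form,
  since a term with less \<open>z\<close> would be larger. Injectivity then puts the quotient into
  the ideal.\<close>

lemma lead_mono_cancel_last:
  fixes f :: "nat \<Rightarrow> (nat, 'k::field) mpoly"
  assumes F: "subfield F (ring_of_type_algebra :: 'k ring)"
    and gen: "generic_family F {1..Suc n} e {..<Suc n} f" and e: "\<And>j. j < Suc n \<Longrightarrow> 0 < e j"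
    and t: "t + 2 * i \<le> (\<Sum>j<Suc n. e j - 1)"
    and b: "single (Suc n) t + b \<in> lead_monos (ideal_part {1..Suc n} e {..<Suc n} f (t + i))"
  shows "b \<in> lead_monos (ideal_part {1..Suc n} e {..<Suc n} f i)"
proof -
  let ?W = "ideal_part {1..Suc n} e {..<Suc n} f" and ?c = "single (Suc n) t + b"
  obtain p where p: "p \<in> ?W (t + i)" "p \<noteq> 0" "lead_mono p = ?c" using b by (rule lead_monosE)
  have "?W (t + i) \<subseteq> hforms {1..Suc n} (t + i)"
    by (intro ideal_part_subset_hforms generic_family_hforms[OF gen])
  then have ph: "p \<in> hforms {1..Suc n} (t + i)" using p(1) by blast
  have "t \<le> lookup a (Suc n)" if a: "a \<in> keys p" for a
  proof (rule ccontr)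
    assume "\<not> t \<le> lookup a (Suc n)"
    then have lt: "lookup a (Suc n) < lookup ?c (Suc n)" by (simp add: lookup_add)
    have "a \<in> mons {1..Suc n} (t + i)" "?c \<in> mons {1..Suc n} (t + i)"
      using ph a lead_mono(1)[OF p(2)] p(3) by (auto simp: hforms_def)
    then have "drl_less ?c a" using lt by (intro drl_less_last)
    moreover have "drl_less a ?c" using lead_mono(2)[OF p(2) a] p(3) lt by auto
    ultimately show False using drl_less_trans drl_less_irrefl by blast
  qed
  then obtain q where q: "p = mono_poly (single (Suc n) t) * q" "q \<in> hforms {1..Suc n} (t + i - t)"
    using divide_out_var[OF ph, of t "Suc n"] by metis
  have "q \<in> ?W i"
    by (rule lefschetz_injective[OF F gen _ _ t]) (use q p(1) e in auto)
  moreover have "q \<noteq> 0" using p(2) q(1) by auto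
  moreover from this have "lead_mono q = b"
    using p(3) unfolding q(1) by (simp add: lead_mono_mono_mult)
  ultimately show ?thesis using \<open>q \<in> ?W i\<close> by (intro lead_monosI)
qed

subsection \<open>Counting the leading monomials\<close>

text \<open>The last form \<open>f n\<close> is \<open>g\<close>, with \<open>e n\<close> its degree
  \<open>d\<close>, and the last variable \<open>Suc n\<close> is \<open>z\<close>.\<close>

locale generic_ideal =
  fixes F :: "'k::field set" and n :: nat and e :: "nat \<Rightarrow> nat" and f :: "nat \<Rightarrow> (nat, 'k) mpoly"
  assumes F: "subfield F (ring_of_type_algebra :: 'k ring)"
    and gen: "generic_family F {1..Suc n} e {..<Suc n} f"
    and e_pos: "\<And>j. j < Suc n \<Longrightarrow> 0 < e j" and n_pos: "1 \<le> n"
begin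

text \<open>\<open>W\<close> and \<open>U\<close> are the graded pieces of \<open>(I,g)\<close> and
  of \<open>I\<close>; \<open>Wz\<close> and \<open>Uz\<close> are their images under
  \<open>z = 0\<close>. Thus \<open>Uz\<close> belongs to \<open>J\<close>, and \<open>std i\<close>
  will turn out to be \<open>B_i\<close>.\<close>

definition "socle_deg = (\<Sum>j<Suc n. e j - 1)"
definition "fz = (\<lambda>j. restrict_vars {1..n} (f j))"
definition "W = ideal_part {1..Suc n} e {..<Suc n} f"
definition "U = ideal_part {1..Suc n} e {..<n} f"
definition "Wz = ideal_part {1..n} e {..<Suc n} fz"
definition "Uz = ideal_part {1..n} e {..<n} fz"
definition "std i = mons {1..n} i - lead_monos (Uz i)"

lemma sub: "W i \<subseteq> hforms {1..Suc n} i" "U i \<subseteq> hforms {1..Suc n} i"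
  unfolding W_def U_def
  by (rule ideal_part_subset_hforms, rule generic_family_hforms[OF gen], simp)+

lemma genz: "generic_family F {1..n} e {..<Suc n} fz"
  unfolding fz_def by (rule generic_family_restrict[OF gen]) auto

lemma genzn: "generic_family F {1..n} e {..<n} fz"
  by (rule generic_family_subset[OF genz]) auto

lemma subz: "Wz i \<subseteq> hforms {1..n} i" "Uz i \<subseteq> hforms {1..n} i"
  unfolding Wz_def Uz_def
  by (rule ideal_part_subset_hforms, rule generic_family_hforms[OF genz], simp)+

lemma lead_monos_Wz: "lead_monos (Wz i) = {b \<in> lead_monos (W i). keys b \<subseteq> {1..n}}"
proof -
  have "Wz i = restrict_vars {1..n} ` W i"
    unfolding Wz_def W_def fz_def by (rule restrict_ideal_part[symmetric]) auto
  then show ?thesis using lead_monos_restrict_vars[OF sub(1)] by simp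
qed

lemma lead_monos_Uz: "lead_monos (Uz i) = {b \<in> lead_monos (U i). keys b \<subseteq> {1..n}}"
proof -
  have "Uz i = restrict_vars {1..n} ` U i"
    unfolding Uz_def U_def fz_def by (rule restrict_ideal_part[symmetric]) auto
  then show ?thesis using lead_monos_restrict_vars[OF sub(2)] by simp
qed

lemma lead_monos_Uz_subset: "lead_monos (Uz i) \<subseteq> lead_monos (Wz i)"
  unfolding Uz_def Wz_def by (intro lead_monos_mono ideal_part_mono) auto

lemma finite_lead_monos: "finite (lead_monos (W i))" "finite (lead_monos (Wz i))" "finite (lead_monos (Uz i))"
  by (rule finite_subset[OF lead_monos_subset[OF sub(1)]], simp)
     (rule finite_subset[OF lead_monos_subset[OF subz(1)]], simp,
      rule finite_subset[OF lead_monos_subset[OF subz(2)]], simp)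

lemma card_lead_monos_W: "card (lead_monos (W i)) + card (box (Suc n) e (Suc n) i) = card (mons {1..Suc n} i)"
  using dim_ideal_part_plus_box[OF F gen order_refl, of i]
    dim_eq_card_lead_monos[OF _ _ sub(1)[of i]] by (simp add: W_def)

lemma card_lead_monos_Uz: "card (lead_monos (Uz i)) + card (box n e n i) = card (mons {1..n} i)"
  using dim_ideal_part_plus_box[OF F genzn order_refl, of i]
    dim_eq_card_lead_monos[OF _ _ subz(2)[of i]] by (simp add: Uz_def)

lemma finite_std [simp]: "finite (std i)"
  by (simp add: std_def)

lemma card_std: "card (std i) = card (box n e n i)"
proof -
  have "card (std i) = card (mons {1..n} i) - card (lead_monos (Uz i))"
    unfolding std_def by (rule card_Diff_subset[OF finite_lead_monos(3) lead_monos_subset[OF subz(2)]])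
  then show ?thesis using card_lead_monos_Uz[of i] by simp
qed

lemma split_by_last_var:
  assumes A: "A \<subseteq> mons {1..Suc n} i" and B: "\<And>b. single (Suc n) 1 + b \<in> A \<longleftrightarrow> b \<in> B" and fin: "finite B"
  shows "card A = card {a \<in> A. keys a \<subseteq> {1..n}} + card B"
proof -
  let ?B = "(+) (single (Suc n) 1) ` B"
  have "A = {a \<in> A. keys a \<subseteq> {1..n}} \<union> ?B"
  proof (intro antisym subsetI)
    fix a assume a: "a \<in> A"
    show "a \<in> {a \<in> A. keys a \<subseteq> {1..n}} \<union> ?B"
    proof (cases "lookup a (Suc n) = 0")
      case True
      then show ?thesis using keys_le_last a A by blast
    next
      case False
      then have "lookup (single (Suc n) 1) i \<le> lookup a i" for i
        by (cases "i = Suc n") (auto simp: lookup_single when_def)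
      then obtain c where "a = single (Suc n) 1 + c" by (rule expo_diff)
      then show ?thesis using a B by blast
    qed
  qed (use B in auto)
  moreover have "{a \<in> A. keys a \<subseteq> {1..n}} \<inter> ?B = {}"
    by (auto simp: keys_add_expo)
  moreover have "finite {a \<in> A. keys a \<subseteq> {1..n}}"
    by (rule finite_subset[OF _ finite_mons[of "{1..Suc n}" i]]) (use A in auto)
  ultimately have "card A = card {a \<in> A. keys a \<subseteq> {1..n}} + card ?B"
    using card_Un_disjoint[of "{a \<in> A. keys a \<subseteq> {1..n}}" ?B] fin by simp
  also have "card ?B = card B" by (rule card_image) simp
  finally show ?thesis .
qed

text \<open>Up to the middle degree multiplication by \<open>z\<close> is injective on the quotient
  by \<open>(I,g)\<close>, so setting \<open>z = 0\<close> replaces its Hilbert function by the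
  first difference. By \<open>card_box_diff\<close> this differs from the Hilbert function of
  \<open>R/J\<close> by the dimension of the latter in degree \<open>i - e n\<close>.\<close>

lemma card_std_lead:
  assumes i: "2 * i \<le> socle_deg + 1"
  shows "card (std i \<inter> lead_monos (W i)) = (if e n \<le> i then card (std (i - e n)) else 0)"
proof (cases "i = 0")
  \<comment> \<open>Degree 0 has no predecessor for the difference and is settled directly: all
    generators have positive degree.\<close>
  case True
  have "W 0 = {0}"
  proof -
    have "{mono_poly a * f j | j a. j \<in> {..<Suc n} \<and> keys a \<subseteq> {1..Suc n} \<and> mdeg a + e j = 0} = {}"
      using e_pos by fastforce
    then show ?thesis unfolding W_def ideal_part_def by (simp only: pv.span_empty)
  qed
  moreover have "\<not> e n \<le> 0" using e_pos[of n] by simp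
  ultimately show ?thesis using True by (simp add: lead_monos_def)
next
  case False
  then have i1: "1 \<le> i" by simp
  \<comment> \<open>Leading monomials divisible by \<open>z\<close> correspond to those of degree
    \<open>i - 1\<close>. Cancelling one \<open>z\<close> there requires
    \<open>1 + 2 (i - 1) \<le> s\<close>, which is the hypothesis on \<open>i\<close>.\<close>
  have "card (lead_monos (W i)) = card {a \<in> lead_monos (W i). keys a \<subseteq> {1..n}} + card (lead_monos (W (i - 1)))"
  proof (rule split_by_last_var[OF lead_monos_subset[OF sub(1)] _ finite_lead_monos(1)])
    fix b
    show "single (Suc n) 1 + b \<in> lead_monos (W i) \<longleftrightarrow> b \<in> lead_monos (W (i - 1))"
    proof
      assume "single (Suc n) 1 + b \<in> lead_monos (W i)"
      then show "b \<in> lead_monos (W (i - 1))"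
        using lead_mono_cancel_last[OF F gen e_pos, of 1 "i - 1" b] i i1
        by (simp add: W_def socle_deg_def)
    next
      assume "b \<in> lead_monos (W (i - 1))"
      then obtain p where p: "p \<in> W (i - 1)" "p \<noteq> 0" "lead_mono p = b" by (rule lead_monosE)
      have "mono_poly (single (Suc n) 1) * p \<in> W (1 + (i - 1))"
        unfolding W_def by (rule ideal_part_mult) (use p(1) in \<open>auto simp: mons_def W_def\<close>)
      moreover have "1 + (i - 1) = i" using i1 by simp
      moreover have "lead_mono (mono_poly (single (Suc n) 1) * p) = single (Suc n) 1 + b"
        using lead_mono_mono_mult[OF p(2)] p(3) by (simp only:)
      moreover have "mono_poly (single (Suc n) 1) * p \<noteq> 0" using p(2) by (simp only: mono_mult_eq_0_iff not_False_eq_True)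
      ultimately show "single (Suc n) 1 + b \<in> lead_monos (W i)"
        by (metis lead_monosI)
    qed
  qed
  then have 1: "card (lead_monos (W i)) = card (lead_monos (Wz i)) + card (lead_monos (W (i - 1)))"
    by (simp only: lead_monos_Wz)
  have "card (mons {1..Suc n} i) = card {a \<in> mons {1..Suc n} i. keys a \<subseteq> {1..n}} + card (mons {1..Suc n} (i - 1))"
  proof (rule split_by_last_var[where i = i])
    show "single (Suc n) 1 + b \<in> mons {1..Suc n} i \<longleftrightarrow> b \<in> mons {1..Suc n} (i - 1)" for b
      using i1 by (auto simp: mons_def keys_add_expo)
  qed simp_all
  moreover have "{a \<in> mons {1..Suc n} i. keys a \<subseteq> {1..n}} = mons {1..n} i"
    by (auto simp: mons_def)
  ultimately have 2: "card (mons {1..Suc n} i) = card (mons {1..n} i) + card (mons {1..Suc n} (i - 1))"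
    by (simp only:)
  have "std i \<inter> lead_monos (W i) = lead_monos (Wz i) - lead_monos (Uz i)"
    using lead_monos_subset[OF subz(1), of i] by (auto simp: std_def lead_monos_Wz mons_def)
  then have "card (std i \<inter> lead_monos (W i)) = card (lead_monos (Wz i)) - card (lead_monos (Uz i))"
    using card_Diff_subset[OF finite_lead_monos(3) lead_monos_Uz_subset] by simp
  moreover have "card (lead_monos (Uz i)) \<le> card (lead_monos (Wz i))"
    by (rule card_mono[OF finite_lead_monos(2) lead_monos_Uz_subset])
  moreover have "card (lead_monos (Wz i)) =
      card (lead_monos (Uz i)) + (if e n \<le> i then card (box n e n (i - e n)) else 0)"
    using 1 2 card_lead_monos_W[of i] card_lead_monos_W[of "i - 1"] card_lead_monos_Uz[of i]
      card_box_diff[OF i1, of n e] by linarith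
  ultimately show ?thesis by (simp add: card_std)
qed

text \<open>Specialising the image of \<open>g\<close> to the monomial \<open>b\<close> shows that
  modulo generic forms \<open>b\<close> is a combination of the other standard monomials; these are
  smaller, so \<open>b\<close> is a leading monomial.\<close>

lemma largest_std_lead:
  assumes b: "b \<in> std (e n)" "\<And>c. c \<in> std (e n) \<Longrightarrow> c \<noteq> b \<Longrightarrow> drl_less c b"
  shows "b \<in> lead_monos (W (e n))"
proof -
  define T where "T = std (e n) - {b}"
  \<comment> \<open>Only the last form is specialised. The others keep their generic values, so that
    the standard monomials remain those of \<open>J\<close>.\<close>
  define g where "g = fz(n := mono_poly b)"
  have bm: "b \<in> mons {1..n} (e n)" using b(1) by (simp add: std_def)
  have "mono_poly ` mons {1..n} (e n) \<subseteq> pv.span (ideal_part {1..n} e {..<Suc n} fz (e n) \<union> mono_poly ` T)"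
  proof (rule generic_forms_span[OF F genz])
    show "g j \<in> hforms {1..n} (e j)" if "j \<in> {..<Suc n}" for j
      using that generic_family_hforms[OF genz, of j] bm by (auto simp: g_def)
    show "T \<subseteq> mons {1..n} (e n)" by (auto simp: T_def std_def)
    show "mono_poly ` mons {1..n} (e n) \<subseteq> pv.span (ideal_part {1..n} e {..<Suc n} g (e n) \<union> mono_poly ` T)"
      (is "_ \<subseteq> ?G")
    proof (rule image_subsetI)
      fix c assume c: "c \<in> mons {1..n} (e n)"
      have "mono_poly c \<in> pv.span (Uz (e n) \<union> mono_poly ` {a \<in> mons {1..n} (e n) - lead_monos (Uz (e n)). a = c \<or> drl_less a c})"
        by (rule standard_monos_span[OF _ _ subz(2) c]) (simp_all add: Uz_def)
      moreover have "Uz (e n) \<union> mono_poly ` {a \<in> mons {1..n} (e n) - lead_monos (Uz (e n)). a = c \<or> drl_less a c} \<subseteq> ?G"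
      proof (rule Un_least)
        have "Uz (e n) = ideal_part {1..n} e {..<n} g (e n)"
          unfolding Uz_def by (rule ideal_part_cong) (simp add: g_def)
        also have "\<dots> \<subseteq> ideal_part {1..n} e {..<Suc n} g (e n)" by (rule ideal_part_mono) auto
        finally show "Uz (e n) \<subseteq> ?G" using pv.span_superset[of "ideal_part {1..n} e {..<Suc n} g (e n) \<union> mono_poly ` T"] by blast
        have "mono_poly a \<in> ?G" if "a \<in> std (e n)" for a
        proof (cases "a = b")
          case True
          have "mono_poly 0 * g n \<in> ideal_part {1..n} e {..<Suc n} g (e n)"
            by (rule ideal_part_base) auto
          then show ?thesis using True by (intro pv.span_base) (simp add: g_def)
        next
          case False
          then show ?thesis using that by (intro pv.span_base) (simp add: T_def)
        qed
        then show "mono_poly ` {a \<in> mons {1..n} (e n) - lead_monos (Uz (e n)). a = c \<or> drl_less a c} \<subseteq> ?G"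
          by (auto simp: std_def)
      qed
      ultimately show "mono_poly c \<in> ?G"
        using pv.span_minimal[OF _ pv.subspace_span] by blast
    qed
  qed
  then have "mono_poly b \<in> pv.span (Wz (e n) \<union> mono_poly ` T)" using bm by (auto simp: Wz_def)
  then obtain x y where xy: "mono_poly b = x + y" "x \<in> pv.span (Wz (e n))" "y \<in> pv.span (mono_poly ` T)"
    unfolding pv.span_Un by auto
  have x: "x \<in> Wz (e n)" using xy(2) pv.span_eq_iff[THEN iffD2, OF subspace_ideal_part] unfolding Wz_def by blast
  have y: "keys y \<subseteq> T" using xy(3) by (simp add: span_monos)
  have xe: "x = mono_poly b - y" using xy(1) by simp
  have "b \<notin> keys y" using y by (auto simp: T_def)
  then have bx: "b \<in> keys x" by (simp add: xe in_keys_iff lookup_minus lookup_mono_poly)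
  have "lead_mono x = b"
  proof (rule lead_mono_eqI[OF bx])
    fix c assume "c \<in> keys x" "c \<noteq> b"
    then have "c \<in> keys y" by (auto simp: xe in_keys_iff lookup_minus lookup_mono_poly)
    then show "drl_less c b" using y b(2) by (auto simp: T_def)
  qed
  moreover have "x \<noteq> 0" using bx by auto
  ultimately have "b \<in> lead_monos (Wz (e n))" using x by (intro lead_monosI)
  then show ?thesis by (simp add: lead_monos_Wz)
qed

lemma lead_mono_high:
  assumes "b \<in> mons {1..n} i" "socle_deg + 1 \<le> t + 2 * i"
  shows "single (Suc n) t + b \<in> lead_monos (W (t + i))"
  unfolding W_def
  by (rule lefschetz_lead_mono[OF lefschetz_generic[OF F gen _ e_pos] generic_family_hforms[OF gen] assms(1)])
     (use assms(2) in \<open>auto simp: socle_deg_def\<close>)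

lemma lead_mono_low:
  assumes "t + 2 * i \<le> socle_deg" "single (Suc n) t + b \<in> lead_monos (W (t + i))"
  shows "b \<in> lead_monos (W i)"
  using lead_mono_cancel_last[OF F gen e_pos, of t i b] assms by (simp add: W_def socle_deg_def)

end

subsection \<open>Ideals of the polynomial ring and their initial ideals\<close>

text \<open>The ideal as a vector space, with the same kind of spanning vectors as
  \<open>ideal_part\<close> but without a degree, so that the two can be compared directly.\<close>

definition poly_ideal :: "nat \<Rightarrow> (nat, 'k::field) mpoly set \<Rightarrow> (nat, 'k) mpoly set" where
  "poly_ideal m S = pv.span {mono_poly a * p | a p. a \<in> monomials m \<and> p \<in> S}"

lemma subspace_poly_ideal [simp]: "pv.subspace (poly_ideal m S)"
  by (simp add: poly_ideal_def)

lemma poly_ideal_base: "a \<in> monomials m \<Longrightarrow> p \<in> S \<Longrightarrow> mono_poly a * p \<in> poly_ideal m S"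
  unfolding poly_ideal_def by (rule pv.span_base) auto

lemma poly_ideal_mult:
  assumes x: "keys x \<subseteq> monomials m" and p: "p \<in> poly_ideal m S"
  shows "x * p \<in> poly_ideal m S"
proof -
  have "poly_ideal m S \<subseteq> {p. x * p \<in> poly_ideal m S}"
    unfolding poly_ideal_def[of m S]
  proof (rule pv.span_minimal[OF _ subspace_mult_vimage[OF pv.subspace_span]], rule subsetI, rule CollectI, fold poly_ideal_def)
    fix q assume "q \<in> {mono_poly a * p | a p. a \<in> monomials m \<and> p \<in> S}"
    then obtain a s where q: "q = mono_poly a * s" "a \<in> monomials m" "s \<in> S" by blast
    have "mono_poly ` monomials m \<subseteq> {x. q * x \<in> poly_ideal m S}"
    proof (rule image_subsetI, rule CollectI)
      fix b assume "b \<in> monomials m"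
      then have "mono_poly (b + a) * s \<in> poly_ideal m S"
        using q by (intro poly_ideal_base monomials_add)
      then show "q * mono_poly b \<in> poly_ideal m S" by (simp add: q(1) mono_poly_add mult_ac)
    qed
    then have "pv.span (mono_poly ` monomials m) \<subseteq> {x. q * x \<in> poly_ideal m S}"
      by (rule pv.span_minimal[OF _ subspace_mult_vimage[OF subspace_poly_ideal]])
    then show "x * q \<in> poly_ideal m S" using x by (auto simp: span_monos mult.commute)
  qed
  then show ?thesis using p by blast
qed

lemma poly_ideal_carrier:
  assumes "\<And>p. p \<in> S \<Longrightarrow> keys p \<subseteq> monomials m"
  shows "poly_ideal m S \<subseteq> {p. keys p \<subseteq> monomials m}"
  unfolding poly_ideal_def
proof (rule pv.span_minimal[OF _ subspace_keys], rule subsetI, rule CollectI, rule subsetI)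
  fix q b assume "q \<in> {mono_poly a * p | a p. a \<in> monomials m \<and> p \<in> S}" "b \<in> keys q"
  then obtain a p c where "a \<in> monomials m" "p \<in> S" "c \<in> keys p" "b = a + c"
    by (auto simp: keys_mono_mult)
  then show "b \<in> monomials m" using assms by (auto intro: monomials_add)
qed

lemma poly_ideal_superset: "S \<subseteq> poly_ideal m S"
proof
  fix p assume "p \<in> S"
  then have "mono_poly 0 * p \<in> poly_ideal m S" by (intro poly_ideal_base) (auto simp: monomials_def)
  then show "p \<in> poly_ideal m S" by simp
qed

lemma genideal_eq_poly_ideal:
  fixes S :: "(nat, 'k::field) mpoly set"
  assumes S: "\<And>p. p \<in> S \<Longrightarrow> keys p \<subseteq> monomials m"
  shows "Idl\<^bsub>mpoly_ring m\<^esub> S = poly_ideal m S"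
proof
  interpret R: cring "mpoly_ring m :: (nat, 'k) mpoly ring" by (rule cring_mpoly_ring)
  have a_inv: "\<ominus>\<^bsub>mpoly_ring m\<^esub> x = - x" if "keys x \<subseteq> monomials m" for x :: "(nat, 'k) mpoly"
    by (rule R.minus_equality) (use that in \<open>auto simp: in_keys_iff\<close>)
  have "ideal (poly_ideal m S) (mpoly_ring m)"
  proof (rule idealI[OF R.ring_axioms])
    show "subgroup (poly_ideal m S) (add_monoid (mpoly_ring m))"
    proof (rule subgroup.intro)
      show "poly_ideal m S \<subseteq> carrier (add_monoid (mpoly_ring m))"
        using poly_ideal_carrier[OF S] by simp
      fix x y assume x: "x \<in> poly_ideal m S"
      then have "inv\<^bsub>add_monoid (mpoly_ring m)\<^esub> x = - x"
        using a_inv[of x] poly_ideal_carrier[OF S] unfolding a_inv_def by blast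
      then show "inv\<^bsub>add_monoid (mpoly_ring m)\<^esub> x \<in> poly_ideal m S"
        using pv.subspace_neg[OF subspace_poly_ideal x] by simp
      assume "y \<in> poly_ideal m S"
      then show "x \<otimes>\<^bsub>add_monoid (mpoly_ring m)\<^esub> y \<in> poly_ideal m S"
        using x by (simp add: pv.subspace_add)
    qed (simp add: pv.subspace_0)
    fix a x assume "a \<in> poly_ideal m S" "x \<in> carrier (mpoly_ring m :: (nat, 'k) mpoly ring)"
    then show "x \<otimes>\<^bsub>mpoly_ring m\<^esub> a \<in> poly_ideal m S" "a \<otimes>\<^bsub>mpoly_ring m\<^esub> x \<in> poly_ideal m S"
      using poly_ideal_mult[of x m a S] by (simp_all add: mult.commute)
  qed
  then show "Idl\<^bsub>mpoly_ring m\<^esub> S \<subseteq> poly_ideal m S"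
    using poly_ideal_superset by (rule R.genideal_minimal)
  have Sc: "S \<subseteq> carrier (mpoly_ring m)" using S by auto
  interpret I: ideal "Idl\<^bsub>mpoly_ring m\<^esub> S" "mpoly_ring m" by (rule R.genideal_ideal[OF Sc])
  show "poly_ideal m S \<subseteq> Idl\<^bsub>mpoly_ring m\<^esub> S"
    unfolding poly_ideal_def
  proof (rule pv.span_minimal)
    have mult: "x * p \<in> Idl\<^bsub>mpoly_ring m\<^esub> S" if "keys x \<subseteq> monomials m" "p \<in> Idl\<^bsub>mpoly_ring m\<^esub> S" for x p
      using I.I_l_closed[OF that(2), of x] that(1) by simp
    show "{mono_poly a * p | a p. a \<in> monomials m \<and> p \<in> S} \<subseteq> Idl\<^bsub>mpoly_ring m\<^esub> S"
      using R.genideal_self[OF Sc] by (auto intro!: mult)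
    show "pv.subspace (Idl\<^bsub>mpoly_ring m\<^esub> S)"
    proof (rule pv.subspaceI)
      show "0 \<in> Idl\<^bsub>mpoly_ring m\<^esub> S" using I.zero_closed by simp
      fix x y c assume x: "x \<in> Idl\<^bsub>mpoly_ring m\<^esub> S"
      show "scl c x \<in> Idl\<^bsub>mpoly_ring m\<^esub> S"
        unfolding scl_def by (rule mult[OF _ x]) (simp add: poly_const_def monomials_def)
      assume "y \<in> Idl\<^bsub>mpoly_ring m\<^esub> S"
      then show "x + y \<in> Idl\<^bsub>mpoly_ring m\<^esub> S" using I.a_closed[OF x] by simp
    qed
  qed
qed

lemma lead_monos_closed:
  assumes "\<And>a p. a \<in> monomials m \<Longrightarrow> p \<in> L \<Longrightarrow> mono_poly a * p \<in> L"
    and "a \<in> monomials m" "b \<in> lead_monos L"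
  shows "a + b \<in> lead_monos L"
proof -
  obtain p where p: "p \<in> L" "p \<noteq> 0" "lead_mono p = b" using assms(3) by (rule lead_monosE)
  have "lead_mono (mono_poly a * p) = a + b" using lead_mono_mono_mult[OF p(2)] p(3) by simp
  moreover have "mono_poly a * p \<noteq> 0" using p(2) by simp
  ultimately show ?thesis using assms(1)[OF assms(2) p(1)] by (metis lead_monosI)
qed

lemma poly_ideal_monos:
  assumes "\<And>a b. a \<in> monomials m \<Longrightarrow> b \<in> M \<Longrightarrow> a + b \<in> M"
  shows "poly_ideal m (mono_poly ` M) = {p :: (nat, 'k::field) mpoly. keys p \<subseteq> M}"
proof -
  have "{mono_poly a * p | a p. a \<in> monomials m \<and> p \<in> mono_poly ` M} = (mono_poly ` M :: (nat, 'k) mpoly set)"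
  proof (intro antisym subsetI)
    fix x :: "(nat, 'k) mpoly"
    assume "x \<in> {mono_poly a * p | a p. a \<in> monomials m \<and> p \<in> mono_poly ` M}"
    then obtain a b where "a \<in> monomials m" "b \<in> M" "x = mono_poly (a + b)"
      by (auto simp: mono_poly_add)
    then show "x \<in> mono_poly ` M" using assms by blast
  next
    fix x :: "(nat, 'k) mpoly" assume "x \<in> mono_poly ` M"
    then have "x = mono_poly 0 * x" "0 \<in> monomials m" "x \<in> mono_poly ` M" by (auto simp: monomials_def)
    then show "x \<in> {mono_poly a * p | a p. a \<in> monomials m \<and> p \<in> mono_poly ` M}" by blast
  qed
  then show ?thesis by (simp add: poly_ideal_def span_monos)
qed

text \<open>Leading monomials are closed under multiplication by monomials, so the ideal they
  generate consists of the polynomials supported on them. Membership becomes a question on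
  exponents.\<close>

lemma initial_ideal_eq:
  fixes L :: "(nat, 'k::field) mpoly set"
  assumes L: "L \<subseteq> {p. keys p \<subseteq> monomials m}"
    and closed: "\<And>a p. a \<in> monomials m \<Longrightarrow> p \<in> L \<Longrightarrow> mono_poly a * p \<in> L"
  shows "initial_ideal m L = {p. keys p \<subseteq> lead_monos L}"
proof -
  have "{mono_poly (lead_mono p) | p. p \<in> L \<and> p \<noteq> 0} = (mono_poly ` lead_monos L :: (nat, 'k) mpoly set)"
    by (auto simp: lead_monos_def)
  then have "initial_ideal m L = Idl\<^bsub>mpoly_ring m\<^esub> (mono_poly ` lead_monos L)"
    by (simp add: initial_ideal_def)
  also have "\<dots> = poly_ideal m (mono_poly ` lead_monos L)"
  proof (rule genideal_eq_poly_ideal)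
    fix q :: "(nat, 'k) mpoly" assume "q \<in> mono_poly ` lead_monos L"
    then obtain p where "p \<in> L" "p \<noteq> 0" "q = mono_poly (lead_mono p)" by (auto simp: lead_monos_def)
    then show "keys q \<subseteq> monomials m" using L lead_mono(1) by fastforce
  qed
  also have "\<dots> = {p. keys p \<subseteq> lead_monos L}"
    by (rule poly_ideal_monos) (rule lead_monos_closed[OF closed])
  finally show ?thesis .
qed

section \<open>Homogeneous components of polynomials and ideals\<close>

definition hcomp :: "nat \<Rightarrow> ('i, 'a::comm_ring_1) mpoly \<Rightarrow> ('i, 'a) mpoly" where
  "hcomp D p = (\<Sum>a\<in>{a \<in> keys p. mdeg a = D}. single a (lookup p a))"

lemma lookup_hcomp: "lookup (hcomp D p) a = (lookup p a when mdeg a = D)"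
proof -
  have "lookup (hcomp D p) a = (\<Sum>b\<in>{b \<in> keys p. mdeg b = D}. if b = a then lookup p a else 0)"
    unfolding hcomp_def lookup_sum by (rule sum.cong) (auto simp: lookup_single when_def)
  then show ?thesis by (auto simp: when_def in_keys_iff)
qed

lemma subspace_hcomp_vimage:
  fixes W :: "('i, 'k::field) mpoly set"
  assumes W: "pv.subspace W" shows "pv.subspace {p. hcomp D p \<in> W}"
proof -
  have "hcomp D (p + q) = hcomp D p + hcomp D q" "hcomp D (scl c p) = scl c (hcomp D p)" "hcomp D (0 :: ('i, 'k) mpoly) = 0"
    for p q :: "('i, 'k) mpoly" and c
    by (rule poly_mapping_eqI; simp add: lookup_hcomp lookup_add when_def)+
  then show ?thesis
    by (intro pv.subspaceI) (simp_all add: pv.subspace_0[OF W] pv.subspace_add[OF W] pv.subspace_scale[OF W])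
qed

lemma hcomp_hforms: "p \<in> hforms V D \<Longrightarrow> hcomp E p = (if E = D then p else 0)"
  by (rule poly_mapping_eqI)
     (auto simp: lookup_hcomp hforms_def mons_def when_def in_keys_iff subset_iff)

lemma monomials_eq: "a \<in> monomials m \<longleftrightarrow> keys a \<subseteq> {1..m}"
  by (simp add: monomials_def)

lemma hcomp_poly_ideal:
  fixes f :: "'j \<Rightarrow> (nat, 'k::field) mpoly"
  assumes f: "\<And>j. j \<in> J \<Longrightarrow> f j \<in> hforms {1..m} (e j)" and p: "p \<in> poly_ideal m (f ` J)"
  shows "hcomp D p \<in> ideal_part {1..m} e J f D"
proof -
  have "poly_ideal m (f ` J) \<subseteq> {p. hcomp D p \<in> ideal_part {1..m} e J f D}"
    unfolding poly_ideal_def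
  proof (rule pv.span_minimal[OF _ subspace_hcomp_vimage[OF subspace_ideal_part]], rule subsetI, rule CollectI)
    fix x assume "x \<in> {mono_poly a * p | a p. a \<in> monomials m \<and> p \<in> f ` J}"
    then obtain a j where x: "x = mono_poly a * f j" "a \<in> monomials m" "j \<in> J" by blast
    then have "x \<in> hforms {1..m} (mdeg a + e j)"
      using f by (auto intro!: hforms_mult simp: mons_def monomials_eq)
    then show "hcomp D x \<in> ideal_part {1..m} e J f D"
      using x by (auto simp: hcomp_hforms pv.subspace_0 monomials_eq intro: ideal_part_base)
  qed
  then show ?thesis using p by blast
qed

lemma ideal_part_subset_poly_ideal: "ideal_part {1..m} e J f D \<subseteq> poly_ideal m (f ` J)"
  unfolding ideal_part_def poly_ideal_def by (rule pv.span_mono) (auto simp: monomials_eq)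

text \<open>Cutting a polynomial down to the degree of its leading monomial keeps that monomial
  leading, and a homogeneous ideal contains the cut.\<close>

lemma lead_monos_homogeneous:
  fixes L :: "(nat, 'k::field) mpoly set"
  assumes "\<And>D. W D \<subseteq> L" "\<And>D p. p \<in> L \<Longrightarrow> hcomp D p \<in> W D"
  shows "lead_monos L = {b. b \<in> lead_monos (W (mdeg b))}"
proof (intro antisym subsetI)
  fix b assume "b \<in> lead_monos L"
  then obtain p where p: "p \<in> L" "p \<noteq> 0" "lead_mono p = b" by (rule lead_monosE)
  let ?q = "hcomp (mdeg b) p"
  have bp: "b \<in> keys p" using lead_mono(1)[OF p(2)] p(3) by simp
  then have bq: "b \<in> keys ?q" by (simp add: in_keys_iff lookup_hcomp)
  have "lead_mono ?q = b"
  proof (rule lead_mono_eqI[OF bq])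
    fix c assume c: "c \<in> keys ?q" "c \<noteq> b"
    then have "c \<in> keys p" by (auto simp: in_keys_iff lookup_hcomp when_def split: if_splits)
    then show "drl_less c b" using lead_mono(2)[OF p(2)] p(3) c(2) by simp
  qed
  moreover have "?q \<noteq> 0" using bq by auto
  ultimately show "b \<in> {b. b \<in> lead_monos (W (mdeg b))}" using assms(2)[OF p(1)] by (auto intro: lead_monosI)
next
  fix b assume "b \<in> {b. b \<in> lead_monos (W (mdeg b))}"
  then show "b \<in> lead_monos L" using lead_monos_mono[OF assms(1)] by blast
qed

section \<open>The homomorphism setting the last variable to zero\<close>

lemma poly_var_power: "poly_var i ^ k = mono_poly (single i k)"
proof (induction k)
  case (Suc k)
  have "single i (Suc k) = single i 1 + single i k" by (simp flip: single_add)
  then show ?case using Suc by (simp add: poly_var_def mono_poly_add)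
qed simp

lemma prod_poly_var:
  "(\<Prod>i\<in>keys a. poly_var i ^ lookup a i) = (mono_poly a :: ('i, 'a::comm_ring_1) mpoly)"
proof -
  have "(\<Prod>i\<in>A. poly_var i ^ lookup a i) =
      (mono_poly (\<Sum>i\<in>A. single i (lookup a i)) :: ('i, 'a) mpoly)" for A
    by (induction A rule: infinite_finite_induct) (auto simp: poly_var_power mono_poly_add)
  then show ?thesis by (simp flip: poly_mapping_sum_singles)
qed

lemma proj_z_eq_restrict_vars:
  fixes p :: "(nat, 'k::field) mpoly"
  assumes "keys p \<subseteq> monomials (n + 1)"
  shows "proj_z n p = restrict_vars {1..n} p"
proof -
  let ?c = "\<lambda>i. if i = n + 1 then 0 else poly_var i :: (nat, 'k) mpoly"
  have prod: "(\<Prod>i\<in>keys a. ?c i ^ lookup a i) = (if n + 1 \<in> keys a then 0 else mono_poly a)" for a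
  proof (cases "n + 1 \<in> keys a")
    case True
    then have "?c (n + 1) ^ lookup a (n + 1) = 0" by (simp add: in_keys_iff)
    then have "(\<Prod>i\<in>keys a. ?c i ^ lookup a i) = 0" using True by (intro prod_zero) auto
    then show ?thesis using True by simp
  next
    case False
    then have "(\<Prod>i\<in>keys a. ?c i ^ lookup a i) = (\<Prod>i\<in>keys a. poly_var i ^ lookup a i)"
      by (intro prod.cong) auto
    then show ?thesis using False by (simp add: prod_poly_var)
  qed
  have "proj_z n p = (\<Sum>a\<in>keys p. poly_const (lookup p a) * (if n + 1 \<in> keys a then 0 else mono_poly a))"
    unfolding proj_z_def poly_eval_def prod ..
  also have "\<dots> = (\<Sum>a\<in>{a \<in> keys p. keys a \<subseteq> {1..n}}. poly_const (lookup p a) * (if n + 1 \<in> keys a then 0 else mono_poly a))"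
  proof (rule sum.mono_neutral_right)
    show "\<forall>a\<in>keys p - {a \<in> keys p. keys a \<subseteq> {1..n}}. poly_const (lookup p a) * (if n + 1 \<in> keys a then 0 else mono_poly a) = 0"
    proof
      fix a assume a: "a \<in> keys p - {a \<in> keys p. keys a \<subseteq> {1..n}}"
      then have "keys a \<subseteq> {1..n + 1}" "\<not> keys a \<subseteq> {1..n}" using assms by (auto simp: monomials_def)
      moreover have "{1..n + 1} - {n + 1} = {1..n}" by auto
      ultimately have "n + 1 \<in> keys a" by blast
      then show "poly_const (lookup p a) * (if n + 1 \<in> keys a then 0 else mono_poly a) = 0" by simp
    qed
  qed auto
  also have "\<dots> = restrict_vars {1..n} p"
    unfolding restrict_vars_def
  proof (rule sum.cong[OF refl])
    fix a assume "a \<in> {a \<in> keys p. keys a \<subseteq> {1..n}}"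
    then have "n + 1 \<notin> keys a" by auto
    then show "poly_const (lookup p a) * (if n + 1 \<in> keys a then 0 else mono_poly a) = single a (lookup p a)"
      by (simp add: poly_const_def mono_poly_def mult_single)
  qed
  finally show ?thesis .
qed

text \<open>Every subset of \<open>C\<close> is a selection by positions; hence only the sizes of
  the sets \<open>S_i\<close> in the theorem need an argument.\<close>

lemma select_exists:
  assumes C: "finite C" and Y: "Y \<subseteq> C"
  shows "\<exists>S. S \<subseteq> {1..card C} \<and> card S = card Y \<and> select C S = Y"
proof -
  note dl = decreasing_list[OF C]
  let ?xs = "decreasing_list C"
  have distinct: "distinct ?xs"
  proof -
    have "sorted_wrt (\<lambda>a b. a \<noteq> b) ?xs"
      using dl drl_less_irrefl by (auto intro: sorted_wrt_mono_rel[of ?xs "\<lambda>a b. drl_less b a"])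
    then show ?thesis by (simp add: distinct_conv_nth sorted_wrt_iff_nth_less nat_neq_iff) metis
  qed
  have len: "length ?xs = card C" using dl distinct_card[OF distinct] by simp
  define S where "S = {i \<in> {1..card C}. ?xs ! (i - 1) \<in> Y}"
  have "bij_betw (\<lambda>i. ?xs ! (i - 1)) S Y"
    unfolding bij_betw_def
  proof
    show "inj_on (\<lambda>i. ?xs ! (i - 1)) S"
    proof (rule inj_onI)
      fix i j assume "i \<in> S" "j \<in> S" "?xs ! (i - 1) = ?xs ! (j - 1)"
      then have "i - 1 = j - 1" "1 \<le> i" "1 \<le> j"
        using nth_eq_iff_index_eq[OF distinct, of "i - 1" "j - 1"] len by (auto simp: S_def)
      then show "i = j" by simp
    qed
    show "(\<lambda>i. ?xs ! (i - 1)) ` S = Y"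
    proof (intro antisym subsetI)
      fix x assume x: "x \<in> Y"
      then have "x \<in> set ?xs" using Y dl by auto
      then obtain j where "j < card C" "?xs ! j = x" using len by (auto simp: in_set_conv_nth)
      then show "x \<in> (\<lambda>i. ?xs ! (i - 1)) ` S" using x by (intro image_eqI[of _ _ "Suc j"]) (auto simp: S_def)
    qed (auto simp: S_def)
  qed
  then have "card S = card Y" "(\<lambda>i. ?xs ! (i - 1)) ` S = Y" by (auto simp: bij_betw_same_card bij_betw_def)
  moreover have "select C S = (\<lambda>i. ?xs ! (i - 1)) ` S" by (auto simp: select_def S_def)
  ultimately show ?thesis by (intro exI[of _ S]) (auto simp: S_def)
qed

lemma select_first:
  assumes C: "finite C" "C \<noteq> {}"
  obtains b where "select C {1} = {b}" "b \<in> C" "\<And>c. c \<in> C \<Longrightarrow> c \<noteq> b \<Longrightarrow> drl_less c b"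
proof -
  note dl = decreasing_list[OF C(1)]
  obtain b xs where xs: "decreasing_list C = b # xs" using dl C(2) by (cases "decreasing_list C") auto
  have "1 \<le> card C" using C by (simp add: Suc_le_eq card_gt_0_iff)
  then have "select C {1} = {b}" by (auto simp: select_def xs)
  moreover have "b \<in> C" using dl xs by auto
  moreover have "drl_less c b" if "c \<in> C" "c \<noteq> b" for c
    using dl xs that by auto
  ultimately show ?thesis using that by blast
qed

subsection \<open>The initial ideal\<close>

lemma poly_ideal_mono: "S \<subseteq> T \<Longrightarrow> poly_ideal m S \<subseteq> poly_ideal m T"
  unfolding poly_ideal_def by (rule pv.span_mono) auto

context generic_ideal
begin

text \<open>The monomials of \<open>in(I,g)\<close> and of \<open>in(I)\<close>, each tested in its
  own degree. \<open>new_std\<close> collects the standard monomials of \<open>J\<close> that become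
  leading for \<open>(I,g)\<close>, which are the sets selected by the \<open>S_i\<close>.\<close>

definition "LW = {b. b \<in> lead_monos (W (mdeg b))}"
definition "LU = {b. b \<in> lead_monos (U (mdeg b))}"
definition "new_std i = std i \<inter> lead_monos (W i)"

abbreviation "I \<equiv> poly_ideal (Suc n) (f ` {..<n})"
abbreviation "Ig \<equiv> poly_ideal (Suc n) (f ` {..<Suc n})"

lemma in_LW: "b \<in> lead_monos (W i) \<longleftrightarrow> b \<in> LW \<and> mdeg b = i"
  using lead_monos_subset[OF sub(1)] by (auto simp: LW_def mons_def)

lemma in_LU: "b \<in> lead_monos (U i) \<longleftrightarrow> b \<in> LU \<and> mdeg b = i"
  using lead_monos_subset[OF sub(2)] by (auto simp: LU_def mons_def)

lemma keys_LW: "b \<in> LW \<Longrightarrow> keys b \<subseteq> {1..Suc n}"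
  using lead_monos_subset[OF sub(1)] by (auto simp: LW_def mons_def)

lemma lead_monos_Ig: "lead_monos Ig = LW"
  unfolding LW_def
proof (rule lead_monos_homogeneous)
  show "W D \<subseteq> Ig" for D unfolding W_def by (rule ideal_part_subset_poly_ideal)
  show "hcomp D p \<in> W D" if "p \<in> Ig" for D p
    unfolding W_def by (rule hcomp_poly_ideal[OF generic_family_hforms[OF gen] that])
qed

lemma lead_monos_I: "lead_monos I = LU"
  unfolding LU_def
proof (rule lead_monos_homogeneous)
  show "U D \<subseteq> I" for D unfolding U_def by (rule ideal_part_subset_poly_ideal)
  show "hcomp D p \<in> U D" if "p \<in> I" for D p
    unfolding U_def by (rule hcomp_poly_ideal[OF generic_family_hforms[OF gen] that]) simp
qed

lemma keys_f: "j < Suc n \<Longrightarrow> keys (f j) \<subseteq> monomials (Suc n)"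
  using generic_family_hforms[OF gen, of j] by (auto simp: hforms_def mons_def monomials_eq)

lemma I_carrier: "I \<subseteq> {p. keys p \<subseteq> monomials (Suc n)}"
proof (rule poly_ideal_carrier)
  fix p assume "p \<in> f ` {..<n}"
  then obtain j where "j < n" "p = f j" by blast
  then show "keys p \<subseteq> monomials (Suc n)" using keys_f[of j] by simp
qed

lemma Ig_carrier: "Ig \<subseteq> {p. keys p \<subseteq> monomials (Suc n)}"
proof (rule poly_ideal_carrier)
  fix p assume "p \<in> f ` {..<Suc n}"
  then obtain j where "j < Suc n" "p = f j" by blast
  then show "keys p \<subseteq> monomials (Suc n)" using keys_f[of j] by simp
qed

lemma mono_mult_poly_ideal:
  "a \<in> monomials m \<Longrightarrow> p \<in> poly_ideal m S \<Longrightarrow> mono_poly a * p \<in> poly_ideal m S"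
  by (rule poly_ideal_mult) auto

lemma initial_ideal_Ig: "initial_ideal (Suc n) Ig = {p. keys p \<subseteq> LW}"
  unfolding lead_monos_Ig[symmetric] by (rule initial_ideal_eq[OF Ig_carrier mono_mult_poly_ideal])

lemma initial_ideal_I: "initial_ideal (Suc n) I = {p. keys p \<subseteq> LU}"
  unfolding lead_monos_I[symmetric] by (rule initial_ideal_eq[OF I_carrier mono_mult_poly_ideal])

lemma LW_closed: "keys a \<subseteq> {1..Suc n} \<Longrightarrow> b \<in> LW \<Longrightarrow> a + b \<in> LW"
  unfolding lead_monos_Ig[symmetric]
  by (rule lead_monos_closed[OF mono_mult_poly_ideal]) (auto simp: monomials_eq)

lemma LU_subset_LW: "LU \<subseteq> LW"
  unfolding lead_monos_Ig[symmetric] lead_monos_I[symmetric]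
  by (intro lead_monos_mono poly_ideal_mono image_mono) auto

lemma Uz_eq: "Uz D = restrict_vars {1..n} ` U D"
  unfolding Uz_def U_def fz_def by (rule restrict_ideal_part[symmetric]) auto

lemma proj_I: "proj_z n ` I = restrict_vars {1..n} ` I"
  using I_carrier by (intro image_cong refl proj_z_eq_restrict_vars) auto

lemma lead_monos_proj_I: "lead_monos (proj_z n ` I) = {b. b \<in> lead_monos (Uz (mdeg b))}"
  unfolding proj_I
proof (rule lead_monos_homogeneous)
  show "Uz D \<subseteq> restrict_vars {1..n} ` I" for D
    unfolding Uz_eq U_def by (intro image_mono ideal_part_subset_poly_ideal)
  fix D p assume "p \<in> restrict_vars {1..n} ` I"
  then obtain q where q: "q \<in> I" "p = restrict_vars {1..n} q" by blast
  have "hcomp D q \<in> U D"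
    unfolding U_def by (rule hcomp_poly_ideal[OF generic_family_hforms[OF gen] q(1)]) simp
  moreover have "hcomp D p = restrict_vars {1..n} (hcomp D q)"
    unfolding q(2) by (rule poly_mapping_eqI) (simp add: lookup_hcomp lookup_restrict_vars when_def)
  ultimately show "hcomp D p \<in> Uz D" unfolding Uz_eq by blast
qed

lemma standard_monomials_eq: "{b \<in> standard_monomials n (proj_z n ` I). mdeg b = i} = std i"
proof -
  have "initial_ideal n (proj_z n ` I) = {p. keys p \<subseteq> lead_monos (proj_z n ` I)}"
  proof (rule initial_ideal_eq)
    show "proj_z n ` I \<subseteq> {p. keys p \<subseteq> monomials n}"
      unfolding proj_I by (auto simp: keys_restrict_vars monomials_eq)
    fix a p assume a: "a \<in> monomials n" and "p \<in> proj_z n ` I"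
    then obtain q where q: "q \<in> I" "p = restrict_vars {1..n} q" unfolding proj_I by blast
    have "a \<in> monomials (Suc n)" using a by (fastforce simp: monomials_eq)
    then have "mono_poly a * q \<in> I" using q(1) by (rule mono_mult_poly_ideal)
    moreover have "mono_poly a * p = restrict_vars {1..n} (mono_poly a * q)"
      using a by (simp add: q(2) restrict_vars_mono_mult monomials_eq)
    ultimately show "mono_poly a * p \<in> proj_z n ` I" unfolding proj_I by blast
  qed
  then show ?thesis
    by (auto simp: standard_monomials_def lead_monos_proj_I std_def mons_def monomials_eq)
qed

lemma std_high:
  assumes "b \<in> std i" "socle_deg + 1 \<le> t + 2 * i"
  shows "single (Suc n) t + b \<in> LW"
  using lead_mono_high[of b i t] assms in_LW by (auto simp: std_def)

lemma std_divisor: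
  assumes "a + b \<in> std i"
  shows "a \<in> std (mdeg a)"
proof -
  have ab: "keys a \<subseteq> {1..n}" "keys b \<subseteq> {1..n}" "mdeg a + mdeg b = i"
    using assms by (auto simp: std_def mons_def keys_add_expo)
  have "a \<notin> lead_monos (Uz (mdeg a))"
  proof
    assume "a \<in> lead_monos (Uz (mdeg a))"
    then obtain p where p: "p \<in> Uz (mdeg a)" "p \<noteq> 0" "lead_mono p = a" by (rule lead_monosE)
    have "mono_poly b * p \<in> Uz (mdeg b + mdeg a)"
      unfolding Uz_def by (rule ideal_part_mult) (use p(1) ab in \<open>auto simp: Uz_def mons_def\<close>)
    moreover have "lead_mono (mono_poly b * p) = a + b"
      using lead_mono_mono_mult[OF p(2)] p(3) by (simp add: add.commute)
    moreover have "mono_poly b * p \<noteq> 0" using p(2) by (metis mono_mult_eq_0_iff)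
    ultimately have "a + b \<in> lead_monos (Uz i)" using ab(3) by (metis lead_monosI add.commute)
    then show False using assms by (simp add: std_def)
  qed
  then show ?thesis using ab by (simp add: std_def mons_def)
qed

text \<open>Writing \<open>x = z^t b\<close>, either \<open>b\<close> lies in \<open>in(I)\<close>,
  or \<open>b\<close> is standard for \<open>J\<close> and the position of
  \<open>t + 2 deg b\<close> relative to the socle degree decides which generator divides
  \<open>x\<close>. The degree \<open>(socle_deg + 2) div 2\<close> is the least one at which every
  standard monomial is leading even without a factor \<open>z\<close>.\<close>

lemma LW_decompose:
  assumes x: "x \<in> LW"
  obtains c y where "x = c + y" "keys c \<subseteq> {1..Suc n}"
    "y \<in> LU \<or> (\<exists>i. e n \<le> i \<and> 2 * i \<le> socle_deg \<and> y \<in> new_std i) \<or>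
     (\<exists>i b. 2 * i \<le> socle_deg + 1 \<and> b \<in> std i \<and> y = single (Suc n) (socle_deg + 1 - 2 * i) + b) \<or>
     y \<in> std ((socle_deg + 2) div 2)"
proof -
  obtain t b where tb: "x = single (Suc n) t + b" "keys b \<subseteq> {1..n}"
    using split_last_var[OF keys_LW[OF x]] by metis
  define i where "i = mdeg b"
  have z: "keys (single (Suc n) u) \<subseteq> {1..Suc n}" for u :: nat by simp
  have bm: "b \<in> mons {1..n} i" using tb(2) by (simp add: mons_def i_def)
  show ?thesis
  proof (cases "b \<in> lead_monos (Uz i)")
    case True
    then have "b \<in> LU" using in_LU[of b i] by (simp add: lead_monos_Uz)
    then show ?thesis using that[OF tb(1) z] by blast
  next
    case False
    then have std: "b \<in> std i" using bm by (simp add: std_def)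
    \<comment> \<open>Injective range, where \<open>z^t\<close> cancels; surjective range, where
      \<open>socle_deg + 1 - 2 * i\<close> is the least sufficient power of \<open>z\<close>; and
      degrees so large that no power of \<open>z\<close> is needed.\<close>
    consider "t + 2 * i \<le> socle_deg" | "socle_deg < t + 2 * i" "2 * i \<le> socle_deg + 1" | "socle_deg + 1 < 2 * i"
      by linarith
    then show ?thesis
    proof cases
      case 1
      have "x \<in> lead_monos (W (t + i))" using x by (simp add: in_LW tb(1) i_def)
      then have "b \<in> new_std i" using lead_mono_low[OF 1] std tb(1) by (simp add: new_std_def)
      \<comment> \<open>Below the degree of \<open>g\<close> the count of new leading monomials is
        zero.\<close>
      moreover from this have "e n \<le> i"
        using card_std_lead[of i] 1 by (auto simp: new_std_def split: if_splits)
      ultimately have "e n \<le> i \<and> 2 * i \<le> socle_deg \<and> b \<in> new_std i" using 1 by simp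
      then show ?thesis using that[OF tb(1) z] by blast
    next
      case 2
      have "x = single (Suc n) (t - (socle_deg + 1 - 2 * i)) + (single (Suc n) (socle_deg + 1 - 2 * i) + b)"
        using 2 by (simp add: tb(1) flip: add.assoc single_add)
      from that[OF this z] show ?thesis using 2 std by blast
    next
      case 3
      then have "(socle_deg + 2) div 2 \<le> mdeg b" by (simp add: i_def)
      then obtain a c where ac: "b = a + c" "mdeg a = (socle_deg + 2) div 2" using expo_divisor by blast
      have "a \<in> std ((socle_deg + 2) div 2)" using std_divisor[of a c i] std ac by simp
      moreover have "x = (single (Suc n) t + c) + a" by (simp add: tb(1) ac(1) add_ac)
      moreover have "keys (single (Suc n) t + c) \<subseteq> {1..Suc n}"
      proof -
        have "{1..n} \<subseteq> {1..Suc n}" by auto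
        then show ?thesis using tb(2) z[of t] unfolding ac(1) keys_add_expo by blast
      qed
      ultimately show ?thesis using that by blast
    qed
  qed
qed

lemma initial_ideal_generators:
  assumes G: "G \<subseteq> LW"
    and gens: "\<And>x. x \<in> LW \<Longrightarrow> \<exists>c y. x = c + y \<and> keys c \<subseteq> {1..Suc n} \<and> (y \<in> LU \<or> y \<in> G)"
  shows "initial_ideal (Suc n) Ig = Idl\<^bsub>mpoly_ring (Suc n)\<^esub> (initial_ideal (Suc n) I \<union> mono_poly ` G)"
proof -
  let ?S = "initial_ideal (Suc n) I \<union> mono_poly ` G"
  have S: "?S \<subseteq> {p. keys p \<subseteq> LW}" using G LU_subset_LW by (auto simp: initial_ideal_I)
  have "Idl\<^bsub>mpoly_ring (Suc n)\<^esub> ?S = poly_ideal (Suc n) ?S"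
  proof (rule genideal_eq_poly_ideal)
    fix p assume "p \<in> ?S"
    then have "keys p \<subseteq> LW" using S by blast
    then show "keys p \<subseteq> monomials (Suc n)" using keys_LW by (auto simp: monomials_eq subset_iff)
  qed
  also have "\<dots> = {p. keys p \<subseteq> LW}"
  proof
    show "poly_ideal (Suc n) ?S \<subseteq> {p. keys p \<subseteq> LW}"
      unfolding poly_ideal_def[of _ ?S]
    proof (rule pv.span_minimal[OF _ subspace_keys], rule subsetI, rule CollectI, rule subsetI)
      fix q b assume "q \<in> {mono_poly a * p | a p. a \<in> monomials (Suc n) \<and> p \<in> ?S}" "b \<in> keys q"
      then obtain a p where ap: "q = mono_poly a * p" "a \<in> monomials (Suc n)" "p \<in> ?S" by blast
      then obtain c where c: "c \<in> keys p" "b = a + c"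
        using \<open>b \<in> keys q\<close> by (auto simp: keys_mono_mult)
      then have "c \<in> LW" using ap(3) S by blast
      then show "b \<in> LW" using LW_closed ap(2) c(2) by (simp add: monomials_eq)
    qed
    have "mono_poly ` LW \<subseteq> poly_ideal (Suc n) ?S"
    proof (rule image_subsetI)
      fix x assume "x \<in> LW"
      then obtain c y where cy: "x = c + y" "keys c \<subseteq> {1..Suc n}" "y \<in> LU \<or> y \<in> G" using gens by blast
      have "mono_poly y \<in> ?S" using cy(3) by (auto simp: initial_ideal_I)
      then show "mono_poly x \<in> poly_ideal (Suc n) ?S"
        unfolding cy(1) mono_poly_add using cy(2) by (intro poly_ideal_base) (simp_all add: monomials_eq)
    qed
    then have "pv.span (mono_poly ` LW) \<subseteq> poly_ideal (Suc n) ?S"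
      by (rule pv.span_minimal) simp
    then show "{p. keys p \<subseteq> LW} \<subseteq> poly_ideal (Suc n) ?S" by (simp add: span_monos)
  qed
  finally show ?thesis by (simp add: initial_ideal_Ig)
qed

lemma card_new_std:
  assumes "2 * (e n + i) \<le> socle_deg + 1"
  shows "card (new_std (e n + i)) = card (std i)"
  using card_std_lead[OF assms] by (simp add: new_std_def)

lemma card_std_0: "card (std 0) = 1"
proof -
  have "box n e n 0 = {0}"
    using e_pos by (auto simp: box_def mons_def mdeg_eq_0_iff)
  then show ?thesis by (simp add: card_std)
qed

text \<open>In the degree of \<open>g\<close> there is exactly one new leading monomial, because
  \<open>a_0 = 1\<close>, and the largest standard monomial is one.\<close>

lemma select_first_std:
  assumes "2 * e n \<le> socle_deg + 1"
  shows "select (std (e n)) {1} = new_std (e n)"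
proof -
  have card: "card (new_std (e n)) = 1" using card_new_std[of 0] assms card_std_0 by simp
  then have "new_std (e n) \<noteq> {}" by auto
  then have "std (e n) \<noteq> {}" by (auto simp: new_std_def)
  then obtain b where b: "select (std (e n)) {1} = {b}" "b \<in> std (e n)"
    "\<And>c. c \<in> std (e n) \<Longrightarrow> c \<noteq> b \<Longrightarrow> drl_less c b"
    by (rule select_first[OF finite_std]) blast
  then have "b \<in> new_std (e n)" using largest_std_lead by (simp add: new_std_def)
  then show ?thesis using card b(1) by (metis card_1_singletonE singletonD)
qed

lemma select_new_std:
  assumes "2 * (e n + k) \<le> socle_deg + 1"
  shows "\<exists>S :: nat \<Rightarrow> nat set. \<forall>i\<in>{1..k}. S i \<subseteq> {1..card (std (e n + i))} \<and> card (S i) = card (std i) \<and>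
    select (std (e n + i)) (S i) = new_std (e n + i)"
proof -
  have "\<forall>i\<in>{1..k}. \<exists>S. S \<subseteq> {1..card (std (e n + i))} \<and> card S = card (std i) \<and>
    select (std (e n + i)) S = new_std (e n + i)"
  proof
    fix i assume i: "i \<in> {1..k}"
    have "new_std (e n + i) \<subseteq> std (e n + i)" by (simp add: new_std_def)
    from select_exists[OF finite_std this]
    show "\<exists>S. S \<subseteq> {1..card (std (e n + i))} \<and> card S = card (std i) \<and>
      select (std (e n + i)) S = new_std (e n + i)"
      using card_new_std[of i] assms i by simp
  qed
  then show ?thesis by (rule bchoice)
qed

lemma new_std_LW: "new_std i \<subseteq> LW"
  by (auto simp: new_std_def in_LW)

text \<open>Substituting \<open>i = d + k - j\<close> into the minimal exponent
  \<open>s + 1 - 2i\<close> gives the powers \<open>z^(2j)\<close>.\<close>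

lemma initial_ideal_even:
  assumes k: "socle_deg + 1 = 2 * (e n + k)"
  shows "initial_ideal (Suc n) Ig = Idl\<^bsub>mpoly_ring (Suc n)\<^esub> (initial_ideal (Suc n) I \<union> mono_poly `
    (new_std (e n) \<union> (\<Union>i\<in>{1..k}. new_std (e n + i)) \<union>
     (\<Union>j\<in>{1..e n + k}. z_times n (2 * j) (std (e n + k - j)))))"
    (is "_ = Idl\<^bsub>_\<^esub> (_ \<union> mono_poly ` ?G)")
proof (rule initial_ideal_generators)
  have new: "new_std i \<subseteq> ?G" if "e n \<le> i" "i \<le> e n + k" for i
  proof -
    obtain j where "i = e n + j" "j \<le> k" using \<open>e n \<le> i\<close> \<open>i \<le> e n + k\<close> by (metis add_le_cancel_left le_Suc_ex)
    then show ?thesis by (cases "j = 0") auto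
  qed
  \<comment> \<open>In degree \<open>d + k\<close> the exponent 0 suffices, so every standard
    monomial is new. This covers the missing index \<open>j = 0\<close> and the top alternative of
    \<open>LW_decompose\<close>.\<close>
  have top: "std (e n + k) \<subseteq> new_std (e n + k)"
    using std_high[of _ "e n + k" 0] k by (auto simp: new_std_def in_LW std_def mons_def)
  show "?G \<subseteq> LW"
  proof (intro Un_least UN_least new_std_LW)
    fix j assume "j \<in> {1..e n + k}"
    then show "z_times n (2 * j) (std (e n + k - j)) \<subseteq> LW"
      using k by (auto simp: z_times_def intro!: std_high)
  qed
  fix x assume "x \<in> LW"
  then obtain c y where cy: "x = c + y" "keys c \<subseteq> {1..Suc n}"
    "y \<in> LU \<or> (\<exists>i. e n \<le> i \<and> 2 * i \<le> socle_deg \<and> y \<in> new_std i) \<or>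
     (\<exists>i b. 2 * i \<le> socle_deg + 1 \<and> b \<in> std i \<and> y = single (Suc n) (socle_deg + 1 - 2 * i) + b) \<or>
     y \<in> std ((socle_deg + 2) div 2)"
    by (rule LW_decompose)
  have "y \<in> LU \<or> y \<in> ?G" using cy(3)
  proof (elim disjE exE conjE)
    fix i assume i: "e n \<le> i" "2 * i \<le> socle_deg" and y: "y \<in> new_std i"
    have "i \<le> e n + k" using i(2) k by simp
    then show ?thesis using new[OF i(1)] y by blast
  next
    fix i b assume i: "2 * i \<le> socle_deg + 1" "b \<in> std i" "y = single (Suc n) (socle_deg + 1 - 2 * i) + b"
    show ?thesis
    proof (cases "i = e n + k")
      case True
      then have "y = b" using i(3) k by simp
      then have "y \<in> new_std (e n + k)" using top i(2) True by blast
      then show ?thesis using new[of "e n + k"] by auto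
    next
      case False
      define j where "j = e n + k - i"
      have j: "j \<in> {1..e n + k}" "e n + k - j = i" "socle_deg + 1 - 2 * i = 2 * j"
        using i(1) k False by (auto simp: j_def)
      then have "y \<in> z_times n (2 * j) (std (e n + k - j))" using i(2,3) by (simp add: z_times_def)
      then show ?thesis using j(1) by blast
    qed
  next
    assume y: "y \<in> std ((socle_deg + 2) div 2)"
    have "(socle_deg + 2) div 2 = e n + k" using k by presburger
    then have "y \<in> new_std (e n + k)" using top y by auto
    then show ?thesis using new[of "e n + k"] by auto
  qed auto
  then show "\<exists>c y. x = c + y \<and> keys c \<subseteq> {1..Suc n} \<and> (y \<in> LU \<or> y \<in> ?G)" using cy(1,2) by blast
qed

lemma initial_ideal_odd:
  assumes k: "socle_deg = 2 * (e n + k)"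
  shows "initial_ideal (Suc n) Ig = Idl\<^bsub>mpoly_ring (Suc n)\<^esub> (initial_ideal (Suc n) I \<union> mono_poly `
    (new_std (e n) \<union> (\<Union>i\<in>{1..k}. new_std (e n + i)) \<union> std (e n + k + 1) \<union>
     (\<Union>j\<in>{0..e n + k}. z_times n (2 * j + 1) (std (e n + k - j)))))"
    (is "_ = Idl\<^bsub>_\<^esub> (_ \<union> mono_poly ` ?G)")
proof (rule initial_ideal_generators)
  have new: "new_std i \<subseteq> ?G" if "e n \<le> i" "i \<le> e n + k" for i
  proof -
    obtain j where "i = e n + j" "j \<le> k" using \<open>e n \<le> i\<close> \<open>i \<le> e n + k\<close> by (metis add_le_cancel_left le_Suc_ex)
    then show ?thesis by (cases "j = 0") auto
  qed
  show "?G \<subseteq> LW"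
  proof (intro Un_least UN_least new_std_LW)
    show "std (e n + k + 1) \<subseteq> LW"
      using std_high[of _ "e n + k + 1" 0] k by auto
    fix j assume "j \<in> {0..e n + k}"
    then show "z_times n (2 * j + 1) (std (e n + k - j)) \<subseteq> LW"
      using k std_high[of _ "e n + k - j" "2 * j + 1"] by (auto simp: z_times_def)
  qed
  fix x assume "x \<in> LW"
  then obtain c y where cy: "x = c + y" "keys c \<subseteq> {1..Suc n}"
    "y \<in> LU \<or> (\<exists>i. e n \<le> i \<and> 2 * i \<le> socle_deg \<and> y \<in> new_std i) \<or>
     (\<exists>i b. 2 * i \<le> socle_deg + 1 \<and> b \<in> std i \<and> y = single (Suc n) (socle_deg + 1 - 2 * i) + b) \<or>
     y \<in> std ((socle_deg + 2) div 2)"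
    by (rule LW_decompose)
  have "y \<in> LU \<or> y \<in> ?G" using cy(3)
  proof (elim disjE exE conjE)
    fix i assume i: "e n \<le> i" "2 * i \<le> socle_deg" and y: "y \<in> new_std i"
    have "i \<le> e n + k" using i(2) k by simp
    then show ?thesis using new[OF i(1)] y by blast
  next
    fix i b assume i: "2 * i \<le> socle_deg + 1" "b \<in> std i" "y = single (Suc n) (socle_deg + 1 - 2 * i) + b"
    define j where "j = e n + k - i"
    have "i \<le> e n + k" using i(1) k by simp
    then have j: "j \<in> {0..e n + k}" "e n + k - j = i" "socle_deg + 1 - 2 * i = 2 * j + 1"
      using k by (auto simp: j_def)
    then have "y \<in> z_times n (2 * j + 1) (std (e n + k - j))" using i(2,3) by (simp add: z_times_def)
    then show ?thesis using j(1) by blast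
  next
    assume y: "y \<in> std ((socle_deg + 2) div 2)"
    have "(socle_deg + 2) div 2 = e n + k + 1" using k by presburger
    then show ?thesis using y by auto
  qed auto
  then show "\<exists>c y. x = c + y \<and> keys c \<subseteq> {1..Suc n} \<and> (y \<in> LU \<or> y \<in> ?G)" using cy(1,2) by blast
qed

end

theorem proposition3p4:
  fixes F :: "'k::field set"
    and n d \<delta> :: nat
    and ds :: "nat list"
    and fs :: "(nat, 'k) mpoly list"
    and g :: "(nat, 'k) mpoly"
    and I Ig J :: "(nat, 'k) mpoly set"
    and B :: "nat \<Rightarrow> nat expo set"
    and a :: "nat \<Rightarrow> nat"
  assumes K_infinite: "infinite (UNIV :: 'k set)"
    and F: "subfield F (ring_of_type_algebra :: 'k ring)"
    and n: "n \<ge> 1"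
    and ds: "length ds = n" "\<forall>e\<in>set ds. e > 0"
    and d: "d > 0"
    and sorted: "sorted (ds @ [d])"
    and \<delta>: "\<delta> = sum_list ds - n"
    and d_less: "d < \<delta>"
    and generic: "generic_forms F (n + 1) (ds @ [d]) (fs @ [g])"
    and I: "I = Idl\<^bsub>mpoly_ring (n + 1)\<^esub> (set fs)"
    and Ig: "Ig = Idl\<^bsub>mpoly_ring (n + 1)\<^esub> (set fs \<union> {g})"
    and J: "J = proj_z n ` I"
    and B: "\<And>i. B i = {b \<in> standard_monomials n J. mdeg b = i}"
    and a: "\<And>i. a i = card (B i)"
  shows
    "(\<forall>k>0. \<delta> - d = 2 * k \<longrightarrow>
       (\<exists>S :: nat \<Rightarrow> nat set.
          (\<forall>i\<in>{1..k}. S i \<subseteq> {1..a (d + i)} \<and> card (S i) = a i) \<and>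
          initial_ideal (n + 1) Ig =
            Idl\<^bsub>mpoly_ring (n + 1)\<^esub>
              (initial_ideal (n + 1) I \<union>
               mono_poly ` (select (B d) {1} \<union>
                 (\<Union>i\<in>{1..k}. select (B (d + i)) (S i)) \<union>
                 (\<Union>j\<in>{1..d + k}. z_times n (2 * j) (B (d + k - j))))))) \<and>
     (\<forall>k>0. \<delta> - d = 2 * k + 1 \<longrightarrow>
       (\<exists>S :: nat \<Rightarrow> nat set.
          (\<forall>i\<in>{1..k}. S i \<subseteq> {1..a (d + i)} \<and> card (S i) = a i) \<and>
          initial_ideal (n + 1) Ig =
            Idl\<^bsub>mpoly_ring (n + 1)\<^esub>
              (initial_ideal (n + 1) I \<union>
               mono_poly ` (select (B d) {1} \<union>
                 (\<Union>i\<in>{1..k}. select (B (d + i)) (S i)) \<union>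
                 B (d + k + 1) \<union>
                 (\<Union>j\<in>{0..d + k}. z_times n (2 * j + 1) (B (d + k - j))))))) \<and>
     (\<delta> - d = 1 \<longrightarrow>
       initial_ideal (n + 1) Ig =
         Idl\<^bsub>mpoly_ring (n + 1)\<^esub>
           (initial_ideal (n + 1) I \<union>
            mono_poly ` (select (B d) {1} \<union>
              B (d + 1) \<union>
              (\<Union>j\<in>{0..d}. z_times n (2 * j + 1) (B (d - j))))))"
proof -
  define f where "f = (\<lambda>j. (fs @ [g]) ! j)"
  define e where "e = (\<lambda>j. (ds @ [d]) ! j)"
  have len: "length fs = n" using generic ds(1) by (simp add: generic_forms_def)
  have en: "e n = d" by (simp add: e_def ds(1)[symmetric])
  have e_ds: "e j = ds ! j" if "j < n" for j using that ds(1) by (simp add: e_def nth_append)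
  have fgn: "f n = g" by (simp add: f_def len[symmetric])
  have f_fs: "f j = fs ! j" if "j < n" for j using that len by (simp add: f_def nth_append)
  have mons: "mons {1..n + 1} D = {a \<in> monomials (n + 1). mdeg a = D}" for D
    by (auto simp: mons_def monomials_eq)
  interpret G: generic_ideal F n e f
  proof (rule generic_ideal.intro)
    show "generic_family F {1..Suc n} e {..<Suc n} f"
    proof -
      have "{(j, a). j \<in> {..<Suc n} \<and> a \<in> mons {1..n + 1} (e j)} =
        {(i, a). i < length (ds @ [d]) \<and> a \<in> monomials (n + 1) \<and> mdeg a = (ds @ [d]) ! i}"
        unfolding mons using ds(1) by (auto simp: e_def)
      moreover have "f j \<in> hforms {1..n + 1} (e j)" if "j < Suc n" for j
        using generic that ds(1) by (simp add: generic_forms_def forms_eq_hforms f_def e_def)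
      ultimately show ?thesis
        using generic by (simp add: generic_family_def generic_forms_def f_def)
    qed
    show "0 < e j" if "j < Suc n" for j
      using that ds d en e_ds[of j] nth_mem[of j ds] by (cases "j = n") auto
  qed (rule F, rule n)
  \<comment> \<open>The subtraction in \<delta> is not truncated because all degrees are positive;
    \<delta> is the sum of the numbers \<open>d_i - 1\<close>, and \<open>g\<close> contributes
    \<open>d - 1\<close>.\<close>
  have socle: "G.socle_deg + 1 = \<delta> + d"
  proof -
    have "(\<Sum>j<n. e j - 1) + n = (\<Sum>j<n. (e j - 1) + 1)" by (simp only: sum.distrib sum_constant) simp
    also have "\<dots> = (\<Sum>j<n. ds ! j)"
      using ds by (intro sum.cong) (auto simp: e_ds)
    also have "\<dots> = sum_list ds" using ds(1) by (simp add: sum_list_sum_nth atLeast0LessThan)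
    finally have "(\<Sum>j<n. e j - 1) = \<delta>" by (simp add: \<delta>)
    then show ?thesis using d by (simp add: G.socle_deg_def en)
  qed
  have set_fs: "set fs = f ` {..<n}" using len f_fs by (auto simp: set_conv_nth)
  have set_fsg: "set fs \<union> {g} = f ` {..<Suc n}" by (simp add: set_fs lessThan_Suc fgn)
  have I_eq: "I = poly_ideal (Suc n) (f ` {..<n})"
    unfolding I set_fs Suc_eq_plus1[symmetric]
    by (rule genideal_eq_poly_ideal) (metis G.keys_f imageE lessThan_iff less_SucI)
  have Ig_eq: "Ig = poly_ideal (Suc n) (f ` {..<Suc n})"
    unfolding Ig set_fsg Suc_eq_plus1[symmetric]
    by (rule genideal_eq_poly_ideal) (metis G.keys_f imageE lessThan_iff)
  have B_eq: "B = G.std" by (rule ext) (simp only: B J I_eq G.standard_monomials_eq)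
  have a_eq: "a i = card (G.std i)" for i by (simp add: a B_eq)
  have first: "select (G.std d) {1} = G.new_std d"
    using G.select_first_std socle d_less by (simp add: en)
  \<comment> \<open>The bound on \<open>k\<close> says that degree \<open>d + k\<close> is still in
    the range of \<open>card_std_lead\<close>.\<close>
  have positions: "\<exists>S :: nat \<Rightarrow> nat set. \<forall>i\<in>{1..k}. S i \<subseteq> {1..a (d + i)} \<and> card (S i) = a i \<and>
      select (B (d + i)) (S i) = G.new_std (d + i)" if "2 * k \<le> \<delta> - d" for k
    using G.select_new_std[of k] socle d_less that by (simp add: en a_eq B_eq)
  have even: "\<exists>S :: nat \<Rightarrow> nat set. (\<forall>i\<in>{1..k}. S i \<subseteq> {1..a (d + i)} \<and> card (S i) = a i) \<and>
      initial_ideal (n + 1) Ig = Idl\<^bsub>mpoly_ring (n + 1)\<^esub> (initial_ideal (n + 1) I \<union>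
        mono_poly ` (select (B d) {1} \<union> (\<Union>i\<in>{1..k}. select (B (d + i)) (S i)) \<union>
          (\<Union>j\<in>{1..d + k}. z_times n (2 * j) (B (d + k - j)))))"
    if k: "\<delta> - d = 2 * k" for k
  proof -
    obtain S :: "nat \<Rightarrow> nat set" where S: "\<forall>i\<in>{1..k}. S i \<subseteq> {1..a (d + i)} \<and> card (S i) = a i \<and>
      select (B (d + i)) (S i) = G.new_std (d + i)"
      using positions[of k] k by auto
    have "G.socle_deg + 1 = 2 * (e n + k)" using socle k d_less en by simp
    from G.initial_ideal_even[OF this] S show ?thesis
      unfolding Suc_eq_plus1[of n, symmetric]
      by (intro exI[of _ S]) (simp add: en I_eq Ig_eq B_eq first del: One_nat_def)
  qed
  have odd: "\<exists>S :: nat \<Rightarrow> nat set. (\<forall>i\<in>{1..k}. S i \<subseteq> {1..a (d + i)} \<and> card (S i) = a i) \<and>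
      initial_ideal (n + 1) Ig = Idl\<^bsub>mpoly_ring (n + 1)\<^esub> (initial_ideal (n + 1) I \<union>
        mono_poly ` (select (B d) {1} \<union> (\<Union>i\<in>{1..k}. select (B (d + i)) (S i)) \<union> B (d + k + 1) \<union>
          (\<Union>j\<in>{0..d + k}. z_times n (2 * j + 1) (B (d + k - j)))))"
    if k: "\<delta> - d = 2 * k + 1" for k
  proof -
    obtain S :: "nat \<Rightarrow> nat set" where S: "\<forall>i\<in>{1..k}. S i \<subseteq> {1..a (d + i)} \<and> card (S i) = a i \<and>
      select (B (d + i)) (S i) = G.new_std (d + i)"
      using positions[of k] k by auto
    have "G.socle_deg = 2 * (e n + k)" using socle k d_less en by simp
    from G.initial_ideal_odd[OF this] S show ?thesis
      unfolding Suc_eq_plus1[of n, symmetric]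
      by (intro exI[of _ S]) (simp add: en I_eq Ig_eq B_eq first del: One_nat_def)
  qed
  \<comment> \<open>The third claim is the odd case with \<open>k = 0\<close>, where no sets
    \<open>S_i\<close> occur.\<close>
  show ?thesis
    using even odd odd[of 0] by simp
qed

end
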